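(* For sufficiently small $h$ (with $\delta=\bar c\,h$), $$|||\boldsymbol{v}_h|||^2\le 3\,a_h(\boldsymbol{v}_h,\boldsymbol{v}_h)\qquad\text{for all } \boldsymbol{v}_h\in\boldsymbol{W}_h .$$
   Context: Setting. $X\subset\mathbb{R}^d$ ($d=2,3$) is a bounded domain with smooth boundary $\partial X$ and unit outward normal $\boldsymbol{n}$ on $\partial X$; $\Omega$ is the unit circle ($d=2$) or unit sphere ($d=3$). A quadrature on $\Omega$ is fixed: nodes $\boldsymbol{\omega}_l\in\Omega$ and weights $w_l>0$, $0\le l\le L$. The phase function $g(\boldsymbol{x},t)\ge 0$ satisfies $\int_\Omega g(\boldsymbol{x},\boldsymbol{\omega}\cdot\hat{\boldsymbol{\omega}})\,d\sigma(\hat{\boldsymbol{\omega}})=1$ for all $\boldsymbol{x}\in X$, $\boldsymbol{\omega}\in\Omega$. Put $m(\boldsymbol{x})=\max_{0\le l\le L}\sum_{i=0}^L w_i\,g(\boldsymbol{x},\boldsymbol{\omega}_l\cdot\boldsymbol{\omega}_i)$. The coefficients satisfy $\sigma_t,\sigma_s\in L^\infty(X)$, $\sigma_s\ge0$ a.e. in $X$, $\sigma_t-\sigma_s\ge c_0$ in $X$ for a constant $c_0>0$, and $\sigma_t-m\sigma_s\ge c_0'$ in $X$ for a constant $c_0'>0$. Mesh. $\{T_h\}_h$ is a regular family of finite element partitions of $X$ with mesh size parameter $h$. For a direction $\boldsymbol{\omega}_l$: $\partial^l_-X=\{\boldsymbol{x}\in\partial X:\boldsymbol{\omega}_l\cdot\boldsymbol{n}<0\}$,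 $\partial^l_+X=\{\boldsymbol{x}\in\partial X:\boldsymbol{\omega}_l\cdot\boldsymbol{n}\ge0\}$, and for $K\in T_h$, with $\boldsymbol{n}$ the unit outward normal to $\partial K$, $\partial^l_-K=\{\boldsymbol{x}\in\partial K:\boldsymbol{\omega}_l\cdot\boldsymbol{n}<0\}$, $\partial^l_+K=\{\boldsymbol{x}\in\partial K:\boldsymbol{\omega}_l\cdot\boldsymbol{n}\ge0\}$; each face (edge if $d=2$) of an element is either incoming or outgoing. Traces and jumps. On an interior face $e$ shared by $K^l_-$ and $K^l_+$, where the normal to $e$ pointing from $K^l_-$ to $K^l_+$ has nonnegative inner product with $\boldsymbol{\omega}_l$, write $v^l_\pm=v^l|_{K^l_\pm}$ and $[v^l]=v^l_+-v^l_-$ on $e$. On faces contained in $\partial^l_-X$, $v^l_+$ is the trace from inside $X$ and $v^l_-:=0$, so $[v^l]=v^l_+$ there. On faces contained in $\partial^l_+X$, $v^l_-$ is the trace from inside $X$. $(\cdot,\cdot)_D$ and $\langle\cdot,\cdot\rangle_{\Gamma}$ are the $L^2$ inner products on $D$ and on a boundary part $\Gamma$; $\|\cdot\|_{0,K}$ is the $L^2(K)$ norm. Spaces. $W_h^l=\{w\in L^2(X): w|_K\in C(K)\cap H^1(K)\ \forall K\in T_h\}$ and $\boldsymbol{W}_h=(W_h^l)^{L+1}$, with elements $\boldsymbol{v}_h=\{v_h^l\}_{l=0}^L$. Bilinear form. With $\delta=\bar c\,h$, $\bar c>0$ a fixed constant, $$a_h(\boldsymbol{u}_h,\boldsymbol{v}_h)=\sum_{l=0}^Lw_l\sum_{K\in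 T_h}\big(\boldsymbol{\omega}_l\cdot\nabla u_h^l+\sigma_tu_h^l,\;v_h^l+\delta\,\boldsymbol{\omega}_l\cdot\nabla v_h^l\big)_K+\sum_{l=0}^Lw_l\sum_{K\in T_h}\big\langle[u_h^l],v^l_+|\boldsymbol{\omega}_l\cdot\boldsymbol{n}|\big\rangle_{\partial^l_-K}$$ $$-\sum_{l=0}^Lw_l\sum_{K\in T_h}\Big(\sigma_s\sum_{i=0}^Lw_i\,g(\cdot,\boldsymbol{\omega}_l\cdot\boldsymbol{\omega}_i)u_h^i,\;v_h^l+\delta\,\boldsymbol{\omega}_l\cdot\nabla v_h^l\Big)_K .$$ Norm. $$|||\boldsymbol{v}_h|||^2=\sum_{l=0}^Lw_l\sum_{K\in T_h}c_0'\|v_h^l\|_{0,K}^2+\sum_{l=0}^Lw_l\sum_{\partial^l_+K\subset\partial^l_+X}\langle v^l_-,v^l_-\,\boldsymbol{\omega}_l\cdot\boldsymbol{n}\rangle_{\partial^l_+K}+\delta\sum_{l=0}^Lw_l\sum_{K\in T_h}\|\boldsymbol{\omega}_l\cdot\nabla v_h^l\|_{0,K}^2+\sum_{l=0}^Lw_l\sum_{K\in T_h}\langle[v_h^l],[v_h^l]|\boldsymbol{\omega}_l\cdot\boldsymbol{n}|\rangle_{\partial^l_-K},$$ where the second sum runs over the element faces in $\partial^l_+K$ that lie on $\partial^l_+X$. *)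

theory Defs
  imports "HOL-Analysis.Analysis"
begin

section \<open>Differentiability classes and domains with smooth boundary\<close>

text \<open>Meant for open \<open>U\<close> in a finite-dimensional space, where it is the usual class \<open>C^k(U)\<close>.\<close>

primrec C_k_on :: "nat \<Rightarrow> 'a::real_normed_vector set \<Rightarrow> ('a \<Rightarrow> 'b::real_normed_vector) \<Rightarrow> bool" where
  "C_k_on 0 U f \<longleftrightarrow> continuous_on U f"
| "C_k_on (Suc k) U f \<longleftrightarrow>
     (\<exists>f'. (\<forall>x\<in>U. (f has_derivative f' x) (at x)) \<and> (\<forall>v. C_k_on k U (\<lambda>x. f' x v)))"

definition smooth_boundary :: "'a::euclidean_space set \<Rightarrow> bool" where
  "smooth_boundary X \<longleftrightarrow>
     (\<forall>p\<in>frontier X. \<exists>U (\<rho> :: 'a \<Rightarrow> real) D. open U \<and> p \<in> U \<and> (\<forall>k. C_k_on k U \<rho>) \<and>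
        (\<rho> has_derivative D) (at p) \<and> D \<noteq> (\<lambda>_. 0) \<and> X \<inter> U = {x\<in>U. \<rho> x < 0})"

definition bounded_smooth_domain :: "'a::euclidean_space set \<Rightarrow> bool" where
  "bounded_smooth_domain X \<longleftrightarrow>
     open X \<and> connected X \<and> X \<noteq> {} \<and> bounded X \<and> smooth_boundary X"

text \<open>\<open>\<nu>\<close> is the unit outward normal of \<open>S\<close> at the boundary point \<open>p\<close>: near \<open>p\<close>, the interior of
  \<open>S\<close> is a strict sublevel set of a \<open>C^1\<close> function whose gradient at \<open>p\<close> is a positive multiple
  of \<open>\<nu>\<close>. No such \<open>\<nu>\<close> exists at an edge or a corner of \<open>S\<close>.\<close>

definition is_outward_normal :: "'a::euclidean_space set \<Rightarrow> 'a \<Rightarrow> 'a \<Rightarrow> bool" where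
  "is_outward_normal S p \<nu> \<longleftrightarrow> norm \<nu> = 1 \<and>
     (\<exists>U (\<rho> :: 'a \<Rightarrow> real) c. open U \<and> p \<in> U \<and> C_k_on 1 U \<rho> \<and> \<rho> p = 0 \<and> c > 0 \<and>
        (\<rho> has_derivative (\<lambda>y. c * (\<nu> \<bullet> y))) (at p) \<and> interior S \<inter> U = {x\<in>U. \<rho> x < 0})"

definition outward_normal :: "'a::euclidean_space set \<Rightarrow> 'a \<Rightarrow> 'a" where
  "outward_normal S p = (THE \<nu>. is_outward_normal S p \<nu>)"

definition inflow_boundary :: "'a::euclidean_space \<Rightarrow> 'a set \<Rightarrow> 'a set" where
  "inflow_boundary \<omega> S = {x\<in>frontier S. \<exists>\<nu>. is_outward_normal S x \<nu> \<and> \<omega> \<bullet> \<nu> < 0}"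

definition outflow_boundary :: "'a::euclidean_space \<Rightarrow> 'a set \<Rightarrow> 'a set" where
  "outflow_boundary \<omega> S = {x\<in>frontier S. \<exists>\<nu>. is_outward_normal S x \<nu> \<and> \<omega> \<bullet> \<nu> \<ge> 0}"


section \<open>Function spaces\<close>

definition L2_on :: "'a::euclidean_space set \<Rightarrow> ('a \<Rightarrow> real) \<Rightarrow> bool" where
  "L2_on S f \<longleftrightarrow> f \<in> borel_measurable (lebesgue_on S) \<and> integrable (lebesgue_on S) (\<lambda>x. (f x)\<^sup>2)"

definition Linf_on :: "'a::euclidean_space set \<Rightarrow> ('a \<Rightarrow> real) \<Rightarrow> bool" where
  "Linf_on S f \<longleftrightarrow> f \<in> borel_measurable (lebesgue_on S) \<and> (\<exists>C. AE x in lebesgue_on S. \<bar>f x\<bar> \<le> C)"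

definition l2_inner :: "'a::euclidean_space set \<Rightarrow> ('a \<Rightarrow> real) \<Rightarrow> ('a \<Rightarrow> real) \<Rightarrow> real" where
  "l2_inner S f g = (LINT x:S|lebesgue. f x * g x)"

definition l2_norm :: "'a::euclidean_space set \<Rightarrow> ('a \<Rightarrow> real) \<Rightarrow> real" where
  "l2_norm S f = sqrt (l2_inner S f f)"

definition test_function :: "'a::euclidean_space set \<Rightarrow> ('a \<Rightarrow> real) \<Rightarrow> bool" where
  "test_function U \<phi> \<longleftrightarrow> (\<forall>k. C_k_on k UNIV \<phi>) \<and>
     compact (closure {x. \<phi> x \<noteq> 0}) \<and> closure {x. \<phi> x \<noteq> 0} \<subseteq> U"

definition is_L2_weak_gradient ::
  "(real^'n) set \<Rightarrow> (real^'n \<Rightarrow> real) \<Rightarrow> (real^'n \<Rightarrow> real^'n) \<Rightarrow> bool" where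
  "is_L2_weak_gradient U f G \<longleftrightarrow> (\<forall>i. L2_on U (\<lambda>x. G x $ i) \<and>
     (\<forall>\<phi>. test_function U \<phi> \<longrightarrow>
        (LINT x:U|lebesgue. f x * frechet_derivative \<phi> (at x) (axis i 1)) =
        - (LINT x:U|lebesgue. G x $ i * \<phi> x)))"

definition H1_on :: "(real^'n) set \<Rightarrow> (real^'n \<Rightarrow> real) \<Rightarrow> bool" where
  "H1_on U f \<longleftrightarrow> L2_on U f \<and> (\<exists>G. is_L2_weak_gradient U f G)"

text \<open>The weak gradient is unique up to a null set; an arbitrary representative is chosen.\<close>

definition weak_gradient :: "(real^'n) set \<Rightarrow> (real^'n \<Rightarrow> real) \<Rightarrow> real^'n \<Rightarrow> real^'n" where
  "weak_gradient U f = (SOME G. is_L2_weak_gradient U f G)"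


section \<open>Finite element partitions\<close>

text \<open>A smoothly bounded domain has no partition into straight-sided elements, so elements may be
  curved: an element is the image \<open>K = F(P)\<close> of a reference polytope \<open>P\<close> (a simplex, a box, ...)
  under a \<open>C^1\<close> diffeomorphism \<open>F\<close> defined in a neighbourhood of \<open>P\<close>. Straight-sided elements
  have an affine \<open>F\<close>. The faces of \<open>K\<close> (edges in the plane) are the images of the facets of \<open>P\<close>.\<close>

record 'v element =
  ref :: "'v set"
  emap :: "'v \<Rightarrow> 'v"

definition body :: "'v element \<Rightarrow> 'v set" where
  "body E = emap E ` ref E"

definition is_element :: "(real^'n) element \<Rightarrow> bool" where
  "is_element E \<longleftrightarrow> polytope (ref E) \<and> interior (ref E) \<noteq> {} \<and>
     (\<exists>U. open U \<and> ref E \<subseteq> U \<and> C_k_on 1 U (emap E) \<and> inj_on (emap E) U \<and>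
        (\<forall>y\<in>U. det (jacobian (emap E) (at y)) \<noteq> 0))"

definition faces :: "(real^'n) element \<Rightarrow> (real^'n) set set" where
  "faces E = {emap E ` f |f. f facet_of ref E}"

definition ref_facet :: "(real^'n) element \<Rightarrow> (real^'n) set \<Rightarrow> (real^'n) set" where
  "ref_facet E e = {y\<in>ref E. emap E y \<in> e}"

text \<open>A face without its relative boundary, which is negligible and where no normal is defined.\<close>

definition open_face :: "(real^'n) element \<Rightarrow> (real^'n) set \<Rightarrow> (real^'n) set" where
  "open_face E e = emap E ` rel_interior (ref_facet E e)"

definition facet_normal :: "(real^'n) set \<Rightarrow> (real^'n) set \<Rightarrow> real^'n" where
  "facet_normal P f =
     (THE a. norm a = 1 \<and> (\<exists>b. P \<subseteq> {x. a \<bullet> x \<le> b} \<and> f = P \<inter> {x. a \<bullet> x = b}))"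

text \<open>Surface element of \<open>F\<close> at a point \<open>y\<close> of a hypersurface with unit normal \<open>a\<close>: the factor
  \<open>|det DF(y)| |DF(y)^{-T} a|\<close> by which the linear map \<open>DF(y)\<close> scales \<open>(d-1)\<close>-dimensional volume
  in the hyperplane orthogonal to \<open>a\<close>.\<close>

definition surface_element :: "(real^'n \<Rightarrow> real^'n) \<Rightarrow> real^'n \<Rightarrow> real^'n \<Rightarrow> real" where
  "surface_element F a y =
     \<bar>det (jacobian F (at y))\<bar> * norm (matrix_inv (transpose (jacobian F (at y))) *v a)"

text \<open>Surface measure on a face \<open>e = F(f)\<close>. By Fubini, \<open>(d-1)\<close>-dimensional Lebesgue measure on the
  flat facet \<open>f\<close> with unit normal \<open>a\<close> is the image of \<open>d\<close>-dimensional Lebesgue measure on the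
  right prism of height 1 over \<open>f\<close> under the orthogonal projection onto \<open>f\<close> (on the prism this
  projection is \<open>closest_point f\<close>). It is weighted by the surface element and transported to \<open>e\<close>
  by \<open>F\<close>.\<close>

definition face_measure :: "(real^'n) element \<Rightarrow> (real^'n) set \<Rightarrow> (real^'n) measure" where
  "face_measure E e =
     (let f = ref_facet E e; a = facet_normal (ref E) f; \<pi> = closest_point f
      in distr (density (lebesgue_on {y + t *\<^sub>R a |y t. y \<in> f \<and> 0 \<le> t \<and> t \<le> 1})
                  (\<lambda>x. ennreal (surface_element (emap E) a (\<pi> x))))
           borel (\<lambda>x. emap E (\<pi> x)))"

definition face_inner ::
  "(real^'n) element \<Rightarrow> (real^'n) set \<Rightarrow> (real^'n \<Rightarrow> real) \<Rightarrow> (real^'n \<Rightarrow> real) \<Rightarrow> real" where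
  "face_inner E e p q = (LINT x:open_face E e|face_measure E e. p x * q x)"

definition incoming_face :: "real^'n \<Rightarrow> (real^'n) element \<Rightarrow> (real^'n) set \<Rightarrow> bool" where
  "incoming_face \<omega> E e \<longleftrightarrow> open_face E e \<subseteq> inflow_boundary \<omega> (body E)"

definition outgoing_face :: "real^'n \<Rightarrow> (real^'n) element \<Rightarrow> (real^'n) set \<Rightarrow> bool" where
  "outgoing_face \<omega> E e \<longleftrightarrow> open_face E e \<subseteq> outflow_boundary \<omega> (body E)"

definition fe_partition :: "(real^'n) set \<Rightarrow> (real^'n) element set \<Rightarrow> bool" where
  "fe_partition X T \<longleftrightarrow> finite T \<and> (\<forall>E\<in>T. is_element E) \<and>
     (\<Union>E\<in>T. body E) = closure X \<and>
     (\<forall>E\<in>T. \<forall>E'\<in>T. E \<noteq> E' \<longrightarrow> interior (body E) \<inter> interior (body E') = {}) \<and>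
     (\<forall>E\<in>T. \<forall>e\<in>faces E. e \<subseteq> frontier X \<or> (\<exists>!E'. E' \<in> T \<and> E' \<noteq> E \<and> e \<in> faces E'))"

definition inball_diameter :: "'a::euclidean_space set \<Rightarrow> real" where
  "inball_diameter S = Sup {2 * r |r c. r \<ge> 0 \<and> cball c r \<subseteq> S}"

definition mesh_size :: "(real^'n) element set \<Rightarrow> real" where
  "mesh_size T = Max ((\<lambda>E. diameter (body E)) ` T)"

text \<open>\<open>H\<close> is the set of mesh parameters of the family; regularity is meant in the sense of Ciarlet
  (bounded ratio of diameter to inball diameter, and mesh sizes approaching 0).\<close>

definition regular_family ::
  "(real^'n) set \<Rightarrow> real set \<Rightarrow> (real \<Rightarrow> (real^'n) element set) \<Rightarrow> bool" where
  "regular_family X H T \<longleftrightarrow> H \<subseteq> {0<..} \<and> (\<forall>\<epsilon>>0. \<exists>h\<in>H. h < \<epsilon>) \<and>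
     (\<forall>h\<in>H. fe_partition X (T h) \<and> mesh_size (T h) = h) \<and>
     (\<exists>\<kappa>>0. \<forall>h\<in>H. \<forall>E\<in>T h. diameter (body E) \<le> \<kappa> * inball_diameter (body E))"


section \<open>The discrete-ordinate scheme\<close>

text \<open>Surface measure on the unit sphere (arc length on the unit circle): the measure of \<open>A\<close> is
  \<open>d\<close> times the volume of the cone \<open>{t x | x \<in> A, 0 < t < 1}\<close>.\<close>

definition sphere_measure :: "(real^'n) measure" where
  "sphere_measure = distr (density (lebesgue_on (ball 0 1)) (\<lambda>_. of_nat CARD('n))) borel sgn"

definition phase_function :: "(real^'n) set \<Rightarrow> (real^'n \<Rightarrow> real \<Rightarrow> real) \<Rightarrow> bool" where
  "phase_function X g \<longleftrightarrow>
     (\<lambda>(x, t). g x t) \<in> borel_measurable (lebesgue_on X \<Otimes>\<^sub>M restrict_space borel {-1..1}) \<and>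
     (\<forall>x\<in>X. \<forall>t\<in>{-1..1}. g x t \<ge> 0) \<and>
     (\<forall>x\<in>X. \<forall>\<omega>\<in>sphere (0 :: real^'n) 1. (LINT \<eta>:sphere 0 1|sphere_measure. g x (\<omega> \<bullet> \<eta>)) = 1)"

definition max_scattering ::
  "nat \<Rightarrow> (nat \<Rightarrow> real^'n) \<Rightarrow> (nat \<Rightarrow> real) \<Rightarrow> (real^'n \<Rightarrow> real \<Rightarrow> real) \<Rightarrow> real^'n \<Rightarrow> real" where
  "max_scattering L \<omega> w g x = Max ((\<lambda>l. \<Sum>i\<le>L. w i * g x (\<omega> l \<bullet> \<omega> i)) ` {..L})"

text \<open>The restriction of \<open>v\<close> to the closed element, i.e. its continuous representative there; its
  boundary values are the traces of \<open>v\<close> from inside the element.\<close>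

definition restr :: "(real^'n) element \<Rightarrow> (real^'n \<Rightarrow> real) \<Rightarrow> real^'n \<Rightarrow> real" where
  "restr E v = (SOME c. continuous_on (body E) c \<and> (AE x in lebesgue_on (body E). v x = c x))"

definition broken_space :: "(real^'n) set \<Rightarrow> (real^'n) element set \<Rightarrow> (real^'n \<Rightarrow> real) set" where
  "broken_space X T = {v. L2_on X v \<and>
     (\<forall>E\<in>T. (\<exists>c. continuous_on (body E) c \<and> (AE x in lebesgue_on (body E). v x = c x)) \<and>
             H1_on (interior (body E)) v)}"

definition dir_deriv :: "real^'n \<Rightarrow> (real^'n) element \<Rightarrow> (real^'n \<Rightarrow> real) \<Rightarrow> real^'n \<Rightarrow> real" where
  "dir_deriv \<omega> E v x = \<omega> \<bullet> weak_gradient (interior (body E)) v x"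

definition neighbour :: "(real^'n) element set \<Rightarrow> (real^'n) element \<Rightarrow> (real^'n) set \<Rightarrow> (real^'n) element" where
  "neighbour T E e = (THE E'. E' \<in> T \<and> E' \<noteq> E \<and> e \<in> faces E')"

text \<open>The jump across an incoming face \<open>e\<close> of \<open>E\<close>: there \<open>E\<close> is the downwind element \<open>K_+\<close> and its
  neighbour the upwind element \<open>K_-\<close>; on the boundary of \<open>X\<close> the upwind value is 0.\<close>

definition jump :: "(real^'n) set \<Rightarrow> (real^'n) element set \<Rightarrow> (real^'n) element \<Rightarrow> (real^'n) set
    \<Rightarrow> (real^'n \<Rightarrow> real) \<Rightarrow> real^'n \<Rightarrow> real" where
  "jump X T E e v x =
     restr E v x - (if e \<subseteq> frontier X then 0 else restr (neighbour T E e) v x)"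

definition scheme_form ::
  "(real^'n) set \<Rightarrow> nat \<Rightarrow> (nat \<Rightarrow> real^'n) \<Rightarrow> (nat \<Rightarrow> real) \<Rightarrow> (real^'n \<Rightarrow> real \<Rightarrow> real) \<Rightarrow>
   (real^'n \<Rightarrow> real) \<Rightarrow> (real^'n \<Rightarrow> real) \<Rightarrow> (real^'n) element set \<Rightarrow> real \<Rightarrow>
   (nat \<Rightarrow> real^'n \<Rightarrow> real) \<Rightarrow> (nat \<Rightarrow> real^'n \<Rightarrow> real) \<Rightarrow> real" where
  "scheme_form X L \<omega> w g \<sigma>t \<sigma>s T \<delta> u v =
     (\<Sum>l\<le>L. w l * (\<Sum>E\<in>T. l2_inner (body E)
        (\<lambda>x. dir_deriv (\<omega> l) E (u l) x + \<sigma>t x * u l x)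
        (\<lambda>x. v l x + \<delta> * dir_deriv (\<omega> l) E (v l) x)))
   + (\<Sum>l\<le>L. w l * (\<Sum>E\<in>T. \<Sum>e | e \<in> faces E \<and> incoming_face (\<omega> l) E e. face_inner E e
        (jump X T E e (u l))
        (\<lambda>x. restr E (v l) x * \<bar>\<omega> l \<bullet> outward_normal (body E) x\<bar>)))
   - (\<Sum>l\<le>L. w l * (\<Sum>E\<in>T. l2_inner (body E)
        (\<lambda>x. \<sigma>s x * (\<Sum>i\<le>L. w i * g x (\<omega> l \<bullet> \<omega> i) * u i x))
        (\<lambda>x. v l x + \<delta> * dir_deriv (\<omega> l) E (v l) x)))"

text \<open>The square of the mesh-dependent norm; the parameter \<open>c\<close> is the constant \<open>c_0'\<close> from the
  coercivity condition \<open>\<sigma>_t - m \<sigma>_s \<ge> c_0'\<close>.\<close>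

definition scheme_norm_sq ::
  "(real^'n) set \<Rightarrow> nat \<Rightarrow> (nat \<Rightarrow> real^'n) \<Rightarrow> (nat \<Rightarrow> real) \<Rightarrow> real \<Rightarrow>
   (real^'n) element set \<Rightarrow> real \<Rightarrow> (nat \<Rightarrow> real^'n \<Rightarrow> real) \<Rightarrow> real" where
  "scheme_norm_sq X L \<omega> w c T \<delta> v =
     (\<Sum>l\<le>L. w l * (\<Sum>E\<in>T. c * (l2_norm (body E) (v l))\<^sup>2))
   + (\<Sum>l\<le>L. w l * (\<Sum>E\<in>T. \<Sum>e | e \<in> faces E \<and> outgoing_face (\<omega> l) E e \<and>
                                     open_face E e \<subseteq> outflow_boundary (\<omega> l) X. face_inner E e
        (restr E (v l))
        (\<lambda>x. restr E (v l) x * (\<omega> l \<bullet> outward_normal (body E) x))))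
   + \<delta> * (\<Sum>l\<le>L. w l * (\<Sum>E\<in>T. (l2_norm (body E) (dir_deriv (\<omega> l) E (v l)))\<^sup>2))
   + (\<Sum>l\<le>L. w l * (\<Sum>E\<in>T. \<Sum>e | e \<in> faces E \<and> incoming_face (\<omega> l) E e. face_inner E e
        (jump X T E e (v l))
        (\<lambda>x. jump X T E e (v l) x * \<bar>\<omega> l \<bullet> outward_normal (body E) x\<bar>)))"

end

theory Submission
  imports Defs
begin

text \<open>Since \<open>(v + \<delta> D)(D + \<sigma>_t v - S)\<close> with \<open>D = \<omega>_l \<cdot> \<nabla>v\<close> and \<open>S\<close> the scattering term is a pointwise
  expression, the volume terms are estimated pointwise: the symmetry of \<open>g(x, \<omega>_l \<cdot> \<omega>_i)\<close> in \<open>l\<close> and \<open>i\<close>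
  and the condition on \<open>m\<close> bound the weighted sum of \<open>S v\<close>, and the weighted sum of \<open>S^2\<close> is at most
  \<open>C^2\<close> times that of \<open>v^2\<close>, where \<open>C\<close> bounds \<open>|\<sigma>_t|\<close>. This costs \<open>2 \<delta> C^2\<close> of the coefficient \<open>c_0'\<close> of
  \<open>v^2\<close>, so \<open>3 \<delta> C^2 \<le> c_0'\<close> leaves a third of it. What remains is \<open>D v\<close>, which Green's formula turns into
  fluxes of \<open>v^2 / 2\<close> through the faces; the fluxes through the two sides of an interior face cancel up
  to squared jumps.

  Green's formula on a curved element is obtained by testing the weak derivative with cutoffs of
  layers along the facets of the reference polytope. No assumption relates the two
  parametrizations of an interior face, so their surface integrals are compared through volume
  integrals.\<close>


section \<open>Smooth mollifiers\<close>

text \<open>The cutoffs near the facets are pulled back by the inverse of a map that is merely C^1,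
  so they are not admissible in the definition of the weak gradient. The weak derivative of
  \<open>v^2\<close> is therefore tested with functions that have one continuous derivative along
  \<omega> (\<open>dir_test\<close>). The profile \<open>cutoff\<close> is tuned to
  \<open>face_measure\<close>: its slope tends to twice the indicator of (1/2, 1], and blowing up a
  boundary layer turns this interval into the prism of height 1 by which surface measure is defined.
  Fluxes thus arrive directly in the form of prism integrals. The single constant \<open>C\<close>
  controls two things: it bounds |\<sigma>_t|, and since \<sigma>_s times a row sum of the
  scattering matrix is at most \<sigma>_t - c_0', it bounds these row sums too. The factor 3 comes
  from the \<open>v^2\<close> term; jumps, boundary fluxes and derivatives are left with the
  coefficient 1/2, for which 2 would do.\<close>

definition bump_pow :: "nat \<Rightarrow> real \<Rightarrow> real" where
  "bump_pow n t = (if t > 0 then exp (-1/t) / t ^ n else 0)"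

text \<open>With \<open>u = 1/t\<close> the right limit is that of \<open>u^n / exp u\<close>; the
  left one is trivial. This flatness supplies the derivative at 0.\<close>

lemma bump_pow_tendsto_0: "(bump_pow n \<longlongrightarrow> 0) (at 0)"
proof -
  have "((\<lambda>t::real. (inverse t) ^ n / exp (inverse t)) \<longlongrightarrow> 0) (at_right 0)"
    by (rule filterlim_compose[OF tendsto_power_div_exp_0 filterlim_inverse_at_top_right])
  moreover have "eventually (\<lambda>t::real. (inverse t) ^ n / exp (inverse t) = bump_pow n t) (at_right 0)"
    unfolding eventually_at_right_field
    by (rule exI[of _ 1]) (auto simp: bump_pow_def exp_minus field_simps)
  ultimately have "(bump_pow n \<longlongrightarrow> 0) (at_right 0)"
    by (rule Lim_transform_eventually)
  moreover have "eventually (\<lambda>t::real. 0 = bump_pow n t) (at_left 0)"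
    unfolding eventually_at_left_field by (rule exI[of _ "-1"]) (auto simp: bump_pow_def)
  then have "(bump_pow n \<longlongrightarrow> 0) (at_left 0)"
    using Lim_transform_eventually tendsto_const by blast
  ultimately show ?thesis
    by (simp add: filterlim_split_at_real)
qed

text \<open>Dividing by powers of \<open>t\<close> makes the family closed under differentiation up
  to linear combinations, so that smoothness of \<open>bump_pow 0\<close> follows by induction
  without formulas for higher derivatives.\<close>

lemma bump_pow_has_real_derivative:
  "(bump_pow n has_real_derivative bump_pow (n + 2) t - real n * bump_pow (n + 1) t) (at t)"
proof (cases t "0::real" rule: linorder_cases)
  case greater
  have "((\<lambda>t. exp (-1/t) / t ^ n) has_real_derivative
      bump_pow (n + 2) t - real n * bump_pow (n + 1) t) (at t)"
  proof -
    have pow: "real n * t ^ (n - 1) = real n * t ^ n / t"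
      using greater by (cases n) auto
    have "((\<lambda>t. exp (-1/t) / t ^ n) has_real_derivative
        ((exp (-1/t) * (1 / t\<^sup>2)) * t ^ n - exp (-1/t) * (real n * t ^ (n - 1))) / (t ^ n * t ^ n)) (at t)"
      using greater by (auto intro!: derivative_eq_intros simp: power2_eq_square)
    then show ?thesis
      unfolding pow
      by (rule DERIV_cong) (use greater in \<open>simp add: bump_pow_def field_simps power2_eq_square\<close>)
  qed
  then show ?thesis
    by (rule has_field_derivative_transform_within_open[where S = "{0<..}"])
      (use greater in \<open>auto simp: bump_pow_def\<close>)
next
  case less
  have "((\<lambda>t. 0) has_real_derivative
      bump_pow (n + 2) t - real n * bump_pow (n + 1) t) (at t)"
    using less by (simp add: bump_pow_def)
  then show ?thesis
    by (rule has_field_derivative_transform_within_open[where S = "{..<0}"])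
      (use less in \<open>auto simp: bump_pow_def\<close>)
next
  case equal
  \<comment> \<open>At 0 the difference quotient of \<open>bump_pow n\<close> is exactly
    \<open>bump_pow (n + 1)\<close>, which tends to 0.\<close>
  have "eventually (\<lambda>h. bump_pow (n + 1) h = (bump_pow n (0 + h) - bump_pow n 0) / h) (at 0)"
    by (rule eventually_at_filter[THEN iffD2], rule always_eventually)
      (auto simp: bump_pow_def field_simps)
  from Lim_transform_eventually[OF bump_pow_tendsto_0 this] show ?thesis
    unfolding DERIV_def using equal by (simp add: bump_pow_def)
qed

text \<open>A class that contains the directional derivatives of its members lies in
  \<open>C_k_on k\<close> for every \<open>k\<close>. The bumps have the argument
  \<open>c - x\<close> because a mollifier is later regarded as a function of the subtracted
  variable.\<close>

inductive smooth_gen :: "('a::real_inner \<Rightarrow> real) \<Rightarrow> bool" where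
  const: "smooth_gen (\<lambda>x. c)"
| inner: "smooth_gen (\<lambda>x. x \<bullet> v)"
| bump: "smooth_gen (\<lambda>x. bump_pow n (r - (c - x) \<bullet> (c - x)))"
| add: "smooth_gen f \<Longrightarrow> smooth_gen g \<Longrightarrow> smooth_gen (\<lambda>x. f x + g x)"
| mult: "smooth_gen f \<Longrightarrow> smooth_gen g \<Longrightarrow> smooth_gen (\<lambda>x. f x * g x)"

lemma bump_has_derivative:
  fixes c :: "'a::real_inner"
  shows "((\<lambda>x. bump_pow n (r - (c - x) \<bullet> (c - x))) has_derivative
    (\<lambda>v. (bump_pow (n + 2) (r - (c - x) \<bullet> (c - x)) - real n * bump_pow (n + 1) (r - (c - x) \<bullet> (c - x)))
      * (2 * (c \<bullet> v) - 2 * (x \<bullet> v)))) (at x)"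
proof -
  have "((\<lambda>x. r - (c - x) \<bullet> (c - x)) has_derivative (\<lambda>v. 2 * (c \<bullet> v) - 2 * (x \<bullet> v))) (at x)"
    by (auto intro!: derivative_eq_intros simp: fun_eq_iff inner_commute algebra_simps)
  from has_derivative_compose[OF this bump_pow_has_real_derivative[unfolded has_field_derivative_def]]
  show ?thesis by simp
qed

lemma smooth_gen_derivative:
  assumes "smooth_gen f"
  shows "\<exists>f'. (\<forall>x. (f has_derivative f' x) (at x)) \<and> (\<forall>v. smooth_gen (\<lambda>x. f' x v))"
  using assms
proof induction
  case (const c)
  show ?case by (rule exI[of _ "\<lambda>x v. 0"]) (auto intro: smooth_gen.const)
next
  case (inner v)
  show ?case
    by (rule exI[of _ "\<lambda>x u. u \<bullet> v"])
      (auto intro: smooth_gen.const intro!: derivative_eq_intros)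
next
  case (bump n r c)
  have 1: "smooth_gen (\<lambda>x. (bump_pow (n + 2) (r - (c - x) \<bullet> (c - x))
       + - real n * bump_pow (n + 1) (r - (c - x) \<bullet> (c - x))) * (2 * (c \<bullet> v) + - 2 * (x \<bullet> v)))" for v
    by (intro smooth_gen.intros)
  show ?case
    by (rule exI, rule conjI, rule allI, rule bump_has_derivative) (use 1 in simp)
next
  case (add f g)
  then obtain f' g' where "\<And>x. (f has_derivative f' x) (at x)" "\<And>v. smooth_gen (\<lambda>x. f' x v)"
    "\<And>x. (g has_derivative g' x) (at x)" "\<And>v. smooth_gen (\<lambda>x. g' x v)" by blast
  then show ?case
    by (intro exI[of _ "\<lambda>x v. f' x v + g' x v"]) (auto intro: smooth_gen.intros has_derivative_add)
next
  case (mult f g)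
  then obtain f' g' where "\<And>x. (f has_derivative f' x) (at x)" "\<And>v. smooth_gen (\<lambda>x. f' x v)"
    "\<And>x. (g has_derivative g' x) (at x)" "\<And>v. smooth_gen (\<lambda>x. g' x v)" by blast
  with mult.hyps show ?case
    by (intro exI[of _ "\<lambda>x v. f x * g' x v + f' x v * g x"] conjI allI has_derivative_mult
        smooth_gen.add smooth_gen.mult)
qed

lemma smooth_gen_imp_C_k: "smooth_gen f \<Longrightarrow> C_k_on k UNIV f"
proof (induction k arbitrary: f)
  case 0
  then show ?case
    using smooth_gen_derivative[OF 0] has_derivative_continuous continuous_at_imp_continuous_on
    by (metis C_k_on.simps(1))
next
  case (Suc k)
  from smooth_gen_derivative[OF Suc.prems] Suc.IH show ?case
    unfolding C_k_on.simps by blast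
qed

section \<open>The normalised mollifier, its support and its integral\<close>

definition mollifier :: "real \<Rightarrow> 'a::euclidean_space \<Rightarrow> real" where
  "mollifier r z = bump_pow 0 (r\<^sup>2 - z \<bullet> z) / (LINT y|lborel. bump_pow 0 (r\<^sup>2 - (y::'a) \<bullet> y))"

text \<open>The derivative of \<open>mollifier r\<close> along \<omega>: the derivative of
  \<open>bump_pow 0\<close> is \<open>bump_pow 2\<close>, and the chain rule adds the factor
  \<open>- 2 * (z \<bullet> \<omega>)\<close>.\<close>

definition mollifier_deriv :: "real \<Rightarrow> 'a::euclidean_space \<Rightarrow> 'a \<Rightarrow> real" where
  "mollifier_deriv r \<omega> z =
     bump_pow 2 (r\<^sup>2 - z \<bullet> z) * (- 2 * (z \<bullet> \<omega>)) / (LINT y|lborel. bump_pow 0 (r\<^sup>2 - (y::'a) \<bullet> y))"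

lemma bump_pow_nonneg: "bump_pow n t \<ge> 0"
  by (simp add: bump_pow_def)

lemma continuous_bump_pow: "continuous_on S (bump_pow n)"
  by (rule DERIV_continuous_on) (rule DERIV_subset[OF bump_pow_has_real_derivative subset_UNIV])

lemma bump_pow_zero: "r > 0 \<Longrightarrow> norm z \<ge> r \<Longrightarrow> bump_pow n (r\<^sup>2 - z \<bullet> z) = 0"
  for z :: "'a::real_inner"
  using power_mono[of r "norm z" 2] by (auto simp: bump_pow_def power2_norm_eq_inner)

lemma continuous_bump: "continuous_on S (\<lambda>z::'a::real_inner. bump_pow n (r - z \<bullet> z))"
  by (rule continuous_on_compose2[OF continuous_bump_pow[of UNIV]]) (auto intro!: continuous_intros)

lemma continuous_compact_support_integrable:
  fixes f :: "'a::euclidean_space \<Rightarrow> real"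
  assumes "continuous_on UNIV f" "compact C" "\<And>x. x \<notin> C \<Longrightarrow> f x = 0"
  shows "integrable lborel f"
proof -
  have "integrable lborel (\<lambda>x. indicator C x *\<^sub>R f x)"
    using borel_integrable_compact[OF assms(2) continuous_on_subset[OF assms(1)]]
    by (simp add: set_integrable_def)
  moreover have "(\<lambda>x. indicator C x *\<^sub>R f x) = f"
    using assms(3) by (auto simp: indicator_def fun_eq_iff)
  ultimately show ?thesis by simp
qed

lemma continuous_compact_support_bounded:
  fixes f :: "'a::euclidean_space \<Rightarrow> real"
  assumes "continuous_on UNIV f" "compact C" "\<And>x. x \<notin> C \<Longrightarrow> f x = 0"
  obtains B where "B > 0" "\<And>x. \<bar>f x\<bar> \<le> B"
proof -
  have "bounded (f ` C)"
    by (intro compact_imp_bounded compact_continuous_image continuous_on_subset[OF assms(1)] assms) auto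
  then obtain B where "B > 0" "\<And>x. x \<in> C \<Longrightarrow> \<bar>f x\<bar> \<le> B"
    by (auto simp: bounded_pos)
  then show ?thesis by (intro that[of B]) (metis abs_zero assms(3) less_imp_le)+
qed

text \<open>A nonnegative integrand with integral 0 vanishes almost everywhere, but this one is
  positive on an open ball.\<close>

lemma bump_integral_pos:
  assumes "r > 0"
  shows "(LINT y|lborel. bump_pow 0 (r\<^sup>2 - (y::'a::euclidean_space) \<bullet> y)) > 0"
proof -
  let ?b = "\<lambda>y::'a. bump_pow 0 (r\<^sup>2 - y \<bullet> y)"
  have int: "integrable lborel ?b"
    by (rule continuous_compact_support_integrable[where C = "cball 0 r"])
      (use assms in \<open>auto intro!: continuous_bump bump_pow_zero\<close>)
  have "(LINT y|lborel. ?b y) \<noteq> 0"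
  proof
    assume "(LINT y|lborel. ?b y) = 0"
    then have "AE y in lborel. ?b y = 0"
      using integral_nonneg_eq_0_iff_AE[OF int] by (simp add: bump_pow_nonneg)
    moreover have "?b y \<noteq> 0" if "y \<in> ball 0 r" for y :: 'a
      using that power_strict_mono[of "norm y" r 2] by (auto simp: bump_pow_def power2_norm_eq_inner)
    ultimately have "AE y in lborel. y \<notin> ball (0::'a) r"
      by (elim AE_mp) (auto intro!: AE_I2)
    then have "emeasure lborel (ball (0::'a) r) = 0"
      by (simp add: AE_iff_measurable[OF _ refl] ball_def dist_norm)
    then have "negligible (ball (0::'a) r)"
      by (simp add: negligible_iff_emeasure0)
    then show False using assms open_not_negligible[of "ball (0::'a) r"] by auto
  qed
  moreover have "(LINT y|lborel. ?b y) \<ge> 0" by (simp add: bump_pow_nonneg)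
  ultimately show ?thesis by simp
qed

lemma mollifier_nonneg: "r > 0 \<Longrightarrow> mollifier r z \<ge> 0"
  unfolding mollifier_def by (intro divide_nonneg_pos bump_pow_nonneg bump_integral_pos)

lemma mollifier_zero: "r > 0 \<Longrightarrow> norm z \<ge> r \<Longrightarrow> mollifier r z = 0"
  by (simp add: mollifier_def bump_pow_zero)

lemma mollifier_deriv_zero: "r > 0 \<Longrightarrow> norm z \<ge> r \<Longrightarrow> mollifier_deriv r \<omega> z = 0"
  by (simp add: mollifier_deriv_def bump_pow_zero)

lemma continuous_mollifier: "continuous_on S (mollifier r)"
  unfolding mollifier_def
  by (simp only: divide_inverse) (intro continuous_on_mult_right continuous_bump)

lemma continuous_mollifier_deriv: "continuous_on S (mollifier_deriv r \<omega>)"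
  unfolding mollifier_deriv_def
  by (simp only: divide_inverse) (intro continuous_on_mult_right continuous_on_mult continuous_bump continuous_intros)

lemma mollifier_integrable: "r > 0 \<Longrightarrow> integrable lborel (mollifier r)"
  by (rule continuous_compact_support_integrable[where C = "cball 0 r"])
    (auto intro!: continuous_mollifier mollifier_zero)

lemma mollifier_integral: "r > 0 \<Longrightarrow> (LINT z|lborel. mollifier r (z::'a::euclidean_space)) = 1"
  using bump_integral_pos[of r, where 'a = 'a] unfolding mollifier_def by simp

text \<open>The equivalence of integrability makes the identity hold for every \<open>f\<close>,
  since both integrals are 0 when they do not exist.\<close>

lemma integral_reflect:
  fixes f :: "'a::euclidean_space \<Rightarrow> real"
  shows "(LINT y|lborel. f (x - y)) = (LINT y|lborel. f y)"
    and "integrable lborel (\<lambda>y. f (x - y)) \<longleftrightarrow> integrable lborel f"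
proof -
  have eq: "(lborel :: 'a measure) = distr lborel borel (\<lambda>y. x - y)"
    using lborel_affine[of "-1" x] by (simp add: density_1)
  have *: "integrable lborel (\<lambda>y. g (x - y))" if "integrable lborel g" for g :: "'a \<Rightarrow> real"
  proof -
    have "integrable (distr lborel borel (\<lambda>y. x - y)) g" using that eq by simp
    then show ?thesis by (rule integrable_distr[rotated]) simp
  qed
  show iff: "integrable lborel (\<lambda>y. f (x - y)) \<longleftrightarrow> integrable lborel f"
    using *[of f] *[of "\<lambda>y. f (x - y)"] by auto
  show "(LINT y|lborel. f (x - y)) = (LINT y|lborel. f y)"
  proof (cases "integrable lborel f")
    case True
    then have "f \<in> borel_measurable borel" by (simp add: integrable_iff_bounded)
    then have "(LINT y|distr lborel borel (\<lambda>y. x - y). f y) = (LINT y|lborel. f (x - y))"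
      by (intro integral_distr) auto
    then show ?thesis using eq by simp
  next
    case False
    then show ?thesis using iff by (simp add: not_integrable_integral_eq)
  qed
qed

text \<open>A translation is the composition of two reflections.\<close>

lemma integral_translate:
  fixes f :: "'a::euclidean_space \<Rightarrow> real"
  shows "(LINT y|lborel. f (x + y)) = (LINT y|lborel. f y)"
  using integral_reflect(1)[of f x] integral_reflect(1)[of "\<lambda>y. f (x + y)" 0]
  by simp

lemma mollifier_has_derivative:
  fixes x :: "'a::euclidean_space"
  shows "((\<lambda>y. mollifier r (x - y)) has_derivative (\<lambda>v. - mollifier_deriv r v (x - y))) (at y)"
proof -
  let ?Z = "LINT y|lborel. bump_pow 0 (r\<^sup>2 - (y::'a) \<bullet> y)"
  have "((\<lambda>y. bump_pow 0 (r\<^sup>2 - (x - y) \<bullet> (x - y)) / ?Z) has_derivative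
    (\<lambda>v. (bump_pow (0 + 2) (r\<^sup>2 - (x - y) \<bullet> (x - y)) - real 0 * bump_pow (0 + 1) (r\<^sup>2 - (x - y) \<bullet> (x - y)))
      * (2 * (x \<bullet> v) - 2 * (y \<bullet> v)) / ?Z)) (at y)"
    by (rule bounded_linear.has_derivative[OF bounded_linear_divide bump_has_derivative])
  moreover have "(\<lambda>v. (bump_pow (0 + 2) (r\<^sup>2 - (x - y) \<bullet> (x - y)) - real 0 * bump_pow (0 + 1) (r\<^sup>2 - (x - y) \<bullet> (x - y)))
      * (2 * (x \<bullet> v) - 2 * (y \<bullet> v)) / ?Z) = (\<lambda>v. - mollifier_deriv r v (x - y))"
    by (auto simp: mollifier_deriv_def fun_eq_iff inner_diff_left algebra_simps add_divide_distrib diff_divide_distrib numeral_2_eq_2)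
  ultimately show ?thesis unfolding mollifier_def by simp
qed

lemma test_function_mollifier:
  fixes x :: "'a::euclidean_space"
  assumes "r > 0" "cball x r \<subseteq> U"
  shows "test_function U (\<lambda>y. mollifier r (x - y))"
proof -
  have "smooth_gen (\<lambda>y. bump_pow 0 (r\<^sup>2 - (x - y) \<bullet> (x - y)) * (1 / (LINT y|lborel. bump_pow 0 (r\<^sup>2 - (y::'a) \<bullet> y))))"
    by (intro smooth_gen.intros)
  then have "smooth_gen (\<lambda>y. mollifier r (x - y))"
    by (simp add: mollifier_def)
  then have "\<forall>k. C_k_on k UNIV (\<lambda>y. mollifier r (x - y))"
    using smooth_gen_imp_C_k by blast
  moreover have sub: "closure {y. mollifier r (x - y) \<noteq> 0} \<subseteq> cball x r"
    by (rule closure_minimal)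
      (use mollifier_zero[OF assms(1), of "x - _"] in \<open>force simp: dist_norm\<close>, simp)
  moreover have "compact (closure {y. mollifier r (x - y) \<noteq> 0})"
    using bounded_subset[OF bounded_cball sub] by (simp add: compact_eq_bounded_closed)
  ultimately show ?thesis using assms(2) unfolding test_function_def by blast
qed

section \<open>Directional integration by parts\<close>

text \<open>The derivative is carried along as an explicit function \<open>df\<close>, because
  product rule, convolution and limits all have to refer to it; other directions do not
  enter.\<close>

definition dir_C1 :: "'a::euclidean_space \<Rightarrow> ('a \<Rightarrow> real) \<Rightarrow> ('a \<Rightarrow> real) \<Rightarrow> bool" where
  "dir_C1 \<omega> f df \<longleftrightarrow> continuous_on UNIV f \<and> continuous_on UNIV df \<and>
     (\<forall>x. ((\<lambda>s. f (x + s *\<^sub>R \<omega>)) has_real_derivative df x) (at 0))"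

text \<open>Weaker than \<open>test_function\<close>, so that cutoffs pulled back by the inverse of
  a C^1 element map belong to it.\<close>

definition dir_test :: "'a::euclidean_space set \<Rightarrow> 'a \<Rightarrow> ('a \<Rightarrow> real) \<Rightarrow> ('a \<Rightarrow> real) \<Rightarrow> bool" where
  "dir_test U \<omega> f df \<longleftrightarrow> dir_C1 \<omega> f df \<and>
     (\<exists>C. compact C \<and> C \<subseteq> U \<and> (\<forall>x. x \<notin> C \<longrightarrow> f x = 0 \<and> df x = 0))"

lemma dir_C1_mult:
  assumes "dir_C1 \<omega> f df" "dir_C1 \<omega> g dg"
  shows "dir_C1 \<omega> (\<lambda>x. f x * g x) (\<lambda>x. df x * g x + f x * dg x)"
  unfolding dir_C1_def
proof (intro conjI allI)
  fix x
  have "((\<lambda>s. f (x + s *\<^sub>R \<omega>) * g (x + s *\<^sub>R \<omega>)) has_real_derivative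
     df x * g (x + 0 *\<^sub>R \<omega>) + dg x * f (x + 0 *\<^sub>R \<omega>)) (at 0)"
    using assms by (intro DERIV_mult) (auto simp: dir_C1_def)
  then show "((\<lambda>s. f (x + s *\<^sub>R \<omega>) * g (x + s *\<^sub>R \<omega>)) has_real_derivative
     df x * g x + f x * dg x) (at 0)" by (simp add: mult.commute)
qed (use assms in \<open>auto simp: dir_C1_def intro!: continuous_intros\<close>)

lemma dir_C1_DERIV:
  assumes "dir_C1 \<omega> f df"
  shows "((\<lambda>s. f (x + s *\<^sub>R \<omega>)) has_real_derivative df (x + t *\<^sub>R \<omega>)) (at t)"
proof -
  have "((\<lambda>s. f ((x + t *\<^sub>R \<omega>) + s *\<^sub>R \<omega>)) has_real_derivative df (x + t *\<^sub>R \<omega>)) (at 0)"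
    using assms unfolding dir_C1_def by blast
  then have "((\<lambda>s. f ((x + t *\<^sub>R \<omega>) + (s - t) *\<^sub>R \<omega>)) has_real_derivative df (x + t *\<^sub>R \<omega>)) (at t)"
    using DERIV_shift[of "\<lambda>s. f ((x + t *\<^sub>R \<omega>) + (s - t) *\<^sub>R \<omega>)" _ 0 t] by simp
  then show ?thesis by (simp add: algebra_simps)
qed

text \<open>Difference quotients along \<omega> integrate to 0 by translation invariance. They
  converge to \<open>df\<close> dominatedly: the mean value theorem bounds them by the bound of
  \<open>df\<close>, and step lengths of at most 1 keep their supports in one ball.\<close>

lemma dir_C1_integral_zero:
  fixes f :: "'a::euclidean_space \<Rightarrow> real"
  assumes f: "dir_C1 \<omega> f df" and C: "compact C" "\<And>x. x \<notin> C \<Longrightarrow> f x = 0" "\<And>x. x \<notin> C \<Longrightarrow> df x = 0"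
  shows "(LINT x|lborel. df x) = 0"
proof -
  have cf: "continuous_on UNIV f" and cdf: "continuous_on UNIV df"
    using f by (auto simp: dir_C1_def)
  have [measurable]: "f \<in> borel_measurable borel" "df \<in> borel_measurable borel"
    using cf cdf by (auto intro: borel_measurable_continuous_onI)
  obtain B where B: "B > 0" "\<And>x. \<bar>df x\<bar> \<le> B"
    using continuous_compact_support_bounded[OF cdf C(1) C(3)] by blast
  obtain R where R: "R > 0" "\<And>x. x \<in> C \<Longrightarrow> norm x \<le> R"
    using compact_imp_bounded[OF C(1)] by (auto simp: bounded_pos)
  define q where "q = (\<lambda>n::nat. \<lambda>x. (f (x + (1 / real (Suc n)) *\<^sub>R \<omega>) - f x) / (1 / real (Suc n)))"
  have q_bound: "\<bar>q n x\<bar> \<le> B" for n x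
  proof -
    have "\<exists>z. z > 0 \<and> z < 1 / real (Suc n) \<and>
      f (x + (1 / real (Suc n)) *\<^sub>R \<omega>) - f (x + 0 *\<^sub>R \<omega>) = (1 / real (Suc n) - 0) * df (x + z *\<^sub>R \<omega>)"
      by (rule MVT2) (auto intro: dir_C1_DERIV[OF f])
    then show ?thesis using B(2) by (auto simp: q_def)
  qed
  have q_zero: "q n x = 0" if "norm x > R + norm \<omega>" for n x
  proof -
    have "norm ((1 / real (Suc n)) *\<^sub>R \<omega>) \<le> norm \<omega>"
      by (simp add: divide_le_eq mult_le_cancel_left1)
    then have "norm (x + (1 / real (Suc n)) *\<^sub>R \<omega>) > R"
      using that norm_diff_ineq[of x "(1 / real (Suc n)) *\<^sub>R \<omega>"] by linarith
    moreover have "norm x > R" using that norm_ge_zero[of \<omega>] by linarith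
    ultimately have "x \<notin> C" "x + (1 / real (Suc n)) *\<^sub>R \<omega> \<notin> C" using R(2) by fastforce+
    then show ?thesis by (simp add: q_def C)
  qed
  have fint: "integrable lborel f"
    by (rule continuous_compact_support_integrable[OF cf C(1) C(2)])
  have "(\<lambda>n. LINT x|lborel. q n x) \<longlonglongrightarrow> (LINT x|lborel. df x)"
  proof (rule integral_dominated_convergence[where w = "\<lambda>x. indicator (cball 0 (R + norm \<omega>)) x *\<^sub>R B"])
    show "df \<in> borel_measurable lborel" by simp
    show "q n \<in> borel_measurable lborel" for n unfolding q_def by measurable
    show "integrable lborel (\<lambda>x. indicator (cball (0::'a) (R + norm \<omega>)) x *\<^sub>R B)"
      using borel_integrable_compact[of "cball (0::'a) (R + norm \<omega>)" "\<lambda>x. B"] by (simp add: set_integrable_def)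
    show "AE x in lborel. norm (q n x) \<le> indicator (cball 0 (R + norm \<omega>)) x *\<^sub>R B" for n
      using q_bound q_zero B(1) by (auto simp: indicator_def not_le)
    show "AE x in lborel. (\<lambda>n. q n x) \<longlonglongrightarrow> df x"
    proof (rule AE_I2)
      fix x
      have "((\<lambda>s. (f (x + s *\<^sub>R \<omega>) - f x) / s) \<longlongrightarrow> df x) (at 0)"
        using f by (auto simp: dir_C1_def DERIV_def)
      moreover have "filterlim (\<lambda>n. 1 / real (Suc n)) (at 0) sequentially"
        by (intro filterlim_atI lim_1_over_n[THEN LIMSEQ_Suc]) auto
      ultimately show "(\<lambda>n. q n x) \<longlonglongrightarrow> df x"
        unfolding q_def by (rule filterlim_compose)
    qed
  qed
  moreover have "(LINT x|lborel. q n x) = 0" for n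
  proof -
    have eq: "(\<lambda>x. f (x + (1 / real (Suc n)) *\<^sub>R \<omega>)) = (\<lambda>x. f ((1 / real (Suc n)) *\<^sub>R \<omega> + x))"
      by (simp add: add.commute)
    have i: "integrable lborel (\<lambda>x. f (x + (1 / real (Suc n)) *\<^sub>R \<omega>))"
      using integral_reflect(2)[of "\<lambda>y. f (y + (1 / real (Suc n)) *\<^sub>R \<omega>)" 0]
        integral_reflect(2)[of f "(1 / real (Suc n)) *\<^sub>R \<omega>"] fint by simp
    have "(LINT x|lborel. f (x + (1 / real (Suc n)) *\<^sub>R \<omega>) - f x) = 0"
      by (subst Bochner_Integration.integral_diff[OF i fint])
        (simp only: eq integral_translate diff_self)
    then show ?thesis unfolding q_def by (simp del: of_nat_Suc)
  qed
  ultimately show ?thesis by (simp add: LIMSEQ_const_iff)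
qed

lemma integrable_mult_bounded:
  fixes f k :: "'a \<Rightarrow> real"
  assumes "integrable M f" "k \<in> borel_measurable M" "\<And>y. y \<in> space M \<Longrightarrow> \<bar>k y\<bar> \<le> B"
  shows "integrable M (\<lambda>y. f y * k y)"
proof (rule Bochner_Integration.integrable_bound[where f = "\<lambda>y. B * f y"])
  show "integrable M (\<lambda>y. B * f y)" using assms by simp
  show "(\<lambda>y. f y * k y) \<in> borel_measurable M"
    using assms by (intro borel_measurable_times) (auto simp: borel_measurable_integrable)
  show "AE y in M. norm (f y * k y) \<le> norm (B * f y)"
  proof (rule AE_I2)
    fix y assume "y \<in> space M"
    then have "\<bar>f y\<bar> * \<bar>k y\<bar> \<le> \<bar>f y\<bar> * \<bar>B\<bar>"
      by (intro mult_left_mono order_trans[OF assms(3) abs_ge_self]) auto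
    then show "norm (f y * k y) \<le> norm (B * f y)" by (simp add: abs_mult mult.commute)
  qed
qed

section \<open>Convolution with bounded continuous kernels\<close>

definition convolve :: "('a::euclidean_space \<Rightarrow> real) \<Rightarrow> ('a \<Rightarrow> real) \<Rightarrow> 'a \<Rightarrow> real" where
  "convolve f k x = (LINT y|lborel. f y * k (x - y))"

lemma convolve_integrable:
  fixes f k :: "'a::euclidean_space \<Rightarrow> real"
  assumes "integrable lborel f" "continuous_on UNIV k" "\<And>x. \<bar>k x\<bar> \<le> B"
  shows "integrable lborel (\<lambda>y. f y * k (x - y))"
proof -
  have "continuous_on UNIV (\<lambda>y. k (x - y))"
    by (rule continuous_on_compose2[OF assms(2)]) (auto intro!: continuous_intros)
  then show ?thesis
    by (intro integrable_mult_bounded[OF assms(1)])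
      (auto intro: borel_measurable_continuous_onI assms(3))
qed

lemma continuous_convolve:
  fixes f k :: "'a::euclidean_space \<Rightarrow> real"
  assumes f: "integrable lborel f" and k: "continuous_on UNIV k" "\<And>x. \<bar>k x\<bar> \<le> B"
  shows "continuous_on UNIV (convolve f k)"
  unfolding continuous_on_sequentially
proof (intro allI ballI impI; elim conjE)
  fix X and x :: 'a assume X: "X \<longlonglongrightarrow> x"
  have int: "integrable lborel (\<lambda>y. f y * k (z - y))" for z
    by (rule convolve_integrable[OF f k])
  show "(convolve f k \<circ> X) \<longlonglongrightarrow> convolve f k x"
    unfolding o_def convolve_def
  proof (rule integral_dominated_convergence[where w = "\<lambda>y. B * \<bar>f y\<bar>"])
    show "integrable lborel (\<lambda>y. B * \<bar>f y\<bar>)" using f by simp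
    show "AE y in lborel. norm (f y * k (X n - y)) \<le> B * \<bar>f y\<bar>" for n
      using mult_left_mono[OF k(2) abs_ge_zero] by (intro AE_I2) (simp add: abs_mult mult.commute)
    show "AE y in lborel. (\<lambda>n. f y * k (X n - y)) \<longlonglongrightarrow> f y * k (x - y)"
    proof (rule AE_I2)
      fix y
      have "isCont k (x - y)" using k(1) continuous_on_eq_continuous_at[OF open_UNIV] by blast
      then have "(\<lambda>n. k (X n - y)) \<longlonglongrightarrow> k (x - y)"
        by (rule isCont_tendsto_compose) (intro tendsto_intros X)
      then show "(\<lambda>n. f y * k (X n - y)) \<longlonglongrightarrow> f y * k (x - y)"
        by (intro tendsto_intros)
    qed
  qed (use int in \<open>auto simp: borel_measurable_integrable\<close>)
qed

text \<open>The derivative falls on the kernel. By the mean value theorem its difference quotients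
  are bounded by \<open>B\<close>, so a multiple of |f| dominates the integrands.\<close>

lemma dir_C1_convolve:
  fixes f k :: "'a::euclidean_space \<Rightarrow> real"
  assumes f: "integrable lborel f" and k: "dir_C1 \<omega> k dk" "\<And>x. \<bar>k x\<bar> \<le> B" "\<And>x. \<bar>dk x\<bar> \<le> B"
  shows "dir_C1 \<omega> (convolve f k) (convolve f dk)"
  unfolding dir_C1_def
proof (intro conjI allI)
  have ck: "continuous_on UNIV k" and cdk: "continuous_on UNIV dk" using k by (auto simp: dir_C1_def)
  show "continuous_on UNIV (convolve f k)" "continuous_on UNIV (convolve f dk)"
    by (rule continuous_convolve[OF f ck k(2)], rule continuous_convolve[OF f cdk k(3)])
  fix x
  have int: "integrable lborel (\<lambda>y. f y * k (z - y))" "integrable lborel (\<lambda>y. f y * dk (z - y))" for z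
    by (rule convolve_integrable[OF f ck k(2)], rule convolve_integrable[OF f cdk k(3)])
  have "((\<lambda>h. (convolve f k (x + (0 + h) *\<^sub>R \<omega>) - convolve f k (x + 0 *\<^sub>R \<omega>)) / h) \<longlongrightarrow> convolve f dk x) (at 0)"
    unfolding tendsto_at_iff_sequentially
  proof (intro allI impI)
    fix X :: "nat \<Rightarrow> real" assume X0: "\<forall>i. X i \<in> UNIV - {0}" and X: "X \<longlonglongrightarrow> 0"
    let ?q = "\<lambda>n y. (k (x - y + X n *\<^sub>R \<omega>) - k (x - y)) / X n"
    have "(\<lambda>n. LINT y|lborel. f y * ?q n y) \<longlonglongrightarrow> (LINT y|lborel. f y * dk (x - y))"
    proof (rule integral_dominated_convergence[where w = "\<lambda>y. B * \<bar>f y\<bar>"])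
      show "integrable lborel (\<lambda>y. B * \<bar>f y\<bar>)" using f by simp
      have "continuous_on UNIV (\<lambda>y. k (x - y + X n *\<^sub>R \<omega>))" "continuous_on UNIV (\<lambda>y. k (x - y))" for n
        by (rule continuous_on_compose2[OF ck]; auto intro!: continuous_intros)+
      then show "(\<lambda>y. f y * ?q n y) \<in> borel_measurable lborel" for n
        using f by (intro borel_measurable_times borel_measurable_divide borel_measurable_diff)
          (auto intro: borel_measurable_continuous_onI simp: borel_measurable_integrable)
      show "(\<lambda>y. f y * dk (x - y)) \<in> borel_measurable lborel"
        using int(2) borel_measurable_integrable by blast
      have qb: "\<bar>?q n y\<bar> \<le> B" for n y
      proof (cases "X n > 0")
        case True
        have "\<exists>z. z > 0 \<and> z < X n \<and> k (x - y + X n *\<^sub>R \<omega>) - k (x - y + 0 *\<^sub>R \<omega>) = (X n - 0) * dk (x - y + z *\<^sub>R \<omega>)"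
          by (rule MVT2) (use True dir_C1_DERIV[OF k(1)] in auto)
        then obtain z where "k (x - y + X n *\<^sub>R \<omega>) - k (x - y) = X n * dk (x - y + z *\<^sub>R \<omega>)" by auto
        then have "?q n y = dk (x - y + z *\<^sub>R \<omega>)" using True by (simp only:) simp
        then show ?thesis using k(3) by simp
      next
        case False
        then have neg: "X n < 0" using X0 by (metis DiffD2 insertI1 linorder_neqE_linordered_idom)
        have "\<exists>z. z > X n \<and> z < 0 \<and> k (x - y + 0 *\<^sub>R \<omega>) - k (x - y + X n *\<^sub>R \<omega>) = (0 - X n) * dk (x - y + z *\<^sub>R \<omega>)"
          by (rule MVT2) (use neg dir_C1_DERIV[OF k(1)] in auto)
        then obtain z where z: "k (x - y) - k (x - y + X n *\<^sub>R \<omega>) = (0 - X n) * dk (x - y + z *\<^sub>R \<omega>)" by auto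
        then have "k (x - y + X n *\<^sub>R \<omega>) - k (x - y) = X n * dk (x - y + z *\<^sub>R \<omega>)" by simp
        then have "?q n y = dk (x - y + z *\<^sub>R \<omega>)" using neg by (simp only:) simp
        then show ?thesis using k(3) by simp
      qed
      show "AE y in lborel. norm (f y * ?q n y) \<le> B * \<bar>f y\<bar>" for n
        using mult_left_mono[OF qb abs_ge_zero] by (intro AE_I2) (simp add: abs_mult mult.commute)
      show "AE y in lborel. (\<lambda>n. f y * ?q n y) \<longlonglongrightarrow> f y * dk (x - y)"
      proof (rule AE_I2)
        fix y
        have "((\<lambda>s. (k (x - y + (0 + s) *\<^sub>R \<omega>) - k (x - y + 0 *\<^sub>R \<omega>)) / s) \<longlongrightarrow> dk (x - y)) (at 0)"
          using k(1) by (auto simp: dir_C1_def DERIV_def)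
        then have "(\<lambda>n. ?q n y) \<longlonglongrightarrow> dk (x - y)"
          unfolding tendsto_at_iff_sequentially o_def using X X0 by simp
        then show "(\<lambda>n. f y * ?q n y) \<longlonglongrightarrow> f y * dk (x - y)"
          by (intro tendsto_intros)
      qed
    qed
    moreover have "(LINT y|lborel. f y * ?q n y) = (convolve f k (x + X n *\<^sub>R \<omega>) - convolve f k x) / X n" for n
    proof -
      have "(LINT y|lborel. f y * ?q n y) = (LINT y|lborel. (f y * k (x + X n *\<^sub>R \<omega> - y) - f y * k (x - y)) / X n)"
        by (intro Bochner_Integration.integral_cong refl) (simp add: field_simps)
      also have "\<dots> = (LINT y|lborel. (f y * k (x + X n *\<^sub>R \<omega> - y) - f y * k (x - y))) / X n"
        by simp
      also have "\<dots> = (convolve f k (x + X n *\<^sub>R \<omega>) - convolve f k x) / X n"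
        unfolding convolve_def by (subst Bochner_Integration.integral_diff[OF int(1) int(1)]) simp
      finally show ?thesis .
    qed
    ultimately show "((\<lambda>h. (convolve f k (x + (0 + h) *\<^sub>R \<omega>) - convolve f k (x + 0 *\<^sub>R \<omega>)) / h) \<circ> X) \<longlonglongrightarrow> convolve f dk x"
      by (simp only: o_def convolve_def add_0_left scaleR_zero_left add_0_right)
  qed
  then show "((\<lambda>s. convolve f k (x + s *\<^sub>R \<omega>)) has_real_derivative convolve f dk x) (at 0)"
    unfolding DERIV_def .
qed

lemma dir_C1_mollifier: "dir_C1 \<omega> (mollifier r) (mollifier_deriv r \<omega>)"
  for \<omega> :: "'a::euclidean_space"
  unfolding dir_C1_def
proof (intro conjI allI)
  fix z
  have "((\<lambda>s::real. s *\<^sub>R (- \<omega>)) has_derivative (\<lambda>s. s *\<^sub>R (- \<omega>))) (at 0)"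
    by (auto intro!: derivative_eq_intros)
  from has_derivative_compose[OF this mollifier_has_derivative[of r z]]
  have "((\<lambda>s. mollifier r (z + s *\<^sub>R \<omega>)) has_derivative (\<lambda>s. - mollifier_deriv r (s *\<^sub>R (- \<omega>)) z)) (at 0)"
    by simp
  moreover have "(\<lambda>s. - mollifier_deriv r (s *\<^sub>R (- \<omega>)) z) = (*) (mollifier_deriv r \<omega> z)"
    by (auto simp: mollifier_deriv_def fun_eq_iff)
  ultimately show "((\<lambda>s. mollifier r (z + s *\<^sub>R \<omega>)) has_real_derivative mollifier_deriv r \<omega> z) (at 0)"
    by (simp add: has_field_derivative_def)
qed (auto intro: continuous_mollifier continuous_mollifier_deriv)

lemma mollifier_bounded:
  fixes \<omega> :: "'a::euclidean_space"
  assumes "r > 0"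
  obtains B where "B > 0" "\<And>x::'a. \<bar>mollifier r x\<bar> \<le> B" "\<And>x. \<bar>mollifier_deriv r \<omega> x\<bar> \<le> B"
proof -
  have m: "mollifier r x = 0" "mollifier_deriv r \<omega> x = 0" if "x \<notin> cball 0 r" for x :: 'a
    using that mollifier_zero[OF assms, of x] mollifier_deriv_zero[OF assms, of x] by auto
  obtain B1 where B1: "B1 > 0" "\<And>x::'a. \<bar>mollifier r x\<bar> \<le> B1"
    using continuous_compact_support_bounded[OF continuous_mollifier compact_cball m(1)] by blast
  obtain B2 where B2: "B2 > 0" "\<And>x. \<bar>mollifier_deriv r \<omega> x\<bar> \<le> B2"
    using continuous_compact_support_bounded[OF continuous_mollifier_deriv compact_cball m(2)] by blast
  show ?thesis by (rule that[of "max B1 B2"]) (use B1 B2 in \<open>auto simp: le_max_iff_disj\<close>)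
qed

lemma dir_C1_mollify:
  assumes "integrable lborel f" "r > 0"
  shows "dir_C1 \<omega> (convolve f (mollifier r)) (convolve f (mollifier_deriv r \<omega>))"
  by (rule mollifier_bounded[OF assms(2), of \<omega>]) (rule dir_C1_convolve[OF assms(1) dir_C1_mollifier])

text \<open>The kernel is a probability density supported in a ball, so the convolution averages
  values of \<open>f\<close> near \<open>x\<close>. This one estimate serves for convergence, for
  sup bounds (\<open>a = 0\<close>) and for supports (\<open>a = 0\<close> and
  \<open>e = 0\<close>).\<close>

lemma mollify_close:
  fixes x :: "'a::euclidean_space"
  assumes f: "integrable lborel f" and r: "r > 0" and e: "\<And>y. dist x y \<le> r \<Longrightarrow> \<bar>f y - a\<bar> \<le> e"
  shows "\<bar>convolve f (mollifier r) x - a\<bar> \<le> e"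
proof -
  let ?m = "\<lambda>y::'a. mollifier r (x - y)"
  have m: "integrable lborel ?m" "(LINT y|lborel. ?m y) = 1"
    using integral_reflect[of "mollifier r" x] mollifier_integrable[OF r] mollifier_integral[OF r, where 'a='a] by auto
  obtain B where "\<And>x::'a. \<bar>mollifier r x\<bar> \<le> B" by (rule mollifier_bounded[OF r, of 0]) blast
  then have fm: "integrable lborel (\<lambda>y. f y * ?m y)"
    by (intro convolve_integrable[OF f continuous_mollifier])
  have "convolve f (mollifier r) x - a = (LINT y|lborel. f y * ?m y - a * ?m y)"
    using m fm by (simp add: convolve_def)
  also have "\<bar>\<dots>\<bar> \<le> (LINT y|lborel. \<bar>f y * ?m y - a * ?m y\<bar>)"
    by (rule integral_abs_bound)
  also have "\<dots> \<le> (LINT y|lborel. e * ?m y)"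
  proof (rule integral_mono)
    show "\<bar>f y * ?m y - a * ?m y\<bar> \<le> e * ?m y" for y
    proof (cases "dist x y \<le> r")
      case True
      have "\<bar>f y * ?m y - a * ?m y\<bar> = \<bar>f y - a\<bar> * ?m y"
        using mollifier_nonneg[OF r, of "x - y"] by (simp add: abs_mult flip: left_diff_distrib)
      then show ?thesis using mult_right_mono[OF e[OF True] mollifier_nonneg[OF r, of "x - y"]] by simp
    next
      case False
      then show ?thesis using mollifier_zero[OF r, of "x - y"] by (simp add: dist_norm)
    qed
  qed (use m fm in auto)
  also have "\<dots> = e" using m by simp
  finally show ?thesis .
qed

text \<open>The transpose of a convolution: the kernel passes from one factor to the other. Fubini
  applies because the kernel is bounded and \<open>g x * f y\<close> is integrable on the
  product.\<close>

lemma convolve_fubini: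
  fixes f g k :: "'a::euclidean_space \<Rightarrow> real"
  assumes f: "integrable lborel f" and g: "integrable lborel g"
    and k: "continuous_on UNIV k" "\<And>x. \<bar>k x\<bar> \<le> B"
  shows "(LINT x|lborel. g x * convolve f k x) = (LINT y|lborel. f y * (LINT x|lborel. g x * k (x - y)))"
proof -
  have [measurable]: "f \<in> borel_measurable borel" "g \<in> borel_measurable borel" "k \<in> borel_measurable borel"
    using f g k by (auto simp: integrable_iff_bounded intro: borel_measurable_continuous_onI)
  have fg: "integrable (lborel \<Otimes>\<^sub>M lborel) (\<lambda>(x, y). g x * f y)"
    by (rule lborel_pair.Fubini_integrable) (use f g in \<open>auto simp: abs_mult\<close>)
  have gfk: "integrable (lborel \<Otimes>\<^sub>M lborel) (\<lambda>(x, y). g x * f y * k (x - y))"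
  proof (rule Bochner_Integration.integrable_bound[where f = "\<lambda>z. B * (case z of (x, y) \<Rightarrow> g x * f y)"])
    show "integrable (lborel \<Otimes>\<^sub>M lborel) (\<lambda>z. B * (case z of (x, y) \<Rightarrow> g x * f y))" using fg by simp
    show "(\<lambda>(x, y). g x * f y * k (x - y)) \<in> borel_measurable (lborel \<Otimes>\<^sub>M lborel)" by measurable
    show "AE z in lborel \<Otimes>\<^sub>M lborel. norm (case z of (x, y) \<Rightarrow> g x * f y * k (x - y))
        \<le> norm (B * (case z of (x, y) \<Rightarrow> g x * f y))"
    proof (rule AE_I2, clarsimp)
      fix x y
      have "\<bar>g x * f y\<bar> * \<bar>k (x - y)\<bar> \<le> \<bar>g x * f y\<bar> * \<bar>B\<bar>"
        by (rule mult_left_mono[OF order_trans[OF k(2) abs_ge_self]]) simp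
      then show "\<bar>g x * f y * k (x - y)\<bar> \<le> \<bar>B * (g x * f y)\<bar>" by (simp add: abs_mult mult.commute mult.left_commute)
    qed
  qed
  have "(LINT x|lborel. g x * convolve f k x) = (LINT x|lborel. LINT y|lborel. g x * f y * k (x - y))"
    unfolding convolve_def by (simp add: mult.assoc)
  also have "\<dots> = (LINT y|lborel. LINT x|lborel. g x * f y * k (x - y))"
    using lborel_pair.Fubini_integral[of "\<lambda>x y. g x * f y * k (x - y)"] gfk by simp
  also have "\<dots> = (LINT y|lborel. f y * (LINT x|lborel. g x * k (x - y)))"
    by (intro Bochner_Integration.integral_cong refl) (simp flip: integral_mult_right_zero add: mult_ac)
  finally show ?thesis .
qed

section \<open>Square-integrable functions and weak gradients\<close>

lemma L2_on_integrable:
  fixes f g :: "'a::euclidean_space \<Rightarrow> real"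
  assumes "L2_on U f" "L2_on U g"
  shows "integrable (lebesgue_on U) (\<lambda>x. f x * g x)"
proof (rule Bochner_Integration.integrable_bound[where f = "\<lambda>x. (f x)\<^sup>2 + (g x)\<^sup>2"])
  show "integrable (lebesgue_on U) (\<lambda>x. (f x)\<^sup>2 + (g x)\<^sup>2)" using assms by (auto simp: L2_on_def)
  show "(\<lambda>x. f x * g x) \<in> borel_measurable (lebesgue_on U)" using assms by (auto simp: L2_on_def)
  have "\<bar>a * b\<bar> \<le> a\<^sup>2 + b\<^sup>2" for a b :: real
    using zero_le_power2[of "a + b"] zero_le_power2[of "a - b"] zero_le_power2[of a] zero_le_power2[of b]
    unfolding power2_sum power2_diff by (intro abs_leI) linarith+
  then show "AE x in lebesgue_on U. norm (f x * g x) \<le> norm ((f x)\<^sup>2 + (g x)\<^sup>2)"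
    by (intro AE_I2) (auto intro: order_trans[OF _ abs_ge_self])
qed

lemma L2_on_add:
  fixes f g :: "'a::euclidean_space \<Rightarrow> real"
  assumes "L2_on U f" "L2_on U g"
  shows "L2_on U (\<lambda>x. f x + g x)"
  using assms L2_on_integrable[OF assms] by (auto simp: L2_on_def power2_sum mult.assoc)

lemma L2_on_cmult: "L2_on U f \<Longrightarrow> L2_on U (\<lambda>x. c * f x)"
  for f :: "'a::euclidean_space \<Rightarrow> real"
  by (auto simp: L2_on_def power_mult_distrib)

lemma L2_on_sum:
  fixes f :: "'i \<Rightarrow> 'a::euclidean_space \<Rightarrow> real"
  assumes "finite I" "\<And>i. i \<in> I \<Longrightarrow> L2_on U (f i)"
  shows "L2_on U (\<lambda>x. \<Sum>i\<in>I. f i x)"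
  using assms
proof induction
  case empty
  show ?case by (simp add: L2_on_def)
next
  case (insert i I)
  then show ?case by (simp add: L2_on_add)
qed

lemma L2_on_dir_gradient:
  fixes U :: "(real^'n) set"
  assumes "is_L2_weak_gradient U v G"
  shows "L2_on U (\<lambda>x. \<omega> \<bullet> G x)"
  using assms unfolding inner_vec_def is_L2_weak_gradient_def
  by (auto intro!: L2_on_sum L2_on_cmult)

lemma L2_on_const:
  assumes "U \<in> lmeasurable"
  shows "L2_on U (\<lambda>x. 1)"
proof -
  have "emeasure (lebesgue_on U) (space (lebesgue_on U)) < \<infinity>"
    using assms by (auto simp: emeasure_restrict_space fmeasurable_def simp del: emeasure_completion)
  then show ?thesis
    using finite_measure.integrable_const[OF finite_measureI, of "lebesgue_on U" "1::real"]
    by (simp add: L2_on_def)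
qed

lemma L2_on_imp_set_integrable:
  assumes "U \<in> lmeasurable" "L2_on U f"
  shows "set_integrable lebesgue U f"
  using L2_on_integrable[OF assms(2) L2_on_const[OF assms(1)]] assms(1)
  by (simp add: integrable_restrict_space set_integrable_def fmeasurable_def)

text \<open>The mollifier centred at \<open>x\<close> is an admissible test function, as its ball
  lies in \<open>U\<close>. The sign from differentiating in \<open>y\<close> cancels the one in the
  definition of the weak gradient, and the coordinate identities are combined with the weights
  \<open>\<omega> $ i\<close>.\<close>

lemma weak_gradient_mollifier:
  fixes U :: "(real^'n) set"
  assumes U: "U \<in> lmeasurable" and v: "L2_on U v" and G: "is_L2_weak_gradient U v G"
    and r: "r > 0" "cball x r \<subseteq> U"
  shows "(LINT y:U|lebesgue. v y * mollifier_deriv r \<omega> (x - y)) = (LINT y:U|lebesgue. (\<omega> \<bullet> G y) * mollifier r (x - y))"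
proof -
  have iv: "integrable (lebesgue_on U) v"
    using L2_on_integrable[OF v L2_on_const[OF U]] by simp
  have iG: "integrable (lebesgue_on U) (\<lambda>y. G y $ i)" for i
    using L2_on_integrable[OF _ L2_on_const[OF U], of "\<lambda>y. G y $ i"] G by (simp add: is_L2_weak_gradient_def)
  have Us: "U \<in> sets lebesgue" using U by blast
  have setI: "(LINT y:U|lebesgue. f y) = (LINT y|lebesgue_on U. f y)" for f :: "real^'n \<Rightarrow> real"
    using Us by (simp add: set_lebesgue_integral_def integral_restrict_space)
  have meas: "(\<lambda>y. k (x - y)) \<in> borel_measurable (lebesgue_on U)" if "continuous_on UNIV k" for k :: "real^'n \<Rightarrow> real"
  proof -
    have "continuous_on UNIV (\<lambda>y. k (x - y))"
      by (rule continuous_on_compose2[OF that]) (auto intro!: continuous_intros)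
    then show ?thesis
      using Us by (intro continuous_imp_measurable_on_sets_lebesgue) (auto intro: continuous_on_subset)
  qed
  have im: "integrable (lebesgue_on U) (\<lambda>y. f y * mollifier r (x - y))"
    and id: "integrable (lebesgue_on U) (\<lambda>y. f y * mollifier_deriv r e (x - y))"
    if "integrable (lebesgue_on U) f" for f :: "real^'n \<Rightarrow> real" and e
  proof -
    obtain B where "\<And>x::real^'n. \<bar>mollifier r x\<bar> \<le> B" "\<And>x. \<bar>mollifier_deriv r e x\<bar> \<le> B"
      by (rule mollifier_bounded[OF r(1), of e]) blast
    then show "integrable (lebesgue_on U) (\<lambda>y. f y * mollifier r (x - y))"
      "integrable (lebesgue_on U) (\<lambda>y. f y * mollifier_deriv r e (x - y))"
      by (intro integrable_mult_bounded[OF that] meas continuous_mollifier continuous_mollifier_deriv; blast)+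
  qed
  have fd: "frechet_derivative (\<lambda>y. mollifier r (x - y)) (at y) = (\<lambda>e. - mollifier_deriv r e (x - y))" for y
    by (rule frechet_derivative_at[symmetric]) (rule mollifier_has_derivative)
  have comp: "(LINT y|lebesgue_on U. v y * mollifier_deriv r (axis i 1) (x - y)) =
      (LINT y|lebesgue_on U. G y $ i * mollifier r (x - y))" for i
    using G test_function_mollifier[OF r] unfolding is_L2_weak_gradient_def
    by (force simp: fd setI)
  have "mollifier_deriv r \<omega> z = (\<Sum>i\<in>UNIV. \<omega> $ i * mollifier_deriv r (axis i 1) z)" for z :: "real^'n"
    unfolding mollifier_deriv_def inner_axis
    by (simp add: inner_vec_def sum_distrib_left sum_distrib_right sum_divide_distrib mult_ac)
  then have "(LINT y|lebesgue_on U. v y * mollifier_deriv r \<omega> (x - y)) =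
      (LINT y|lebesgue_on U. (\<Sum>i\<in>UNIV. \<omega> $ i * (v y * mollifier_deriv r (axis i 1) (x - y))))"
    by (simp add: sum_distrib_left mult_ac)
  also have "\<dots> = (\<Sum>i\<in>UNIV. \<omega> $ i * (LINT y|lebesgue_on U. v y * mollifier_deriv r (axis i 1) (x - y)))"
    using id[OF iv] by (subst Bochner_Integration.integral_sum) auto
  also have "\<dots> = (\<Sum>i\<in>UNIV. \<omega> $ i * (LINT y|lebesgue_on U. G y $ i * mollifier r (x - y)))"
    by (simp add: comp)
  also have "\<dots> = (LINT y|lebesgue_on U. (\<Sum>i\<in>UNIV. \<omega> $ i * (G y $ i * mollifier r (x - y))))"
    using im[OF iG] by (subst Bochner_Integration.integral_sum) auto
  also have "\<dots> = (LINT y|lebesgue_on U. (\<omega> \<bullet> G y) * mollifier r (x - y))"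
    by (simp add: inner_vec_def sum_distrib_left mult_ac)
  finally show ?thesis by (simp add: setI)
qed

text \<open>The complement of \<open>C\<close> is open, so the difference quotients at
  \<open>x\<close> are eventually 0.\<close>

lemma dir_C1_zero_outside:
  assumes "dir_C1 \<omega> f df" "compact C" "\<And>x. x \<notin> C \<Longrightarrow> f x = 0" "x \<notin> C"
  shows "df x = 0"
proof -
  have "open (- C)" using assms(2) by (simp add: compact_imp_closed open_Compl)
  have "((\<lambda>s. x + s *\<^sub>R \<omega>) \<longlongrightarrow> x + 0 *\<^sub>R \<omega>) (at 0)" by (intro tendsto_intros)
  then have "eventually (\<lambda>s. x + s *\<^sub>R \<omega> \<in> - C) (at 0)"
    using topological_tendstoD[OF _ \<open>open (- C)\<close>] assms(4) by fastforce
  then have "eventually (\<lambda>s. 0 = (f (x + (0 + s) *\<^sub>R \<omega>) - f (x + 0 *\<^sub>R \<omega>)) / s) (at 0)"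
    by eventually_elim (use assms(3,4) in auto)
  then have "((\<lambda>s. (f (x + (0 + s) *\<^sub>R \<omega>) - f (x + 0 *\<^sub>R \<omega>)) / s) \<longlongrightarrow> 0) (at 0)"
    by (rule Lim_transform_eventually[OF tendsto_const])
  moreover have "((\<lambda>s. (f (x + (0 + s) *\<^sub>R \<omega>) - f (x + 0 *\<^sub>R \<omega>)) / s) \<longlongrightarrow> df x) (at 0)"
    using assms(1) unfolding dir_C1_def DERIV_def by blast
  ultimately show ?thesis using LIM_unique by blast
qed

text \<open>The weak product rule for the square of a continuous Sobolev function: mollify the function,
  integrate by parts classically, and move the mollifier onto the test function.\<close>

lemma weak_derivative_square:
  fixes U :: "(real^'n) set"
  assumes U: "open U" "bounded U" and v: "L2_on U v" and G: "is_L2_weak_gradient U v G"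
    and c: "continuous_on U c" "AE x in lebesgue_on U. v x = c x"
    and \<phi>: "dir_test U \<omega> \<phi> d\<phi>"
  shows "(LINT x:U|lebesgue. (c x)\<^sup>2 * d\<phi> x) = - (LINT x:U|lebesgue. 2 * c x * (\<omega> \<bullet> G x) * \<phi> x)"
proof -
  have Ul: "U \<in> lmeasurable" using U by (simp add: lmeasurable_open)
  then have Us: "U \<in> sets lebesgue" by blast
  have AEU: "AE x in lebesgue. x \<in> U \<longrightarrow> v x = c x"
    using c(2) Us by (simp add: AE_restrict_space_iff)
  obtain C where C: "compact C" "C \<subseteq> U" "\<And>x. x \<notin> C \<Longrightarrow> \<phi> x = 0" "\<And>x. x \<notin> C \<Longrightarrow> d\<phi> x = 0"
    and \<phi>1: "dir_C1 \<omega> \<phi> d\<phi>" using \<phi> unfolding dir_test_def by blast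
  have c\<phi>: "continuous_on UNIV \<phi>" and cd\<phi>: "continuous_on UNIV d\<phi>" using \<phi>1 by (auto simp: dir_C1_def)
  \<comment> \<open>The continuous representative extended by 0. It is Borel, so it can be
    integrated over \<open>lborel\<close>, where convolutions are defined.\<close>
  define f where "f = (\<lambda>x. indicator U x * c x)"
  have f_meas: "f \<in> borel_measurable borel"
    using borel_measurable_continuous_on_indicator[OF _ c(1)] U by (simp add: f_def borel_open)
  have "integrable lebesgue (\<lambda>x. indicator U x * v x)"
    using L2_on_imp_set_integrable[OF Ul v] by (simp add: set_integrable_def)
  then have "integrable lebesgue f"
    by (rule integrable_cong_AE_imp)
      (use AEU f_meas in \<open>auto simp: f_def indicator_def intro: measurable_completion\<close>)
  then have f: "integrable lborel f" using f_meas by (simp add: integrable_completion)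
  have L2G: "L2_on U (\<lambda>x. \<omega> \<bullet> G x)"
    by (rule L2_on_dir_gradient[OF G])
  have g0: "integrable lebesgue (\<lambda>x. indicator U x * (\<omega> \<bullet> G x))"
    using L2_on_imp_set_integrable[OF Ul L2G] by (simp add: set_integrable_def)
  \<comment> \<open>The weak derivative is only Lebesgue measurable; \<open>g\<close> is a Borel
    version of it, as Fubini's theorem requires.\<close>
  then obtain g where g_meas: "g \<in> borel_measurable lborel"
    and g_eq: "AE x in lborel. indicator U x * (\<omega> \<bullet> G x) = g x"
    using completion_ex_borel_measurable_real[OF borel_measurable_integrable] by blast
  have g_eq': "AE x in lebesgue. indicator U x * (\<omega> \<bullet> G x) = g x"
    using g_eq by (rule AE_completion)
  have "integrable lebesgue g"
    by (rule integrable_cong_AE_imp[OF g0])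
      (use g_eq' g_meas in \<open>auto intro: measurable_completion\<close>)
  then have g: "integrable lborel g" using g_meas by (simp add: integrable_completion)
  have [measurable]: "f \<in> borel_measurable borel" "g \<in> borel_measurable borel"
      "\<phi> \<in> borel_measurable borel" "d\<phi> \<in> borel_measurable borel"
    using f_meas g_meas c\<phi> cd\<phi> by (auto intro: borel_measurable_continuous_onI)
  have g0_meas: "(\<lambda>x. indicator U x * (\<omega> \<bullet> G x)) \<in> borel_measurable lebesgue"
    using g0 by (simp add: borel_measurable_integrable)
  have lhs: "(LINT x:U|lebesgue. (c x)\<^sup>2 * d\<phi> x) = (LINT x|lborel. (f x)\<^sup>2 * d\<phi> x)"
  proof -
    have "(LINT x:U|lebesgue. (c x)\<^sup>2 * d\<phi> x) = (LINT x|lebesgue. (f x)\<^sup>2 * d\<phi> x)"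
      unfolding set_lebesgue_integral_def
      by (intro Bochner_Integration.integral_cong refl) (simp add: f_def indicator_def)
    then show ?thesis by (simp add: integral_completion)
  qed
  have rhs: "(LINT x:U|lebesgue. 2 * c x * (\<omega> \<bullet> G x) * \<phi> x) = (LINT x|lborel. g x * (2 * (f x * \<phi> x)))"
  proof -
    have m: "(\<lambda>x. 2 * (f x * \<phi> x)) \<in> borel_measurable lebesgue" by (rule measurable_completion) measurable
    have "(LINT x:U|lebesgue. 2 * c x * (\<omega> \<bullet> G x) * \<phi> x)
        = (LINT x|lebesgue. (indicator U x * (\<omega> \<bullet> G x)) * (2 * (f x * \<phi> x)))"
      unfolding set_lebesgue_integral_def
      by (intro Bochner_Integration.integral_cong refl) (simp add: f_def indicator_def)
    also have "\<dots> = (LINT x|lebesgue. g x * (2 * (f x * \<phi> x)))"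
      by (rule integral_cong_AE)
        (use g_eq' m g0_meas in \<open>auto intro!: borel_measurable_times measurable_completion\<close>)
    also have "\<dots> = (LINT x|lborel. g x * (2 * (f x * \<phi> x)))"
      by (rule integral_completion) measurable
    finally show ?thesis .
  qed
  obtain e where e: "e > 0" "(\<Union>x\<in>C. ball x e) \<subseteq> U"
    by (rule compact_subset_open_imp_ball_epsilon_subset[OF C(1) U(1) C(2)])
  \<comment> \<open>The closed \<open>e / 2\<close>-neighbourhood of \<open>C\<close>. All radii
    \<open>r n\<close> are at most \<open>e / 2\<close>, so on \<open>C\<close> the mollified
    functions only see values of \<open>f\<close> on this compact subset of
    \<open>U\<close>.\<close>
  define C' where "C' = {x + y |x y. x \<in> C \<and> y \<in> cball 0 (e / 2)}"
  have C'c: "compact C'" unfolding C'_def by (rule compact_sums[OF C(1) compact_cball])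
  have near: "y \<in> C'" if "x \<in> C" "dist x y \<le> e / 2" for x y
  proof -
    have "y = x + (y - x)" "y - x \<in> cball 0 (e / 2)" using that by (auto simp: dist_norm norm_minus_commute)
    then show ?thesis using that(1) unfolding C'_def by blast
  qed
  have C'U: "C' \<subseteq> U"
  proof
    fix z assume "z \<in> C'"
    then obtain x y where "z = x + y" "x \<in> C" "norm y \<le> e / 2" by (auto simp: C'_def)
    then have "z \<in> ball x e" using e(1) by (simp add: dist_norm)
    then show "z \<in> U" using e(2) \<open>x \<in> C\<close> by blast
  qed
  have fc: "f x = c x" if "x \<in> U" for x using that by (simp add: f_def)
  have cf: "continuous_on U f" using c(1) by (rule continuous_on_eq) (simp add: fc)
  have cf': "continuous_on C' f" by (rule continuous_on_subset[OF cf C'U])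
  have uc: "uniformly_continuous_on C' f" by (rule compact_uniformly_continuous[OF cf' C'c])
  obtain M where M: "M > 0" "\<And>x. x \<in> C' \<Longrightarrow> \<bar>f x\<bar> \<le> M"
    using compact_imp_bounded[OF compact_continuous_image[OF cf' C'c]] by (auto simp: bounded_pos)
  obtain B where B: "B > 0" "\<And>x. \<bar>\<phi> x\<bar> \<le> B"
    using continuous_compact_support_bounded[OF c\<phi> C(1) C(3)] by blast
  define r where "r = (\<lambda>n::nat. (e / 2) / real (Suc n))"
  have r: "r n > 0" "r n \<le> e / 2" for n
    using e(1) by (auto simp: r_def divide_le_eq mult_le_cancel_left1)
  have r0: "r \<longlonglongrightarrow> 0" unfolding r_def by (rule LIMSEQ_Suc) (rule lim_const_over_n)
  have CC': "x \<in> C'" if "x \<in> C" for x using near[OF that, of x] e(1) by simp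
  have nearr: "y \<in> C'" if "x \<in> C" "dist x y \<le> r n" for x y n
    using near[OF that(1)] that(2) r(2)[of n] by simp
  define V where "V = (\<lambda>n. convolve f (mollifier (r n)))"
  define dV where "dV = (\<lambda>n. convolve f (mollifier_deriv (r n) \<omega>))"
  define W where "W = (\<lambda>n. convolve g (mollifier (r n)))"
  have V1: "dir_C1 \<omega> (V n) (dV n)" for n unfolding V_def dV_def by (rule dir_C1_mollify[OF f r(1)])
  have Vb: "\<bar>V n x\<bar> \<le> M" if "x \<in> C" for n x
    using mollify_close[OF f r(1)[of n], of x 0 M] M(2) nearr[OF that] by (simp add: V_def)
  have Vconv: "\<exists>N. \<forall>n\<ge>N. \<forall>x\<in>C. \<bar>V n x - f x\<bar> \<le> \<epsilon>" if \<epsilon>: "\<epsilon> > 0" for \<epsilon>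
  proof -
    obtain \<delta> where \<delta>: "\<delta> > 0" "\<And>x y. x \<in> C' \<Longrightarrow> y \<in> C' \<Longrightarrow> dist y x < \<delta> \<Longrightarrow> dist (f y) (f x) < \<epsilon>"
      using uc \<epsilon> unfolding uniformly_continuous_on_def by blast
    obtain N where N: "\<And>n. n \<ge> N \<Longrightarrow> r n < \<delta>"
      using order_tendstoD(2)[OF r0 \<delta>(1)] by (auto simp: eventually_sequentially)
    have "\<bar>V n x - f x\<bar> \<le> \<epsilon>" if "n \<ge> N" "x \<in> C" for n x
      unfolding V_def
    proof (rule mollify_close[OF f r(1)])
      fix y assume y: "dist x y \<le> r n"
      then have "dist (f y) (f x) < \<epsilon>"
        using \<delta>(2)[OF CC'[OF that(2)] nearr[OF that(2) y]] N[OF that(1)] by (simp add: dist_commute)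
      then show "\<bar>f y - f x\<bar> \<le> \<epsilon>" by (simp add: dist_real_def)
    qed
    then show ?thesis by blast
  qed
  \<comment> \<open>At points of \<open>C\<close> the kernel is supported in \<open>U\<close>, so
    the derivative of the mollified function is the mollified weak derivative.\<close>
  have dVW: "dV n x = W n x" if x: "x \<in> C" for n x
  proof -
    have sub: "cball x (r n) \<subseteq> U" using nearr[OF x] C'U by auto
    have mb: "(\<lambda>y. mollifier (r n) (x - y)) \<in> borel_measurable borel"
      "(\<lambda>y. mollifier_deriv (r n) \<omega> (x - y)) \<in> borel_measurable borel"
      by (rule borel_measurable_continuous_onI, rule continuous_on_compose2[OF continuous_mollifier[of UNIV]],
          auto intro!: continuous_intros,
          rule borel_measurable_continuous_onI, rule continuous_on_compose2[OF continuous_mollifier_deriv[of UNIV]],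
          auto intro!: continuous_intros)
    have v_meas: "(\<lambda>x. indicator U x * v x) \<in> borel_measurable lebesgue"
      using L2_on_imp_set_integrable[OF Ul v] by (simp add: set_integrable_def borel_measurable_integrable)
    have fv: "AE y in lebesgue. f y = indicator U y * v y"
      using AEU by eventually_elim (simp add: f_def indicator_def)
    have "dV n x = (LINT y|lebesgue. f y * mollifier_deriv (r n) \<omega> (x - y))"
      unfolding dV_def convolve_def using mb by (subst integral_completion) auto
    also have "\<dots> = (LINT y|lebesgue. (indicator U y * v y) * mollifier_deriv (r n) \<omega> (x - y))"
    proof (rule integral_cong_AE)
      show "(\<lambda>y. f y * mollifier_deriv (r n) \<omega> (x - y)) \<in> borel_measurable lebesgue"
        by (rule measurable_completion) (use mb in simp)
      show "(\<lambda>y. indicator U y * v y * mollifier_deriv (r n) \<omega> (x - y)) \<in> borel_measurable lebesgue"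
        by (rule borel_measurable_times[OF v_meas measurable_completion]) (use mb in simp)
      show "AE y in lebesgue. f y * mollifier_deriv (r n) \<omega> (x - y) =
          indicator U y * v y * mollifier_deriv (r n) \<omega> (x - y)"
        using fv by eventually_elim simp
    qed
    also have "\<dots> = (LINT y:U|lebesgue. v y * mollifier_deriv (r n) \<omega> (x - y))"
      by (simp add: set_lebesgue_integral_def mult.assoc)
    also have "\<dots> = (LINT y:U|lebesgue. (\<omega> \<bullet> G y) * mollifier (r n) (x - y))"
      by (rule weak_gradient_mollifier[OF Ul v G r(1) sub])
    also have "\<dots> = (LINT y|lebesgue. (indicator U y * (\<omega> \<bullet> G y)) * mollifier (r n) (x - y))"
      by (simp add: set_lebesgue_integral_def mult.assoc)
    also have "\<dots> = (LINT y|lebesgue. g y * mollifier (r n) (x - y))"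
    proof (rule integral_cong_AE)
      show "(\<lambda>y. indicator U y * (\<omega> \<bullet> G y) * mollifier (r n) (x - y)) \<in> borel_measurable lebesgue"
        by (rule borel_measurable_times[OF g0_meas measurable_completion]) (use mb in simp)
      show "(\<lambda>y. g y * mollifier (r n) (x - y)) \<in> borel_measurable lebesgue"
        by (rule measurable_completion) (use mb in simp)
      show "AE y in lebesgue. indicator U y * (\<omega> \<bullet> G y) * mollifier (r n) (x - y) =
          g y * mollifier (r n) (x - y)"
        using g_eq' by eventually_elim simp
    qed
    also have "\<dots> = W n x"
      unfolding W_def convolve_def using mb by (subst integral_completion) auto
    finally show ?thesis .
  qed
  \<comment> \<open>The mollifier is even, so Fubini moves it from \<open>g\<close> onto
    \<open>2 * V * \<phi>\<close>. The limit is then taken with \<open>g\<close> fixed, and only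
    bounded pointwise convergence of \<open>\<Xi> n\<close> enters.\<close>
  define \<Xi> where "\<Xi> = (\<lambda>n. convolve (\<lambda>x. 2 * (V n x * \<phi> x)) (mollifier (r n)))"
  have cV: "continuous_on UNIV (V n)" "continuous_on UNIV (dV n)" for n using V1 by (auto simp: dir_C1_def)
  have key: "(LINT x|lborel. (V n x)\<^sup>2 * d\<phi> x) = - (LINT y|lborel. g y * \<Xi> n y)" for n
  proof -
    have 1: "dir_C1 \<omega> (\<lambda>x. V n x * V n x * \<phi> x)
        (\<lambda>x. (dV n x * V n x + V n x * dV n x) * \<phi> x + V n x * V n x * d\<phi> x)"
      by (intro dir_C1_mult V1 \<phi>1)
    have 2: "(LINT x|lborel. (dV n x * V n x + V n x * dV n x) * \<phi> x + V n x * V n x * d\<phi> x) = 0"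
      by (rule dir_C1_integral_zero[OF 1 C(1)]) (use C(3,4) in auto)
    have i1: "integrable lborel (\<lambda>x. (dV n x * V n x + V n x * dV n x) * \<phi> x)"
      by (rule continuous_compact_support_integrable[OF _ C(1)])
        (use C(3) cV c\<phi> in \<open>auto intro!: continuous_intros\<close>)
    have i2: "integrable lborel (\<lambda>x. V n x * V n x * d\<phi> x)"
      by (rule continuous_compact_support_integrable[OF _ C(1)])
        (use C(4) cV cd\<phi> in \<open>auto intro!: continuous_intros\<close>)
    have i3: "integrable lborel (\<lambda>x. 2 * (V n x * \<phi> x))"
      by (rule continuous_compact_support_integrable[OF _ C(1)])
        (use C(3) cV c\<phi> in \<open>auto intro!: continuous_intros\<close>)
    obtain D where D: "\<And>x::real^'n. \<bar>mollifier (r n) x\<bar> \<le> D"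
      by (rule mollifier_bounded[OF r(1)[of n], of 0]) blast
    have "(LINT x|lborel. (V n x)\<^sup>2 * d\<phi> x) = - (LINT x|lborel. (dV n x * V n x + V n x * dV n x) * \<phi> x)"
      using 2 i1 i2 by (simp add: power2_eq_square)
    also have "(LINT x|lborel. (dV n x * V n x + V n x * dV n x) * \<phi> x) = (LINT x|lborel. (2 * (V n x * \<phi> x)) * W n x)"
    proof (intro Bochner_Integration.integral_cong refl)
      fix x show "(dV n x * V n x + V n x * dV n x) * \<phi> x = 2 * (V n x * \<phi> x) * W n x"
        by (cases "x \<in> C") (auto simp: dVW C(3))
    qed
    also have "\<dots> = (LINT y|lborel. g y * (LINT x|lborel. 2 * (V n x * \<phi> x) * mollifier (r n) (x - y)))"
      unfolding W_def by (rule convolve_fubini[OF g i3 continuous_mollifier D])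
    also have "\<dots> = (LINT y|lborel. g y * \<Xi> n y)"
    proof -
      have "mollifier (r n) (x - y) = mollifier (r n) (y - x)" for x y :: "real^'n"
        by (simp add: mollifier_def inner_diff_left inner_diff_right algebra_simps)
      then show ?thesis by (simp add: \<Xi>_def convolve_def)
    qed
    finally show ?thesis .
  qed
  have lim1: "(\<lambda>n. LINT x|lborel. (V n x)\<^sup>2 * d\<phi> x) \<longlonglongrightarrow> (LINT x|lborel. (f x)\<^sup>2 * d\<phi> x)"
  proof (rule integral_dominated_convergence[where w = "\<lambda>x. M\<^sup>2 * \<bar>d\<phi> x\<bar>"])
    show "integrable lborel (\<lambda>x. M\<^sup>2 * \<bar>d\<phi> x\<bar>)"
      by (intro integrable_mult_right integrable_abs continuous_compact_support_integrable[OF cd\<phi> C(1) C(4)])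
    have "V n \<in> borel_measurable borel" for n by (rule borel_measurable_continuous_onI[OF cV(1)])
    then show "(\<lambda>x. (V n x)\<^sup>2 * d\<phi> x) \<in> borel_measurable lborel" for n by simp
    show "AE x in lborel. norm ((V n x)\<^sup>2 * d\<phi> x) \<le> M\<^sup>2 * \<bar>d\<phi> x\<bar>" for n
    proof (rule AE_I2)
      fix x show "norm ((V n x)\<^sup>2 * d\<phi> x) \<le> M\<^sup>2 * \<bar>d\<phi> x\<bar>"
        using power_mono[OF Vb[of x n] abs_ge_zero, of 2] C(4)[of x]
        by (cases "x \<in> C") (auto simp: abs_mult intro: mult_right_mono)
    qed
    show "AE x in lborel. (\<lambda>n. (V n x)\<^sup>2 * d\<phi> x) \<longlonglongrightarrow> (f x)\<^sup>2 * d\<phi> x"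
    proof (rule AE_I2)
      fix x
      show "(\<lambda>n. (V n x)\<^sup>2 * d\<phi> x) \<longlonglongrightarrow> (f x)\<^sup>2 * d\<phi> x"
      proof (cases "x \<in> C")
        case True
        have "(\<lambda>n. V n x) \<longlonglongrightarrow> f x"
        proof (rule LIMSEQ_I)
          fix \<epsilon> :: real assume "\<epsilon> > 0"
          then obtain N where "\<forall>n\<ge>N. \<forall>x\<in>C. \<bar>V n x - f x\<bar> \<le> \<epsilon> / 2" using Vconv[of "\<epsilon> / 2"] by auto
          then have "\<forall>n\<ge>N. norm (V n x - f x) < \<epsilon>" using True \<open>\<epsilon> > 0\<close> by fastforce
          then show "\<exists>N. \<forall>n\<ge>N. norm (V n x - f x) < \<epsilon>" by blast
        qed
        then show ?thesis by (intro tendsto_intros)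
      qed (simp add: C(4))
    qed
  qed simp
  \<comment> \<open>\<open>f\<close> may jump at the boundary of \<open>U\<close>, but
    \<open>\<phi>\<close> already vanishes off \<open>C\<close>; the open sets \<open>U\<close> and
    the complement of \<open>C\<close> cover the space.\<close>
  have cf\<phi>: "continuous_on UNIV (\<lambda>x. 2 * (f x * \<phi> x))"
  proof -
    have "continuous_on U (\<lambda>x. 2 * (f x * \<phi> x))"
      by (intro continuous_intros cf continuous_on_subset[OF c\<phi>]) auto
    moreover have "continuous_on (- C) (\<lambda>x. 2 * (f x * \<phi> x))"
      by (rule continuous_on_eq[OF continuous_on_const[of _ 0]]) (simp add: C(3))
    ultimately have "continuous_on (U \<union> - C) (\<lambda>x. 2 * (f x * \<phi> x))"
      using C(1) U(1) by (intro continuous_on_open_Un) (auto simp: compact_imp_closed)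
    moreover have "U \<union> - C = UNIV" using C(2) by blast
    ultimately show ?thesis by simp
  qed
  have iV\<phi>: "integrable lborel (\<lambda>x. 2 * (V n x * \<phi> x))" for n
    by (rule continuous_compact_support_integrable[OF _ C(1)])
      (use C(3) cV c\<phi> in \<open>auto intro!: continuous_intros\<close>)
  have \<Xi>b: "\<bar>\<Xi> n y\<bar> \<le> 2 * (M * B)" for n y
  proof -
    have "\<bar>2 * (V n x * \<phi> x)\<bar> \<le> 2 * (M * B)" for x
      using mult_mono[OF Vb[of x n] B(2)[of x]] M(1) B(1) C(3)[of x]
      by (cases "x \<in> C") (auto simp: abs_mult)
    then show ?thesis
      using mollify_close[OF iV\<phi>[of n] r(1)[of n], of y 0 "2 * (M * B)"] by (simp add: \<Xi>_def)
  qed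
  have \<Xi>conv: "(\<lambda>n. \<Xi> n y) \<longlonglongrightarrow> 2 * (f y * \<phi> y)" for y
  proof (rule LIMSEQ_I)
    fix \<epsilon> :: real assume \<epsilon>: "\<epsilon> > 0"
    have "isCont (\<lambda>x. 2 * (f x * \<phi> x)) y" using cf\<phi> continuous_on_eq_continuous_at[OF open_UNIV] by blast
    then obtain \<delta> where \<delta>: "\<delta> > 0" "\<And>x. dist x y < \<delta> \<Longrightarrow> dist (2 * (f x * \<phi> x)) (2 * (f y * \<phi> y)) < \<epsilon> / 4"
      using \<epsilon> unfolding continuous_at_eps_delta by (metis zero_less_divide_iff zero_less_numeral)
    obtain N1 where N1: "\<And>n. n \<ge> N1 \<Longrightarrow> r n < \<delta>"
      using order_tendstoD(2)[OF r0 \<delta>(1)] by (auto simp: eventually_sequentially)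
    \<comment> \<open>With |\<phi>| at most \<open>B\<close>, this tolerance makes
      \<open>2 * (V n x * \<phi> x)\<close> differ from its limit by at most a quarter of
      \<epsilon>.\<close>
    obtain N2 where N2: "\<And>n x. n \<ge> N2 \<Longrightarrow> x \<in> C \<Longrightarrow> \<bar>V n x - f x\<bar> \<le> \<epsilon> / (8 * B)"
      using Vconv[of "\<epsilon> / (8 * B)"] \<epsilon> B(1) by auto
    have "norm (\<Xi> n y - 2 * (f y * \<phi> y)) < \<epsilon>" if n: "n \<ge> max N1 N2" for n
    proof -
      have "\<bar>\<Xi> n y - 2 * (f y * \<phi> y)\<bar> \<le> \<epsilon> / 2"
        unfolding \<Xi>_def
      proof (rule mollify_close[OF iV\<phi> r(1)])
        fix x assume "dist y x \<le> r n"
        then have 1: "\<bar>2 * (f x * \<phi> x) - 2 * (f y * \<phi> y)\<bar> < \<epsilon> / 4"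
          using \<delta>(2)[of x] N1[of n] n by (simp add: dist_commute dist_real_def)
        have 2: "\<bar>2 * (V n x * \<phi> x) - 2 * (f x * \<phi> x)\<bar> \<le> \<epsilon> / 4"
        proof (cases "x \<in> C")
          case True
          have "\<bar>V n x - f x\<bar> * \<bar>\<phi> x\<bar> \<le> \<epsilon> / (8 * B) * B"
            using N2[OF _ True, of n] n B \<epsilon> by (intro mult_mono) auto
          moreover have "\<bar>2 * (V n x * \<phi> x) - 2 * (f x * \<phi> x)\<bar> = 2 * (\<bar>V n x - f x\<bar> * \<bar>\<phi> x\<bar>)"
          proof -
            have "2 * (V n x * \<phi> x) - 2 * (f x * \<phi> x) = 2 * ((V n x - f x) * \<phi> x)"
              by (simp add: algebra_simps)
            then show ?thesis by (simp add: abs_mult)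
          qed
          ultimately show ?thesis using B(1) by simp
        qed (use \<epsilon> in \<open>simp add: C(3)\<close>)
        show "\<bar>2 * (V n x * \<phi> x) - 2 * (f y * \<phi> y)\<bar> \<le> \<epsilon> / 2"
          using 1 2 by linarith
      qed
      then show ?thesis using \<epsilon> by simp
    qed
    then show "\<exists>N. \<forall>n\<ge>N. norm (\<Xi> n y - 2 * (f y * \<phi> y)) < \<epsilon>" by blast
  qed
  have lim2: "(\<lambda>n. LINT y|lborel. g y * \<Xi> n y) \<longlonglongrightarrow> (LINT y|lborel. g y * (2 * (f y * \<phi> y)))"
  proof (rule integral_dominated_convergence[where w = "\<lambda>y. \<bar>g y\<bar> * (2 * (M * B))"])
    show "integrable lborel (\<lambda>y. \<bar>g y\<bar> * (2 * (M * B)))" using g by simp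
    have "continuous_on UNIV (\<Xi> n)" for n
    proof -
      obtain D where D: "\<And>x::real^'n. \<bar>mollifier (r n) x\<bar> \<le> D"
        by (rule mollifier_bounded[OF r(1)[of n], of 0]) blast
      show ?thesis unfolding \<Xi>_def by (rule continuous_convolve[OF iV\<phi> continuous_mollifier D])
    qed
    then have "\<Xi> n \<in> borel_measurable borel" for n by (rule borel_measurable_continuous_onI)
    then show "(\<lambda>y. g y * \<Xi> n y) \<in> borel_measurable lborel" for n by simp
    show "AE y in lborel. norm (g y * \<Xi> n y) \<le> \<bar>g y\<bar> * (2 * (M * B))" for n
      using \<Xi>b by (intro AE_I2) (auto simp: abs_mult intro: mult_left_mono)
    show "AE y in lborel. (\<lambda>n. g y * \<Xi> n y) \<longlonglongrightarrow> g y * (2 * (f y * \<phi> y))"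
      by (intro AE_I2 tendsto_intros \<Xi>conv)
  qed simp
  have "(\<lambda>n. LINT x|lborel. (V n x)\<^sup>2 * d\<phi> x) \<longlonglongrightarrow> - (LINT y|lborel. g y * (2 * (f y * \<phi> y)))"
    unfolding key by (rule tendsto_minus[OF lim2])
  then show ?thesis
    unfolding lhs rhs using lim1 LIMSEQ_unique by blast
qed

section \<open>Facets of a solid polytope\<close>

definition facet_offset :: "(real^'n) set \<Rightarrow> (real^'n) set \<Rightarrow> real" where
  "facet_offset P f = (THE b. \<forall>y\<in>f. facet_normal P f \<bullet> y = b)"

text \<open>The part of \<open>a'\<close> orthogonal to \<open>a\<close> is, by assumption,
  orthogonal to \<open>a'\<close> as well, and therefore orthogonal to itself.\<close>

lemma unit_parallel:
  fixes a a' :: "'a::euclidean_space"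
  assumes "norm a = 1" "norm a' = 1" "\<And>z. a \<bullet> z = 0 \<Longrightarrow> a' \<bullet> z = 0"
  shows "a' = a \<or> a' = - a"
proof -
  let ?z = "a' - (a' \<bullet> a) *\<^sub>R a"
  have aa: "a \<bullet> a = 1" "a' \<bullet> a' = 1" using assms(1,2) by (auto simp: norm_eq_1)
  have "a \<bullet> ?z = 0" using aa by (simp add: inner_diff_right inner_commute)
  then have "a' \<bullet> ?z = 0" by (rule assms(3))
  then have "(a' \<bullet> a)\<^sup>2 = 1" using aa by (simp add: inner_diff_right power2_eq_square)
  then have c: "a' \<bullet> a = 1 \<or> a' \<bullet> a = -1" by (simp add: power2_eq_1_iff)
  have "?z \<bullet> ?z = a' \<bullet> ?z - (a' \<bullet> a) * (a \<bullet> ?z)" by (simp add: inner_diff_left)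
  then have "?z = 0" using \<open>a \<bullet> ?z = 0\<close> \<open>a' \<bullet> ?z = 0\<close> by simp
  then show ?thesis using c by auto
qed

locale solid_polytope =
  fixes P :: "(real^'n) set"
  assumes poly: "polytope P" and solid: "interior P \<noteq> {}"
begin

abbreviation nrm :: "(real^'n) set \<Rightarrow> real^'n" where "nrm f \<equiv> facet_normal P f"
abbreviation off :: "(real^'n) set \<Rightarrow> real" where "off f \<equiv> facet_offset P f"

text \<open>By dimension the affine hull of a facet is its whole supporting hyperplane, so two unit
  normals are parallel. Opposite normals would squeeze \<open>P\<close> into that hyperplane,
  against its nonempty interior. This gives the definite description in \<open>facet_normal\<close>
  a meaning.\<close>

lemma facet_normal_unique:
  assumes f: "f facet_of P"
    and a: "norm a = 1" "P \<subseteq> {x. a \<bullet> x \<le> b}" "f = P \<inter> {x. a \<bullet> x = b}"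
    and a': "norm a' = 1" "P \<subseteq> {x. a' \<bullet> x \<le> b'}" "f = P \<inter> {x. a' \<bullet> x = b'}"
  shows "a' = a"
proof -
  have a0: "a \<noteq> 0" "a' \<noteq> 0" using a(1) a'(1) by auto
  have "f \<noteq> {}" "aff_dim f = aff_dim P - 1" using f by (auto simp: facet_of_def)
  then have "aff_dim f = int (DIM(real^'n)) - 1"
    using aff_dim_nonempty_interior[OF solid] by simp
  then have eqd: "aff_dim f = aff_dim {x. a \<bullet> x = b}" using aff_dim_hyperplane[OF a0(1)] by simp
  have sub: "affine hull f \<subseteq> {x. a \<bullet> x = b}"
    using a(3) by (intro hull_minimal affine_hyperplane) auto
  have hyp: "affine hull f = {x. a \<bullet> x = b}"
  proof (rule ccontr)
    assume "affine hull f \<noteq> {x. a \<bullet> x = b}"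
    then have "affine hull f \<subset> affine hull {x. a \<bullet> x = b}"
      using sub by (simp add: affine_hull_eq[THEN iffD2, OF affine_hyperplane] psubset_eq)
    from aff_dim_psubset[OF this] eqd show False by simp
  qed
  have "affine hull f \<subseteq> {x. a' \<bullet> x = b'}"
    using a'(3) by (intro hull_minimal affine_hyperplane) auto
  then have imp: "a' \<bullet> x = b'" if "a \<bullet> x = b" for x using hyp that by auto
  have aa: "a \<bullet> a = 1" using a(1) by (simp add: norm_eq_1)
  have "a' \<bullet> z = 0" if "a \<bullet> z = 0" for z
    using imp[of "b *\<^sub>R a"] imp[of "b *\<^sub>R a + z"] that aa by (simp add: inner_add_right)
  from unit_parallel[OF a(1) a'(1) this] consider "a' = a" | "a' = - a" by blast
  then show ?thesis
  proof cases
    case 2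
    then have "b' = - b" using imp[of "b *\<^sub>R a"] aa by simp
    then have "P \<subseteq> {x. a \<bullet> x = b}" using a(2) a'(2) 2 by fastforce
    then have "interior P \<subseteq> interior {x. a \<bullet> x = b}" by (rule interior_mono)
    then show ?thesis using solid interior_hyperplane[OF a0(1)] by auto
  qed
qed

text \<open>A minimal half-space representation with normals scaled to length 1. As \<open>P\<close>
  is solid, its affine hull is the whole space and its relative interior is the interior.\<close>

lemma facet_representation:
  "\<exists>(F :: (real^'n) set set) a b. (\<forall>h\<in>F. norm (a h) = 1) \<and>
     (\<forall>x. x \<in> P \<longleftrightarrow> (\<forall>h\<in>F. a h \<bullet> x \<le> b h)) \<and>
     (\<forall>f. f facet_of P \<longleftrightarrow> (\<exists>h\<in>F. f = P \<inter> {x. a h \<bullet> x = b h})) \<and>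
     (\<forall>x. x \<in> interior P \<longleftrightarrow> (\<forall>h\<in>F. a h \<bullet> x < b h))"
proof -
  have hullP: "affine hull P = UNIV" by (rule affine_hull_nonempty_interior[OF solid])
  obtain F where F: "finite F" "P = (affine hull P) \<inter> \<Inter>F"
    "\<forall>h\<in>F. \<exists>a b. a \<noteq> 0 \<and> h = {x. a \<bullet> x \<le> b}" "\<forall>F'. F' \<subset> F \<longrightarrow> P \<subset> (affine hull P) \<inter> \<Inter>F'"
    using polytope_imp_polyhedron[OF poly] unfolding polyhedron_Int_affine_minimal by blast
  from F(3) obtain a0 b0 where ab0: "\<And>h. h \<in> F \<Longrightarrow> a0 h \<noteq> 0 \<and> h = {x. a0 h \<bullet> x \<le> b0 h}" by metis
  define a where "a = (\<lambda>h. a0 h /\<^sub>R norm (a0 h))"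
  define b where "b = (\<lambda>h. b0 h / norm (a0 h))"
  have mem: "x \<in> h \<longleftrightarrow> a h \<bullet> x \<le> b h" and nrm1: "norm (a h) = 1" if "h \<in> F" for h x
  proof -
    have n: "norm (a0 h) > 0" using ab0[OF that] by simp
    have "x \<in> h \<longleftrightarrow> a0 h \<bullet> x \<le> b0 h" using ab0[OF that] by blast
    then show "x \<in> h \<longleftrightarrow> a h \<bullet> x \<le> b h"
      using n by (simp add: a_def b_def divide_simps mult.commute)
    show "norm (a h) = 1" using n by (simp add: a_def)
  qed
  have ab: "a h \<noteq> 0 \<and> h = {x. a h \<bullet> x \<le> b h}" if "h \<in> F" for h
  proof
    show "a h \<noteq> 0" using nrm1[OF that] by force
    show "h = {x. a h \<bullet> x \<le> b h}" by (rule set_eqI) (simp only: mem_Collect_eq mem[OF that])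
  qed
  have psub: "\<And>F'. F' \<subset> F \<Longrightarrow> P \<subset> affine hull P \<inter> \<Inter>F'" by (rule F(4)[rule_format])
  have memP: "x \<in> P \<longleftrightarrow> (\<forall>h\<in>F. a h \<bullet> x \<le> b h)" for x
  proof -
    have "x \<in> P \<longleftrightarrow> x \<in> affine hull P \<inter> \<Inter>F" using F(2) by simp
    also have "\<dots> \<longleftrightarrow> (\<forall>h\<in>F. x \<in> h)" using hullP by simp
    finally show ?thesis using mem by blast
  qed
  have fac: "f facet_of P \<longleftrightarrow> (\<exists>h\<in>F. f = P \<inter> {x. a h \<bullet> x = b h})" for f
  proof -
    have "f facet_of P \<longleftrightarrow> (\<exists>h. h \<in> F \<and> f = P \<inter> {x. a h \<bullet> x = b h})"
      by (rule facet_of_polyhedron_explicit[OF F(1,2)]) (fact ab, fact psub)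
    then show ?thesis by (simp only: Bex_def)
  qed
  have "interior P = {x \<in> P. \<forall>h\<in>F. a h \<bullet> x < b h}"
    unfolding rel_interior_nonempty_interior[OF solid, symmetric]
    by (rule rel_interior_polyhedron_explicit[OF F(1,2)]) (fact ab, fact psub)
  then have int: "x \<in> interior P \<longleftrightarrow> (\<forall>h\<in>F. a h \<bullet> x < b h)" for x
    using memP[of x] by (auto intro: less_imp_le)
  show ?thesis
    by (rule exI[of _ F], rule exI[of _ a], rule exI[of _ b])
      (intro conjI ballI allI nrm1 memP fac int)
qed

lemma facet_ne: "f facet_of P \<Longrightarrow> f \<noteq> {}"
  by (simp add: facet_of_def)

lemma facet_offset_eq:
  assumes "f facet_of P" "f = P \<inter> {x. nrm f \<bullet> x = b}"
  shows "off f = b"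
  unfolding facet_offset_def
proof (rule the_equality)
  show "\<forall>y\<in>f. nrm f \<bullet> y = b" using assms(2) by blast
  fix c assume c: "\<forall>y\<in>f. nrm f \<bullet> y = c"
  obtain y where "y \<in> f" using facet_ne[OF assms(1)] by blast
  moreover from this have "nrm f \<bullet> y = b" using assms(2) by blast
  ultimately show "c = b" using c by simp
qed

lemma facet_normal_eq:
  assumes "f facet_of P" "norm a = 1" "P \<subseteq> {x. a \<bullet> x \<le> b}" "f = P \<inter> {x. a \<bullet> x = b}"
  shows "nrm f = a" "off f = b"
proof -
  show n: "nrm f = a"
    unfolding facet_normal_def
    by (rule the_equality) (use assms facet_normal_unique[OF assms(1-4)] in blast)+
  show "off f = b" by (rule facet_offset_eq) (use assms n in auto)
qed

lemma finite_facets: "finite {f. f facet_of P}"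
  by (rule finite_polytope_facets[OF poly])

lemma facet_props:
  assumes "f facet_of P"
  shows "norm (nrm f) = 1" "P \<subseteq> {x. nrm f \<bullet> x \<le> off f}" "f = P \<inter> {x. nrm f \<bullet> x = off f}"
proof -
  from facet_representation obtain F :: "(real^'n) set set" and a b where F: "\<And>h. h \<in> F \<Longrightarrow> norm (a h) = 1"
    "\<And>x. x \<in> P \<longleftrightarrow> (\<forall>h\<in>F. a h \<bullet> x \<le> b h)" "\<And>f. f facet_of P \<longleftrightarrow> (\<exists>h\<in>F. f = P \<inter> {x. a h \<bullet> x = b h})"
    by (elim exE conjE) (rule that; simp)
  from assms F(3) obtain h where h: "h \<in> F" "f = P \<inter> {x. a h \<bullet> x = b h}" by blast
  have sub: "P \<subseteq> {x. a h \<bullet> x \<le> b h}" using F(2) h(1) by blast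
  have eq: "nrm f = a h" "off f = b h"
    by (rule facet_normal_eq[OF assms F(1)[OF h(1)] sub h(2)])+
  show "norm (nrm f) = 1" "P \<subseteq> {x. nrm f \<bullet> x \<le> off f}" "f = P \<inter> {x. nrm f \<bullet> x = off f}"
    unfolding eq by (rule F(1)[OF h(1)], rule sub, rule h(2))
qed

lemma polytope_eq: "x \<in> P \<longleftrightarrow> (\<forall>f. f facet_of P \<longrightarrow> nrm f \<bullet> x \<le> off f)" (is ?thesis1)
  and interior_eq: "x \<in> interior P \<longleftrightarrow> (\<forall>f. f facet_of P \<longrightarrow> nrm f \<bullet> x < off f)" (is ?thesis2)
proof -
  from facet_representation obtain F :: "(real^'n) set set" and a b where F: "\<And>h. h \<in> F \<Longrightarrow> norm (a h) = 1"
    "\<And>x. x \<in> P \<longleftrightarrow> (\<forall>h\<in>F. a h \<bullet> x \<le> b h)" "\<And>f. f facet_of P \<longleftrightarrow> (\<exists>h\<in>F. f = P \<inter> {x. a h \<bullet> x = b h})"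
    "\<And>x. x \<in> interior P \<longleftrightarrow> (\<forall>h\<in>F. a h \<bullet> x < b h)"
    by (elim exE conjE) (rule that; simp)
  have eq: "nrm f = a h" "off f = b h" if "h \<in> F" "f = P \<inter> {x. a h \<bullet> x = b h}" for f h
  proof -
    have "f facet_of P" using F(3) that by blast
    moreover have "P \<subseteq> {x. a h \<bullet> x \<le> b h}" using F(2) that(1) by blast
    ultimately show "nrm f = a h" "off f = b h"
      using facet_normal_eq[OF _ F(1)[OF that(1)] _ that(2)] by blast+
  qed
  have *: "(\<forall>f. f facet_of P \<longrightarrow> Q (nrm f) (off f)) \<longleftrightarrow> (\<forall>h\<in>F. Q (a h) (b h))" for Q
  proof
    assume Q: "\<forall>f. f facet_of P \<longrightarrow> Q (nrm f) (off f)"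
    show "\<forall>h\<in>F. Q (a h) (b h)"
    proof
      fix h assume h: "h \<in> F"
      then have "(P \<inter> {x. a h \<bullet> x = b h}) facet_of P" using F(3) by blast
      then show "Q (a h) (b h)" using Q eq[OF h refl] by metis
    qed
  next
    assume Q: "\<forall>h\<in>F. Q (a h) (b h)"
    show "\<forall>f. f facet_of P \<longrightarrow> Q (nrm f) (off f)"
    proof (intro allI impI)
      fix f assume "f facet_of P"
      then obtain h where "h \<in> F" "f = P \<inter> {x. a h \<bullet> x = b h}" using F(3) by blast
      then show "Q (nrm f) (off f)" using Q eq by metis
    qed
  qed
  show ?thesis1 unfolding *[of "\<lambda>a b. a \<bullet> x \<le> b"] by (rule F(2))
  show ?thesis2 unfolding *[of "\<lambda>a b. a \<bullet> x < b"] by (rule F(4))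
qed

text \<open>A proper face of a convex set has smaller dimension, while all facets have the same
  one.\<close>

lemma facet_subset_eq:
  assumes "f facet_of P" "f' facet_of P" "f \<subseteq> f'"
  shows "f = f'"
proof -
  have "f face_of f'"
    using assms by (meson face_of_subset facet_of_imp_face_of facet_of_imp_subset)
  moreover have "aff_dim f = aff_dim f'" using assms by (simp add: facet_of_def)
  moreover have "convex f'"
    using assms(2) poly by (meson face_of_imp_convex facet_of_imp_face_of)
  ultimately show ?thesis using face_of_aff_dim_lt[of f' f] by auto
qed

text \<open>If a relatively interior point of \<open>f\<close> lay on another facet
  \<open>f'\<close>, the functional defining \<open>f'\<close> would attain its maximum there and
  hence be constant on \<open>f\<close>, which would put \<open>f\<close> inside
  \<open>f'\<close>.\<close>

lemma rel_interior_facet: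
  assumes f: "f facet_of P"
  shows "rel_interior f = {y. nrm f \<bullet> y = off f \<and> (\<forall>f'. f' facet_of P \<longrightarrow> f' \<noteq> f \<longrightarrow> nrm f' \<bullet> y < off f')}"
    (is "_ = ?R")
proof
  have cf: "convex f" using f poly by (meson face_of_imp_convex facet_of_imp_face_of)
  let ?O = "\<Inter>f'\<in>{f'. f' facet_of P \<and> f' \<noteq> f}. {y. nrm f' \<bullet> y < off f'}"
  have fin: "finite {f'. f' facet_of P \<and> f' \<noteq> f}" using finite_facets by (rule finite_subset[rotated]) auto
  have "open ?O" by (intro open_INT fin ballI open_halfspace_lt)
  have Req: "?R = {y. nrm f \<bullet> y = off f} \<inter> ?O" by auto
  have Rf: "?R \<subseteq> f"
  proof
    fix y assume y: "y \<in> ?R"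
    have "nrm f' \<bullet> y \<le> off f'" if "f' facet_of P" for f' using y that by (cases "f' = f") (auto intro: less_imp_le)
    then have "y \<in> P" by (simp add: polytope_eq)
    then show "y \<in> f" using y by (subst facet_props(3)[OF f]) auto
  qed
  have sub: "affine hull f \<subseteq> {x. nrm f \<bullet> x = off f}"
    using facet_props(3)[OF f] by (intro hull_minimal affine_hyperplane) blast
  show "?R \<subseteq> rel_interior f"
  proof
    fix y assume y: "y \<in> ?R"
    show "y \<in> rel_interior f"
      unfolding rel_interior
      using \<open>open ?O\<close> y Rf sub Req by (intro CollectI conjI exI[of _ ?O]) blast+
  qed
  show "rel_interior f \<subseteq> ?R"
  proof
    fix y assume y: "y \<in> rel_interior f"
    then have yf: "y \<in> f" using rel_interior_subset by blast
    then have yP: "y \<in> P" and y1: "nrm f \<bullet> y = off f" using facet_props(3)[OF f] by blast+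
    have "nrm f' \<bullet> y < off f'" if f': "f' facet_of P" "f' \<noteq> f" for f'
    proof (rule ccontr)
      assume "\<not> nrm f' \<bullet> y < off f'"
      then have eq: "nrm f' \<bullet> y = off f'" using facet_props(2)[OF f'(1)] yP by fastforce
      have "f \<subseteq> f'"
      proof
        fix z assume z: "z \<in> f"
        then have zP: "z \<in> P" using facet_props(3)[OF f] by blast
        have zle: "nrm f' \<bullet> z \<le> off f'" using facet_props(2)[OF f'(1)] zP by blast
        \<comment> \<open>The segment from \<open>z\<close> to \<open>y\<close> can be prolonged
          beyond \<open>y\<close> within \<open>f\<close>. A linear functional that is maximal at
          the inner point \<open>y\<close> is maximal at \<open>z\<close> too.\<close>
        have "\<exists>e>1. (1 - e) *\<^sub>R z + e *\<^sub>R y \<in> f"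
          using convex_rel_interior_iff[OF cf] y z by blast
        then obtain e where e: "e > 1" "(1 - e) *\<^sub>R z + e *\<^sub>R y \<in> f" by blast
        then have "(1 - e) *\<^sub>R z + e *\<^sub>R y \<in> P" using facet_props(3)[OF f] by blast
        then have "nrm f' \<bullet> ((1 - e) *\<^sub>R z + e *\<^sub>R y) \<le> off f'" using facet_props(2)[OF f'(1)] by blast
        then have "(1 - e) * (nrm f' \<bullet> z - off f') \<le> 0"
          using eq by (simp add: inner_add_right algebra_simps)
        then have "nrm f' \<bullet> z \<ge> off f'" using e(1) by (simp add: mult_le_0_iff)
        then show "z \<in> f'" using zle zP by (subst facet_props(3)[OF f'(1)]) auto
      qed
      then show False using facet_subset_eq[OF f f'(1)] f'(2) by simp
    qed
    then show "y \<in> ?R" using y1 by blast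
  qed
qed

lemma compact_polytope: "compact P"
  by (rule polytope_imp_compact[OF poly])

lemma closure_interior: "closure (interior P) = P"
  using solid poly convex_closure_interior[of P] compact_polytope
  by (simp add: polytope_imp_convex compact_imp_closed closure_closed)

lemma negligible_boundary: "negligible (P - interior P)"
  using negligible_convex_frontier[OF polytope_imp_convex[OF poly]] compact_polytope
  by (simp add: frontier_def compact_imp_closed closure_closed)

text \<open>Points whose projection to the hyperplane of \<open>f\<close> lands on the hyperplane of
  \<open>f'\<close> form a hyperplane, except for parallel normals, where there are none: equal
  normals would give \<open>f' = f\<close>, opposite ones a flat \<open>P\<close>. This null set is
  discarded in the layer limit.\<close>

lemma facet_negligible_inter:
  assumes f: "f facet_of P" "f' facet_of P" "f' \<noteq> f"
  shows "negligible {x. nrm f' \<bullet> (x - (nrm f \<bullet> x - off f) *\<^sub>R nrm f) = off f'}"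
proof -
  let ?a = "nrm f" and ?a' = "nrm f'"
  let ?c = "?a' - (?a' \<bullet> ?a) *\<^sub>R ?a"
  have eq: "{x. ?a' \<bullet> (x - (?a \<bullet> x - off f) *\<^sub>R ?a) = off f'} = {x. ?c \<bullet> x = off f' - off f * (?a' \<bullet> ?a)}"
    by (auto simp: inner_diff_right inner_diff_left algebra_simps)
  show ?thesis
  proof (cases "?c = 0")
    case False
    then show ?thesis unfolding eq by (intro negligible_hyperplane) auto
  next
    case True
    then have a'a: "?a' = (?a' \<bullet> ?a) *\<^sub>R ?a" by simp
    then have "?a' \<bullet> z = 0" if "?a \<bullet> z = 0" for z using that by (metis inner_scaleR_left mult_zero_right)
    from unit_parallel[OF facet_props(1)[OF f(1)] facet_props(1)[OF f(2)] this]
    have par: "?a' = ?a \<or> ?a' = - ?a" .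
    have aa: "?a \<bullet> ?a = 1" using facet_props(1)[OF f(1)] by (simp add: norm_eq_1)
    have "off f' \<noteq> off f * (?a' \<bullet> ?a)"
    proof
      assume b: "off f' = off f * (?a' \<bullet> ?a)"
      from par show False
      proof
        assume "?a' = ?a"
        then have "f' = f" using b aa facet_props(3)[OF f(1)] facet_props(3)[OF f(2)] by simp
        then show False using f(3) by simp
      next
        assume "?a' = - ?a"
        then have "P \<subseteq> {x. ?a \<bullet> x = off f}"
          using b aa facet_props(2)[OF f(1)] facet_props(2)[OF f(2)] by fastforce
        then have "interior P \<subseteq> interior {x. ?a \<bullet> x = off f}" by (rule interior_mono)
        moreover have "?a \<noteq> 0" using aa by auto
        ultimately show False using solid interior_hyperplane[of ?a "off f"] by auto
      qed
    qed
    then show ?thesis unfolding eq True by simp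
  qed
qed

end

section \<open>Change of variables for real integrands\<close>

text \<open>The two integrands are absolutely integrable together, and if they are not, both
  integrals are 0; hence no integrability assumption on \<open>f\<close>. Real values are handled as
  vectors in \<open>real^1\<close>.\<close>

lemma lebesgue_change_of_variables:
  fixes f :: "real^'n::{finite,wellorder} \<Rightarrow> real" and g :: "real^'n::_ \<Rightarrow> real^'n::_"
  assumes "S \<in> sets lebesgue"
    and "\<And>x. x \<in> S \<Longrightarrow> (g has_derivative g' x) (at x within S)" and "inj_on g S"
  shows "(LINT x:g ` S|lebesgue. f x) = (LINT x:S|lebesgue. \<bar>det (matrix (g' x))\<bar> * f (g x))"
proof -
  let ?h = "\<lambda>x. \<bar>det (matrix (g' x))\<bar> * f (g x)"
  have abs1: "((\<lambda>x. vec (k x) :: real^1) absolutely_integrable_on A) \<longleftrightarrow> k absolutely_integrable_on A"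
    and int1: "integral A (\<lambda>x. vec (k x) :: real^1) = vec (integral A k)" for A and k :: "real^'n::_ \<Rightarrow> real"
    unfolding absolutely_integrable_on_1_iff integral_on_1_eq by simp_all
  have vs: "c *\<^sub>R (vec k :: real^1) = vec (c * k)" for c k by (simp add: vec_eq_iff)
  have veq: "(vec k :: real^1) = vec b \<longleftrightarrow> k = b" for k b by (simp add: vec_eq_iff)
  have cov: "?h absolutely_integrable_on S \<and> integral S ?h = b \<longleftrightarrow>
      f absolutely_integrable_on (g ` S) \<and> integral (g ` S) f = b" for b
    using has_absolute_integral_change_of_variables[OF assms, of "\<lambda>x. vec (f x) :: real^1" "vec b"]
    unfolding vs abs1 int1 veq .
  show ?thesis
  proof (cases "f absolutely_integrable_on (g ` S)")
    case True
    then have "?h absolutely_integrable_on S" "integral S ?h = integral (g ` S) f"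
      using cov[of "integral (g ` S) f"] by auto
    then show ?thesis using True by (simp add: set_lebesgue_integral_eq_integral)
  next
    case False
    then have "\<not> ?h absolutely_integrable_on S" using cov[of "integral S ?h"] by auto
    then show ?thesis using False
      by (simp add: set_integrable_def set_lebesgue_integral_def not_integrable_integral_eq)
  qed
qed

text \<open>The map scales the direction \<open>a\<close> by \<open>1 - c\<close> and fixes its
  orthogonal complement. Conjugation with an orthogonal map that sends an axis to \<open>a\<close>
  makes the matrix diagonal.\<close>

lemma det_shrink_along:
  fixes a :: "real^'n"
  assumes "norm a = 1"
  shows "det (matrix (\<lambda>v::real^'n. v - (c * (a \<bullet> v)) *\<^sub>R a)) = 1 - c"
proof -
  obtain k :: 'n where True by blast
  let ?e = "axis k 1 :: real^'n"
  obtain R :: "real^'n \<Rightarrow> real^'n" where R: "orthogonal_transformation R" "R ?e = a"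
    using orthogonal_transformation_exists_1[of ?e a] assms by (auto simp: norm_axis_1)
  have linR: "linear R" using R(1) by (rule orthogonal_transformation_linear)
  let ?D = "\<lambda>v::real^'n. v - (c * (?e \<bullet> v)) *\<^sub>R ?e"
  let ?T = "\<lambda>v::real^'n. v - (c * (a \<bullet> v)) *\<^sub>R a"
  have linD: "linear ?D" "linear ?T"
    by (rule linearI; simp add: inner_add_right algebra_simps)+
  have "?T \<circ> R = R \<circ> ?D"
  proof
    fix v
    have "a \<bullet> R v = ?e \<bullet> v" using R by (metis orthogonal_transformation_def)
    then show "(?T \<circ> R) v = (R \<circ> ?D) v"
      using R(2) linR by (simp add: linear_diff linear_scale)
  qed
  then have "matrix ?T ** matrix R = matrix R ** matrix ?D"
    using matrix_compose[OF linR linD(2)] matrix_compose[OF linD(1) linR] by simp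
  then have "det (matrix ?T) * det (matrix R) = det (matrix R) * det (matrix ?D)"
    by (simp flip: det_mul)
  moreover have "det (matrix R) \<noteq> 0"
    using orthogonal_transformation_det[OF R(1)] by auto
  ultimately have TD: "det (matrix ?T) = det (matrix ?D)" by simp
  have entry: "matrix ?D $ i $ j = (if i = j then if i = k then 1 - c else 1 else 0)" for i j
    unfolding matrix_def inner_axis_axis by (simp add: axis_def)
  have "det (matrix ?D) = (\<Prod>i\<in>UNIV. matrix ?D $ i $ i)"
    by (rule det_diagonal) (simp add: entry)
  also have "\<dots> = (\<Prod>i\<in>UNIV. if i = k then 1 - c else 1)"
    by (simp add: entry)
  also have "\<dots> = 1 - c" by simp
  finally show ?thesis using TD by simp
qed

section \<open>A differentiable cutoff profile\<close>

text \<open>A C^1 step built from squared positive parts. For \<open>n\<close> at least 2 its slope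
  \<open>cutoff'\<close> is a trapezoid of height 2, rising on [1/2, 1/2 + 1/n] and falling on
  [1, 1 + 1/n], so the step has height 1. Vanishing below 1/2 produces compact supports; the ramps
  shrink with \<open>n\<close> so that the slope tends to twice an indicator.\<close>

definition cutoff :: "real \<Rightarrow> real \<Rightarrow> real" where
  "cutoff n s = n * ((max 0 (s - 1/2))\<^sup>2 - (max 0 (s - 1/2 - 1/n))\<^sup>2 - (max 0 (s - 1))\<^sup>2 + (max 0 (s - 1 - 1/n))\<^sup>2)"

definition cutoff' :: "real \<Rightarrow> real \<Rightarrow> real" where
  "cutoff' n s = 2 * n * (max 0 (s - 1/2) - max 0 (s - 1/2 - 1/n) - max 0 (s - 1) + max 0 (s - 1 - 1/n))"

lemma DERIV_max_square: "((\<lambda>s::real. (max 0 s)\<^sup>2) has_real_derivative 2 * max 0 s) (at s)"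
proof (cases s "0::real" rule: linorder_cases)
  case greater
  have "((\<lambda>s. s\<^sup>2) has_real_derivative 2 * max 0 s) (at s)"
    using greater by (auto intro!: derivative_eq_intros)
  then show ?thesis
    by (rule has_field_derivative_transform_within_open[where S = "{0<..}"]) (use greater in auto)
next
  case less
  have "((\<lambda>s. 0) has_real_derivative 2 * max 0 s) (at s)" using less by simp
  then show ?thesis
    by (rule has_field_derivative_transform_within_open[where S = "{..<0}"]) (use less in auto)
next
  case equal
  have "((\<lambda>h::real. max 0 h) \<longlongrightarrow> max 0 0) (at 0)" by (intro tendsto_intros)
  moreover have "eventually (\<lambda>h::real. max 0 h = ((max 0 (0 + h))\<^sup>2 - (max 0 0)\<^sup>2) / h) (at 0)"
    by (rule eventually_at_filter[THEN iffD2], rule always_eventually) (auto simp: max_def power2_eq_square)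
  ultimately have "((\<lambda>h::real. ((max 0 (0 + h))\<^sup>2 - (max 0 0)\<^sup>2) / h) \<longlongrightarrow> 0) (at 0)"
    using Lim_transform_eventually by force
  then show ?thesis unfolding DERIV_def equal by simp
qed

lemma DERIV_cutoff: "(cutoff n has_real_derivative cutoff' n s) (at s)"
proof -
  have *: "((\<lambda>s. (max 0 (s - c))\<^sup>2) has_real_derivative 2 * max 0 (s - c)) (at s)" for c
    using DERIV_shift[of "\<lambda>s. (max 0 s)\<^sup>2" "2 * max 0 (s - c)" s "- c"] DERIV_max_square[of "s - c"] by simp
  show ?thesis
    unfolding cutoff_def[abs_def] cutoff'_def diff_diff_eq
    by (rule DERIV_cong, (rule derivative_intros *)+) (simp add: algebra_simps)
qed

lemma continuous_cutoff': "continuous_on A (cutoff' n)"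
  unfolding cutoff'_def[abs_def] by (intro continuous_intros)

lemma continuous_cutoff: "continuous_on A (cutoff n)"
  unfolding cutoff_def[abs_def] by (intro continuous_intros)

lemma cutoff_low:
  assumes "n > 0" "s \<le> 1/2"
  shows "cutoff n s = 0" "cutoff' n s = 0"
proof -
  define d where "d = 1/n"
  have "d > 0" using assms by (simp add: d_def)
  then have m: "max 0 (s - 1/2) = 0" "max 0 (s - 1/2 - d) = 0" "max 0 (s - 1) = 0" "max 0 (s - 1 - d) = 0"
    using assms by (auto intro!: max_absorb1)
  show "cutoff n s = 0" "cutoff' n s = 0"
    unfolding cutoff_def cutoff'_def d_def[symmetric] m by simp_all
qed

lemma cutoff_high:
  assumes "n > 0" "s \<ge> 1 + 1/n"
  shows "cutoff n s = 1" "cutoff' n s = 0"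
proof -
  define d where "d = 1/n"
  have d: "d > 0" "s \<ge> 1 + d" "n * d = 1" using assms by (auto simp: d_def)
  then have m: "max 0 (s - 1/2) = s - 1/2" "max 0 (s - 1/2 - d) = s - 1/2 - d" "max 0 (s - 1) = s - 1"
    "max 0 (s - 1 - d) = s - 1 - d" by (auto intro!: max_absorb2)
  have "(s - 1/2)\<^sup>2 - (s - 1/2 - d)\<^sup>2 - (s - 1)\<^sup>2 + (s - 1 - d)\<^sup>2 = d"
    by (simp add: power2_eq_square algebra_simps)
  then show "cutoff n s = 1" "cutoff' n s = 0"
    unfolding cutoff_def cutoff'_def d_def[symmetric] m using d(3) by simp_all
qed

lemma cutoff'_bounds:
  assumes "n > 0"
  shows "0 \<le> cutoff' n s" "cutoff' n s \<le> 2"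
proof -
  define d where "d = 1/n"
  have d: "d > 0" "n * d = 1" using assms by (auto simp: d_def)
  \<comment> \<open>The unit-slope ramp clipped at height \<open>d\<close>; the slope of the profile
    is \<open>2 * n\<close> times the difference of two shifted copies, which monotonicity makes
    nonnegative.\<close>
  let ?r = "\<lambda>u. max 0 u - max 0 (u - d)"
  have r0: "0 \<le> ?r u" and r1: "?r u \<le> d" and rmono: "u \<le> v \<Longrightarrow> ?r u \<le> ?r v" for u v
    using d(1) by (auto simp: max_def)
  have eq: "cutoff' n s = 2 * (n * (?r (s - 1/2) - ?r (s - 1)))"
    unfolding cutoff'_def d_def[symmetric] by (simp add: algebra_simps)
  have "0 \<le> ?r (s - 1/2) - ?r (s - 1)" "?r (s - 1/2) - ?r (s - 1) \<le> d"
    using r0[of "s - 1"] r1[of "s - 1/2"] rmono[of "s - 1" "s - 1/2"] by linarith+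
  from mult_left_mono[OF this(1), of n] mult_left_mono[OF this(2), of n] assms d(2)
  show "0 \<le> cutoff' n s" "cutoff' n s \<le> 2" unfolding eq by auto
qed

lemma cutoff_bounds:
  assumes "n \<ge> 1"
  shows "0 \<le> cutoff n s" "cutoff n s \<le> 1"
proof -
  have n: "n > 0" "1 / n \<le> 1" using assms by auto
  have mono: "cutoff n s \<le> cutoff n t" if "s \<le> t" for s t
    by (rule DERIV_nonneg_imp_nondecreasing[OF that]) (use DERIV_cutoff cutoff'_bounds(1)[OF n(1)] in blast)
  have "cutoff n (min s 0) = 0" by (rule cutoff_low(1)[OF n(1)]) simp
  moreover have "cutoff n (max s 2) = 1" by (rule cutoff_high(1)[OF n(1)]) (use n(2) in \<open>simp add: le_max_iff_disj\<close>)
  ultimately show "0 \<le> cutoff n s" "cutoff n s \<le> 1"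
    using mono[of "min s 0" s] mono[of s "max s 2"] by auto
qed

text \<open>A fixed \<open>s\<close> is eventually outside both open ramps. The half-open interval
  records the values at the ends: 0 at 1/2 and 2 at 1.\<close>

lemma cutoff'_eventually:
  "eventually (\<lambda>k. cutoff' (real (Suc k)) s = (if 1/2 < s \<and> s \<le> 1 then 2 else 0)) sequentially"
proof -
  have small: "eventually (\<lambda>k. 1 / real (Suc k) < d) sequentially" if "d > 0" for d
    using order_tendstoD(2)[OF lim_1_over_n[THEN LIMSEQ_Suc], of d] that by simp
  consider "s \<le> 1/2" | "1/2 < s" "s \<le> 1" | "s > 1" by linarith
  then show ?thesis
  proof cases
    case 1
    then show ?thesis by (auto simp: cutoff_low(2))
  next
    case 2
    have "eventually (\<lambda>k. 1 / real (Suc k) < s - 1/2) sequentially" using small 2 by simp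
    then show ?thesis
    proof eventually_elim
      case (elim k)
      define n d where "n = real (Suc k)" and "d = 1 / n"
      have p: "d > 0" "n * d = 1" "d < s - 1/2" using elim by (auto simp: n_def d_def)
      have m: "max 0 (s - 1/2) = s - 1/2" "max 0 (s - 1/2 - d) = s - 1/2 - d" "max 0 (s - 1) = 0" "max 0 (s - 1 - d) = 0"
        using p 2 by (auto intro!: max_absorb1 max_absorb2)
      have "cutoff' n s = 2 * (n * d)" unfolding cutoff'_def d_def[symmetric] m by simp
      then show ?case unfolding n_def[symmetric] using 2 p by simp
    qed
  next
    case 3
    have "eventually (\<lambda>k. 1 / real (Suc k) < s - 1) sequentially" using small 3 by simp
    then show ?thesis
    proof eventually_elim
      case (elim k)
      then show ?case using 3 cutoff_high(2)[of "real (Suc k)" s] by simp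
    qed
  qed
qed

section \<open>Geometry of a curved element\<close>

lemma continuous_on_det:
  fixes A :: "'a::topological_space \<Rightarrow> real^'n^'n"
  assumes "\<And>i j. continuous_on S (\<lambda>y. A y $ i $ j)"
  shows "continuous_on S (\<lambda>y. det (A y))"
  unfolding det_def by (intro continuous_intros assms)

lemma matrix_inv_works:
  fixes A :: "real^'n^'n"
  assumes "det A \<noteq> 0"
  shows "A ** matrix_inv A = mat 1" "matrix_inv A ** A = mat 1"
proof -
  have "\<exists>B. A ** B = mat 1 \<and> B ** A = mat 1"
    using assms by (simp add: invertible_def flip: invertible_det_nz)
  then have "A ** matrix_inv A = mat 1 \<and> matrix_inv A ** A = mat 1"
    unfolding matrix_inv_def by (rule someI_ex)
  then show "A ** matrix_inv A = mat 1" "matrix_inv A ** A = mat 1" by auto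
qed

text \<open>Moves the inverse transpose in \<open>surface_element\<close> from the normal to the
  direction, so that it meets the derivative of the inverse element map.\<close>

lemma matrix_inv_transpose:
  fixes A :: "real^'n^'n"
  assumes "det A \<noteq> 0"
  shows "(matrix_inv (transpose A) *v a) \<bullet> v = a \<bullet> (matrix_inv A *v v)"
proof -
  let ?m = "matrix_inv (transpose A) *v a"
  have "v = A *v (matrix_inv A *v v)"
    using matrix_inv_works(1)[OF assms] by (simp add: matrix_vector_mul_assoc)
  then have "?m \<bullet> v = ?m \<bullet> (A *v (matrix_inv A *v v))" by simp
  also have "\<dots> = (transpose A *v ?m) \<bullet> (matrix_inv A *v v)"
    by (simp flip: dot_lmul_matrix)
  also have "transpose A *v ?m = a"
    using matrix_inv_works(1)[of "transpose A"] assms by (simp add: matrix_vector_mul_assoc det_transpose)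
  finally show ?thesis .
qed

text \<open>Cramer's rule writes the components as quotients of determinants.\<close>

lemma continuous_on_matrix_inv_vector:
  fixes A :: "'a::topological_space \<Rightarrow> real^'n^'n"
  assumes "\<And>i j. continuous_on S (\<lambda>y. A y $ i $ j)" "\<And>y. y \<in> S \<Longrightarrow> det (A y) \<noteq> 0"
  shows "continuous_on S (\<lambda>y. matrix_inv (A y) *v v)"
proof -
  have *: "continuous_on S (\<lambda>y. \<chi> k. det (\<chi> i j. if j = k then v $ i else A y $ i $ j) / det (A y))"
  proof (intro continuous_on_vec_lambda continuous_on_divide continuous_on_det)
    show "continuous_on S (\<lambda>y. (\<chi> i j. if j = k then v $ i else A y $ i $ j) $ i $ j)" for i j k
      using assms(1) by (cases "j = k") auto
  qed (use assms in auto)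
  show ?thesis
  proof (rule continuous_on_eq[OF *])
    fix y assume "y \<in> S"
    then have d: "det (A y) \<noteq> 0" by (rule assms(2))
    have "A y *v (matrix_inv (A y) *v v) = v"
      using matrix_inv_works(1)[OF d] by (simp add: matrix_vector_mul_assoc)
    from iffD1[OF cramer[OF d] this] show "(\<chi> k. det (\<chi> i j. if j = k then v $ i else A y $ i $ j) / det (A y)) = matrix_inv (A y) *v v"
      by (rule sym)
  qed
qed

text \<open>The defining function is 0 at \<open>p\<close> and has a negative derivative along
  \<open>z\<close>. Uniqueness of normals and the opposite normals of neighbours both follow by
  choosing \<open>z\<close> suitably.\<close>

lemma outward_normal_inside:
  fixes p z :: "'a::euclidean_space"
  assumes "is_outward_normal S p \<nu>" "\<nu> \<bullet> z < 0"
  shows "eventually (\<lambda>t. p + t *\<^sub>R z \<in> interior S) (at_right 0)"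
proof -
  obtain V \<rho> c where \<rho>: "open V" "p \<in> V" "\<rho> p = 0" "c > 0"
    "(\<rho> has_derivative (\<lambda>y. c * (\<nu> \<bullet> y))) (at p)" "interior S \<inter> V = {x\<in>V. \<rho> x < 0}"
    using assms(1) unfolding is_outward_normal_def by blast
  have line: "((\<lambda>t::real. p + t *\<^sub>R z) has_derivative (\<lambda>t. t *\<^sub>R z)) (at 0)"
    by (auto intro!: derivative_eq_intros)
  have "((\<lambda>t. \<rho> (p + t *\<^sub>R z)) has_derivative (\<lambda>t. c * (\<nu> \<bullet> (t *\<^sub>R z)))) (at 0)"
    using has_derivative_compose[OF line, of \<rho> "\<lambda>y. c * (\<nu> \<bullet> y)"] \<rho>(5) by simp
  moreover have "(\<lambda>t. c * (\<nu> \<bullet> (t *\<^sub>R z))) = (*) (c * (\<nu> \<bullet> z))" by (auto simp: fun_eq_iff)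
  ultimately have 1: "((\<lambda>t. \<rho> (p + t *\<^sub>R z)) has_real_derivative (c * (\<nu> \<bullet> z))) (at 0)"
    by (simp only: has_field_derivative_def)
  have "c * (\<nu> \<bullet> z) < 0" using assms(2) \<rho>(4) by (simp add: mult_pos_neg)
  from DERIV_neg_dec_right[OF 1 this] obtain d1 where "d1 > 0"
    "\<And>h. h > 0 \<Longrightarrow> h < d1 \<Longrightarrow> \<rho> (p + h *\<^sub>R z) < 0" using \<rho>(3) by auto
  then have "eventually (\<lambda>t. \<rho> (p + t *\<^sub>R z) < 0) (at_right 0)"
    unfolding eventually_at_right_field by auto
  moreover have "((\<lambda>t::real. p + t *\<^sub>R z) \<longlongrightarrow> p + 0 *\<^sub>R z) (at_right 0)" by (intro tendsto_intros)
  then have "eventually (\<lambda>t. p + t *\<^sub>R z \<in> V) (at_right 0)"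
    using topological_tendstoD[OF _ \<rho>(1)] \<rho>(2) by fastforce
  ultimately show ?thesis by eventually_elim (use \<rho>(6) in blast)
qed

text \<open>Fixes one of the neighbourhoods \<open>U\<close> granted by \<open>is_element\<close>,
  so that the inverse map \<open>G\<close> is available, and differentiable, beyond the element
  itself.\<close>

locale curved_element = solid_polytope "ref E" for E :: "(real^'n::{finite,wellorder}) element" +
  fixes U :: "(real^'n::_) set"
  assumes U: "open U" "ref E \<subseteq> U" and emap_C1: "C_k_on 1 U (emap E)" and inj: "inj_on (emap E) U"
    and det_nz: "\<And>y. y \<in> U \<Longrightarrow> det (jacobian (emap E) (at y)) \<noteq> 0"
begin

abbreviation "P \<equiv> ref E"
abbreviation "F \<equiv> emap E"
abbreviation "K \<equiv> body E"

definition J :: "real^'n::_ \<Rightarrow> ((real, 'n) vec, 'n) vec" where "J y = jacobian F (at y)"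

definition G :: "real^'n::_ \<Rightarrow> real^'n::_" where "G = inv_into U F"

lemma G_F [simp]: "y \<in> U \<Longrightarrow> G (F y) = y"
  unfolding G_def by (rule inv_into_f_f[OF inj])

lemma F_derivative:
  assumes "y \<in> U"
  shows "(F has_derivative (\<lambda>v. J y *v v)) (at y)"
proof -
  have "F differentiable (at y)" using emap_C1 assms by (auto simp: differentiable_def)
  then show ?thesis unfolding J_def by (simp add: jacobian_works)
qed

lemma continuous_J: "continuous_on U (\<lambda>y. J y $ i $ j)"
proof -
  obtain F' where F': "\<And>x. x \<in> U \<Longrightarrow> (F has_derivative F' x) (at x)" "\<And>v. continuous_on U (\<lambda>x. F' x v)"
    using emap_C1 by auto
  have "continuous_on U (\<lambda>x. F' x (axis j 1) $ i)" by (intro continuous_intros F'(2))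
  moreover have "F' x (axis j 1) $ i = J x $ i $ j" if "x \<in> U" for x
  proof -
    have "F' x = (\<lambda>v. J x *v v)" by (rule has_derivative_unique[OF F'(1)[OF that] F_derivative[OF that]])
    then have "F' x (axis j 1) = J x *v axis j 1" by simp
    then show ?thesis by (simp add: matrix_vector_mult_basis column_def)
  qed
  ultimately show ?thesis by (rule continuous_on_eq)
qed

lemma det_J: "y \<in> U \<Longrightarrow> det (J y) \<noteq> 0"
  unfolding J_def by (rule det_nz)

lemma continuous_det_J: "continuous_on U (\<lambda>y. det (J y))"
  by (intro continuous_on_det continuous_J)

lemma continuous_inv_J: "continuous_on U (\<lambda>y. matrix_inv (J y) *v v)"
  by (intro continuous_on_matrix_inv_vector continuous_J det_J)

lemma continuous_F: "continuous_on U F"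
  using F_derivative has_derivative_continuous continuous_at_imp_continuous_on by blast

lemma open_F: "open V \<Longrightarrow> V \<subseteq> U \<Longrightarrow> open (F ` V)"
  by (rule invariance_of_domain) (auto intro: continuous_on_subset[OF continuous_F] inj_on_subset[OF inj])

lemma continuous_G: "continuous_on (F ` U) G"
  by (rule continuous_on_inverse_open[OF U(1) continuous_F]) auto

lemma G_derivative:
  assumes "y \<in> U"
  shows "(G has_derivative (\<lambda>v. matrix_inv (J y) *v v)) (at (F y))"
proof (rule has_derivative_inverse_strong[OF U(1) assms continuous_F G_F F_derivative[OF assms]])
  show "(\<lambda>v. J y *v v) \<circ> (\<lambda>v. matrix_inv (J y) *v v) = id"
    using matrix_inv_works(1)[OF det_J[OF assms]] by (simp add: fun_eq_iff matrix_vector_mul_assoc)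
qed

lemma P_subset: "interior P \<subseteq> U" "P \<subseteq> U"
  using U(2) interior_subset by blast+

lemma compact_K: "compact K"
  unfolding body_def
  by (intro compact_continuous_image continuous_on_subset[OF continuous_F] compact_polytope U(2))

text \<open>\<open>F\<close> maps open subsets of \<open>U\<close> to open sets by invariance of
  domain. Conversely the preimage in \<open>U\<close> of the interior is open, and injectivity
  places it inside \<open>P\<close>.\<close>

lemma interior_K: "interior K = F ` interior P"
proof
  have "open (F ` interior P)" by (rule open_F[OF open_interior P_subset(1)])
  then show "F ` interior P \<subseteq> interior K"
    unfolding body_def by (intro interior_maximal image_mono interior_subset)
  have "open (U \<inter> F -` interior K)"
    using continuous_F U(1) open_interior by (simp add: continuous_on_open_vimage vimage_def Int_commute)
  moreover have "U \<inter> F -` interior K \<subseteq> P"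
  proof
    fix y assume y: "y \<in> U \<inter> F -` interior K"
    then obtain p where "p \<in> P" "F p = F y" using interior_subset[of K] unfolding body_def by force
    then show "y \<in> P" using y P_subset(2) inj by (metis IntD1 inj_onD subsetD)
  qed
  ultimately have *: "U \<inter> F -` interior K \<subseteq> interior P" by (rule interior_maximal[rotated])
  show "interior K \<subseteq> F ` interior P"
  proof
    fix x assume x: "x \<in> interior K"
    then obtain p where "p \<in> P" "x = F p" using interior_subset[of K] unfolding body_def by blast
    then show "x \<in> F ` interior P" using * x P_subset(2) by blast
  qed
qed

lemma negligible_boundary_K: "negligible (K - interior K)"
proof -
  have "negligible (F ` (P - interior P))"
  proof (rule negligible_differentiable_image_negligible[OF order_refl negligible_boundary])
    show "F differentiable_on (P - interior P)"
      using F_derivative P_subset(2) by (meson DiffD1 differentiableI differentiable_at_withinI differentiable_on_def subsetD)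
  qed
  moreover have "K - interior K \<subseteq> F ` (P - interior P)" using interior_K by (simp add: body_def image_diff_subset)
  ultimately show ?thesis by (rule negligible_subset)
qed

lemma closure_interior_K: "closure (interior K) = K"
proof
  show "closure (interior K) \<subseteq> K"
    by (rule closure_minimal[OF interior_subset]) (rule compact_imp_closed[OF compact_K])
  have "F ` closure (interior P) \<subseteq> closure (F ` interior P)"
    by (rule image_closure_subset)
      (auto simp: closure_interior intro: continuous_on_subset[OF continuous_F P_subset(2)] subsetD[OF closure_subset])
  then show "K \<subseteq> closure (interior K)"
    unfolding interior_K closure_interior by (subst body_def)
qed

text \<open>The surface element times the normal component of \<omega>, pulled back to the reference
  facet (Nanson's formula). The norm of the transformed normal has cancelled, which leaves an
  expression that is continuous on all of \<open>U\<close>.\<close>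

definition conormal :: "(real^'n::_) set \<Rightarrow> real^'n::_ \<Rightarrow> real^'n::_ \<Rightarrow> real" where
  "conormal f \<omega> y = \<bar>det (J y)\<bar> * (nrm f \<bullet> (matrix_inv (J y) *v \<omega>))"

lemma continuous_conormal: "continuous_on U (conormal f \<omega>)"
  unfolding conormal_def[abs_def] by (intro continuous_intros continuous_det_J continuous_inv_J)

text \<open>The normalised gradient at \<open>F y\<close> of the function
  \<open>nrm f \<bullet> G x\<close> of \<open>x\<close>, whose level set carries the face.\<close>

definition unit_normal :: "(real^'n::_) set \<Rightarrow> real^'n::_ \<Rightarrow> real^'n::_" where
  "unit_normal f y = sgn (matrix_inv (transpose (J y)) *v nrm f)"

lemma conormal_eq:
  assumes "y \<in> U" "f facet_of P"
  shows "surface_element F (nrm f) y * (\<omega> \<bullet> unit_normal f y) = conormal f \<omega> y"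
    and "norm (unit_normal f y) = 1"
    and "nrm f \<bullet> (matrix_inv (J y) *v v) = norm (matrix_inv (transpose (J y)) *v nrm f) * (unit_normal f y \<bullet> v)"
    and "norm (matrix_inv (transpose (J y)) *v nrm f) > 0"
proof -
  let ?m = "matrix_inv (transpose (J y)) *v nrm f"
  have "transpose (J y) *v ?m = nrm f"
    using matrix_inv_works(1)[of "transpose (J y)"] det_J[OF assms(1)]
    by (simp add: matrix_vector_mul_assoc det_transpose)
  then have m0: "?m \<noteq> 0" using facet_props(1)[OF assms(2)] by (metis matrix_vector_mult_0_right norm_zero zero_neq_one)
  show n1: "norm (unit_normal f y) = 1" unfolding unit_normal_def using m0 by (simp add: norm_sgn)
  show "norm ?m > 0" using m0 by simp
  have mm: "?m = norm ?m *\<^sub>R unit_normal f y" unfolding unit_normal_def using m0 by (simp add: sgn_div_norm)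
  show 3: "nrm f \<bullet> (matrix_inv (J y) *v v) = norm ?m * (unit_normal f y \<bullet> v)" for v
    using matrix_inv_transpose[OF det_J[OF assms(1)], of "nrm f" v] mm by (metis inner_scaleR_left)
  show "surface_element F (nrm f) y * (\<omega> \<bullet> unit_normal f y) = conormal f \<omega> y"
    unfolding surface_element_def conormal_def 3 by (simp add: J_def inner_commute)
qed

text \<open>If the two vectors differed, their difference \<open>z\<close> would point strictly
  inward with respect to \<nu> and strictly outward across the facet; short steps along
  \<open>z\<close> would then be in the interior of \<open>K\<close> and beyond the face at
  once.\<close>

lemma normal_unique:
  assumes f: "f facet_of P" and y: "y \<in> rel_interior f" and \<nu>: "is_outward_normal K (F y) \<nu>"
  shows "\<nu> = unit_normal f y"
proof (rule ccontr)
  assume neq: "\<nu> \<noteq> unit_normal f y"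
  let ?n = "unit_normal f y"
  have yP: "y \<in> P" and yf: "nrm f \<bullet> y = off f"
    using y rel_interior_subset facet_props(3)[OF f] by blast+
  then have yU: "y \<in> U" using P_subset by blast
  have n1: "norm ?n = 1" by (rule conormal_eq(2)[OF yU f])
  have \<nu>1: "norm \<nu> = 1" using \<nu> by (simp add: is_outward_normal_def)
  have "\<nu> \<bullet> ?n < 1"
  proof -
    have "(\<nu> - ?n) \<bullet> (\<nu> - ?n) > 0" using neq by simp
    then show ?thesis using \<nu>1 n1 by (simp add: inner_diff_left inner_diff_right inner_commute norm_eq_1)
  qed
  define z where "z = ?n - \<nu>"
  have z: "\<nu> \<bullet> z < 0" "?n \<bullet> z > 0"
    using \<open>\<nu> \<bullet> ?n < 1\<close> \<nu>1 n1 by (simp_all add: z_def inner_diff_right inner_commute norm_eq_1)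
  have line: "((\<lambda>t::real. F y + t *\<^sub>R z) has_derivative (\<lambda>t. t *\<^sub>R z)) (at 0)"
    by (auto intro!: derivative_eq_intros)
  have "((\<lambda>t. nrm f \<bullet> G (F y + t *\<^sub>R z)) has_derivative (\<lambda>t. nrm f \<bullet> (matrix_inv (J y) *v (t *\<^sub>R z)))) (at 0)"
    using has_derivative_compose[OF line, of G "\<lambda>v. matrix_inv (J y) *v v"] G_derivative[OF yU]
    by (intro has_derivative_inner_right) simp
  then have 2: "((\<lambda>t. nrm f \<bullet> G (F y + t *\<^sub>R z)) has_real_derivative (nrm f \<bullet> (matrix_inv (J y) *v z))) (at 0)"
  proof -
    have "(\<lambda>t. nrm f \<bullet> (matrix_inv (J y) *v (t *\<^sub>R z))) = (*) (nrm f \<bullet> (matrix_inv (J y) *v z))"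
      by (auto simp: fun_eq_iff matrix_vector_mult_scaleR)
    then show "((\<lambda>t. nrm f \<bullet> G (F y + t *\<^sub>R z)) has_derivative (\<lambda>t. nrm f \<bullet> (matrix_inv (J y) *v (t *\<^sub>R z)))) (at 0) \<Longrightarrow> ?thesis"
      by (simp only: has_field_derivative_def)
  qed
  have "nrm f \<bullet> (matrix_inv (J y) *v z) > 0"
    using conormal_eq(3,4)[OF yU f] z(2) by simp
  from DERIV_pos_inc_right[OF 2 this] obtain d2 where "d2 > 0"
    "\<And>h. h > 0 \<Longrightarrow> h < d2 \<Longrightarrow> off f < nrm f \<bullet> G (F y + h *\<^sub>R z)" using yf yU by auto
  then have "eventually (\<lambda>t. off f < nrm f \<bullet> G (F y + t *\<^sub>R z)) (at_right 0)"
    unfolding eventually_at_right_field by auto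
  then have "eventually (\<lambda>t::real. False) (at_right 0)"
    using outward_normal_inside[OF \<nu> z(1)]
  proof eventually_elim
    case (elim t)
    then obtain q where q: "q \<in> interior P" "F y + t *\<^sub>R z = F q" unfolding interior_K by blast
    then have "G (F y + t *\<^sub>R z) = q" using P_subset by auto
    then have "nrm f \<bullet> G (F y + t *\<^sub>R z) < off f" using q(1) f by (simp add: interior_eq)
    then show ?case using elim(1) by simp
  qed
  then show False by simp
qed

lemma outward_normal_eq:
  assumes "f facet_of P" "y \<in> rel_interior f" "is_outward_normal K (F y) \<nu>"
  shows "outward_normal K (F y) = unit_normal f y"
  unfolding outward_normal_def
  by (rule the_equality) (use normal_unique[OF assms(1,2)] assms(3) in blast)+

lemma faces_eq: "faces E = (\<lambda>f. F ` f) ` {f. f facet_of P}"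
  unfolding faces_def by blast

lemma ref_facet_image:
  assumes "f facet_of P"
  shows "ref_facet E (F ` f) = f"
proof -
  have "f \<subseteq> P" using assms by (rule facet_of_imp_subset)
  then show ?thesis unfolding ref_facet_def using inj P_subset(2)
    by (auto dest: inj_onD)
qed

lemma inj_faces: "inj_on (\<lambda>f. F ` f) {f. f facet_of P}"
  by (rule inj_on_inverseI[of _ "ref_facet E"]) (simp add: ref_facet_image)

lemma finite_faces: "finite (faces E)"
  unfolding faces_eq using finite_facets by simp

lemma open_face_image: "f facet_of P \<Longrightarrow> open_face E (F ` f) = F ` rel_interior f"
  unfolding open_face_def by (simp add: ref_facet_image)

end

lemma is_element_curved:
  assumes "is_element E"
  obtains U where "curved_element E U"
  using assms that unfolding is_element_def curved_element_def curved_element_axioms_def solid_polytope_def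
  by blast

section \<open>The flux through the boundary of an element\<close>

text \<open>Continuity and differentiability are local, and the open sets \<open>V\<close> and the
  complement of \<open>C\<close> cover the space; on the latter the extension is 0.\<close>

lemma dir_test_extend:
  fixes V :: "'a::euclidean_space set"
  assumes V: "open V" "compact C" "C \<subseteq> V" and p: "continuous_on V p" "continuous_on V dp"
    and d: "\<And>x. x \<in> V \<Longrightarrow> ((\<lambda>s. p (x + s *\<^sub>R \<omega>)) has_real_derivative dp x) (at 0)"
    and z: "\<And>x. x \<in> V - C \<Longrightarrow> p x = 0" "\<And>x. x \<in> V - C \<Longrightarrow> dp x = 0"
  shows "dir_test V \<omega> (\<lambda>x. if x \<in> V then p x else 0) (\<lambda>x. if x \<in> V then dp x else 0)"
proof -
  have cover: "V \<union> - C = UNIV" "open (- C)" using V by (auto simp: compact_imp_closed)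
  have cont: "continuous_on UNIV (\<lambda>x. if x \<in> V then q x else 0)"
    if "continuous_on V q" "\<And>x. x \<in> V - C \<Longrightarrow> q x = 0" for q :: "'a \<Rightarrow> real"
  proof -
    have "continuous_on V (\<lambda>x. if x \<in> V then q x else 0)"
      by (rule continuous_on_eq[OF that(1)]) simp
    moreover have "continuous_on (- C) (\<lambda>x. if x \<in> V then q x else 0)"
      by (rule continuous_on_eq[OF continuous_on_const[of _ 0]]) (use that(2) in auto)
    ultimately have "continuous_on (V \<union> - C) (\<lambda>x. if x \<in> V then q x else 0)"
      using V cover by (intro continuous_on_open_Un) auto
    then show ?thesis unfolding cover .
  qed
  have der: "((\<lambda>s. if x + s *\<^sub>R \<omega> \<in> V then p (x + s *\<^sub>R \<omega>) else 0) has_real_derivative (if x \<in> V then dp x else 0)) (at 0)" for x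
  proof -
    have ev: "eventually (\<lambda>s. x + s *\<^sub>R \<omega> \<in> W) (nhds 0)" if "open W" "x \<in> W" for W
    proof -
      have "((\<lambda>s. x + s *\<^sub>R \<omega>) \<longlongrightarrow> x + 0 *\<^sub>R \<omega>) (nhds 0)"
        by (intro tendsto_intros) (simp add: filterlim_ident)
      then show ?thesis using topological_tendstoD[OF _ that(1)] that(2) by fastforce
    qed
    show ?thesis
    proof (cases "x \<in> V")
      case True
      have "((\<lambda>s. if x + s *\<^sub>R \<omega> \<in> V then p (x + s *\<^sub>R \<omega>) else 0) has_real_derivative dp x) (at 0)
          \<longleftrightarrow> ((\<lambda>s. p (x + s *\<^sub>R \<omega>)) has_real_derivative dp x) (at 0)"
        by (rule DERIV_cong_ev) (use ev[OF V(1) True] in \<open>auto elim: eventually_mono\<close>)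
      then show ?thesis using d[OF True] True by simp
    next
      case False
      then have xC: "x \<in> - C" using V(3) by auto
      have "((\<lambda>s. if x + s *\<^sub>R \<omega> \<in> V then p (x + s *\<^sub>R \<omega>) else 0) has_real_derivative 0) (at 0)
          \<longleftrightarrow> ((\<lambda>s. 0) has_real_derivative 0) (at 0)"
        by (rule DERIV_cong_ev) (use ev[OF cover(2) xC] z(1) in \<open>auto elim!: eventually_mono\<close>)
      then show ?thesis using False by simp
    qed
  qed
  show ?thesis
    unfolding dir_test_def dir_C1_def
    by (intro conjI exI[of _ C] allI cont p z der V) (use z in auto)
qed

section \<open>Prisms of height 1 over facets\<close>

context solid_polytope
begin

definition prj :: "(real^'n) set \<Rightarrow> real^'n \<Rightarrow> real^'n" where
  "prj f x = x - (nrm f \<bullet> x - off f) *\<^sub>R nrm f"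

text \<open>The prism of \<open>face_measure\<close>, erected on the outer side of \<open>P\<close>,
  but over the relative interior of the facet only, because face integrals run over
  \<open>open_face\<close>.\<close>

definition prism :: "(real^'n) set \<Rightarrow> (real^'n) set" where
  "prism f = {x. 0 \<le> nrm f \<bullet> x - off f \<and> nrm f \<bullet> x - off f \<le> 1 \<and> prj f x \<in> rel_interior f}"

lemma nrm_prj: "f facet_of P \<Longrightarrow> nrm f \<bullet> prj f x = off f"
  using facet_props(1)[of f] by (simp add: prj_def inner_diff_right norm_eq_1)

lemma continuous_prj: "continuous_on A (prj f)"
  unfolding prj_def[abs_def] by (intro continuous_intros)

lemma prism_eq:
  assumes "f facet_of P"
  shows "prism f = {x. 0 \<le> nrm f \<bullet> x - off f} \<inter> {x. nrm f \<bullet> x - off f \<le> 1} \<inter>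
    (\<Inter>f'\<in>{f. f facet_of P} - {f}. {x. nrm f' \<bullet> prj f x < off f'})"
  unfolding prism_def rel_interior_facet[OF assms] using nrm_prj[OF assms] by auto

lemma borel_prism:
  assumes "f facet_of P"
  shows "prism f \<in> sets borel"
proof -
  have "closed {x. 0 \<le> nrm f \<bullet> x - off f}" "closed {x. nrm f \<bullet> x - off f \<le> 1}"
    by (intro closed_Collect_le continuous_intros)+
  moreover have "open (\<Inter>f'\<in>{f. f facet_of P} - {f}. {x. nrm f' \<bullet> prj f x < off f'})"
    by (intro open_INT finite_Diff finite_facets ballI open_Collect_less continuous_intros continuous_prj)
  ultimately show ?thesis unfolding prism_eq[OF assms] by (intro sets.Int) auto
qed

lemma prj_prism: "f facet_of P \<Longrightarrow> x \<in> prism f \<Longrightarrow> prj f x \<in> P"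
  unfolding prism_def using rel_interior_subset facet_of_imp_subset by blast

lemma bounded_prism:
  assumes f: "f facet_of P"
  shows "bounded (prism f)"
proof -
  obtain B where B: "\<And>y. y \<in> P \<Longrightarrow> norm y \<le> B" using compact_imp_bounded[OF compact_polytope] by (auto simp: bounded_iff)
  have "norm x \<le> B + 1" if "x \<in> prism f" for x
  proof -
    have "x = prj f x + (nrm f \<bullet> x - off f) *\<^sub>R nrm f" by (simp add: prj_def)
    then have "norm x \<le> norm (prj f x) + norm ((nrm f \<bullet> x - off f) *\<^sub>R nrm f)" by (metis norm_triangle_ineq)
    also have "\<dots> \<le> B + 1"
      using B[OF prj_prism[OF f that]] that facet_props(1)[OF f] by (auto simp: prism_def)
    finally show ?thesis .
  qed
  then show ?thesis by (auto simp: bounded_iff)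
qed

lemma prism_integrable:
  fixes Q :: "real^'n \<Rightarrow> real"
  assumes f: "f facet_of P" and Q: "continuous_on (rel_interior f) Q" "\<And>y. y \<in> rel_interior f \<Longrightarrow> \<bar>Q y\<bar> \<le> M"
  shows "(\<lambda>x. indicator (prism f) x * Q (prj f x)) \<in> borel_measurable borel"
    and "integrable lebesgue (\<lambda>x. indicator (prism f) x * Q (prj f x))"
proof -
  have "continuous_on (prism f) (\<lambda>x. Q (prj f x))"
    by (rule continuous_on_compose2[OF Q(1) continuous_prj]) (auto simp: prism_def)
  from borel_measurable_continuous_on_indicator[OF borel_prism[OF f] this]
  show m: "(\<lambda>x. indicator (prism f) x * Q (prj f x)) \<in> borel_measurable borel" by simp
  have fin: "emeasure lborel (prism f) < \<infinity>" using bounded_prism[OF f] by (rule emeasure_bounded_finite)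
  have "integrable lborel (\<lambda>x. indicator (prism f) x * Q (prj f x))"
  proof (rule Bochner_Integration.integrable_bound[where f = "\<lambda>x. M * indicator (prism f) x"])
    show "integrable lborel (\<lambda>x. M * indicator (prism f) x :: real)"
      using fin borel_prism[OF f] by (intro integrable_mult_right) (simp add: integrable_indicator_iff)
    show "AE x in lborel. norm (indicator (prism f) x * Q (prj f x)) \<le> norm (M * indicator (prism f) x)"
      by (rule AE_I2) (auto simp: indicator_def prism_def intro: order_trans[OF Q(2) abs_ge_self])
  qed (use m in simp)
  then show "integrable lebesgue (\<lambda>x. indicator (prism f) x * Q (prj f x))"
    using m by (simp add: integrable_completion)
qed

end

section \<open>Layer cutoffs and the flux formula\<close>

context curved_element
begin

abbreviation "facets \<equiv> {f. f facet_of P}"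

text \<open>The argument of the profile is the signed distance to the facet hyperplane, positive
  inside, measured in units of \<open>1/n\<close>.\<close>

definition cut :: "real \<Rightarrow> real^'n::_ \<Rightarrow> (real^'n::_) set \<Rightarrow> real" where
  "cut n y f = cutoff n (n * (off f - nrm f \<bullet> y))"

definition psi :: "real \<Rightarrow> real^'n::_ \<Rightarrow> real" where
  "psi n y = (\<Prod>f\<in>facets. cut n y f)"

text \<open>The derivative along \<omega> of \<open>psi n\<close> composed with \<open>G\<close>, in
  reference coordinates: the chain rule replaces \<omega> by its image under the inverse
  Jacobian.\<close>

definition dpsi :: "real \<Rightarrow> real^'n::_ \<Rightarrow> real^'n::_ \<Rightarrow> real" where
  "dpsi n \<omega> y = (\<Sum>f\<in>facets. cutoff' n (n * (off f - nrm f \<bullet> y)) * (- n * (nrm f \<bullet> (matrix_inv (J y) *v \<omega>)))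
     * (\<Prod>f'\<in>facets - {f}. cut n y f'))"

lemma continuous_cut: "continuous_on A (\<lambda>y. cut n y f)"
  unfolding cut_def by (rule continuous_on_compose2[OF continuous_cutoff[of UNIV]]) (auto intro!: continuous_intros)

lemma continuous_psi: "continuous_on A (psi n)"
  unfolding psi_def[abs_def] by (intro continuous_intros continuous_cut)

lemma continuous_cutoff'_facet: "continuous_on A (\<lambda>y. cutoff' n (n * (off f - nrm f \<bullet> y)))"
  by (rule continuous_on_compose2[OF continuous_cutoff'[of UNIV]]) (auto intro!: continuous_intros)

lemma continuous_dpsi: "continuous_on U (dpsi n \<omega>)"
  unfolding dpsi_def[abs_def] by (intro continuous_intros continuous_cut continuous_cutoff'_facet continuous_inv_J)

lemma psi_derivative:
  assumes y: "y \<in> U"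
  shows "((\<lambda>s. psi n (G (F y + s *\<^sub>R \<omega>))) has_real_derivative dpsi n \<omega> y) (at 0)"
proof -
  have line: "((\<lambda>t::real. F y + t *\<^sub>R \<omega>) has_derivative (\<lambda>t. t *\<^sub>R \<omega>)) (at 0)"
    by (auto intro!: derivative_eq_intros)
  have Gl: "((\<lambda>t. G (F y + t *\<^sub>R \<omega>)) has_derivative (\<lambda>t. matrix_inv (J y) *v (t *\<^sub>R \<omega>))) (at 0)"
    using has_derivative_compose[OF line, of G "\<lambda>v. matrix_inv (J y) *v v"] G_derivative[OF y] by simp
  have fac: "((\<lambda>t. cut n (G (F y + t *\<^sub>R \<omega>)) f) has_derivative
      (\<lambda>t. cutoff' n (n * (off f - nrm f \<bullet> y)) * (- n * (nrm f \<bullet> (matrix_inv (J y) *v \<omega>))) * t)) (at 0)" for f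
  proof -
    have "((\<lambda>t. nrm f \<bullet> G (F y + t *\<^sub>R \<omega>)) has_derivative (\<lambda>t. nrm f \<bullet> (matrix_inv (J y) *v (t *\<^sub>R \<omega>)))) (at 0)"
      by (rule has_derivative_inner_right[OF Gl])
    moreover have "(\<lambda>t. nrm f \<bullet> (matrix_inv (J y) *v (t *\<^sub>R \<omega>))) = (*) (nrm f \<bullet> (matrix_inv (J y) *v \<omega>))"
      by (auto simp: fun_eq_iff matrix_vector_mult_scaleR)
    ultimately have "((\<lambda>t. nrm f \<bullet> G (F y + t *\<^sub>R \<omega>)) has_real_derivative (nrm f \<bullet> (matrix_inv (J y) *v \<omega>))) (at 0)"
      by (simp only: has_field_derivative_def)
    then have "((\<lambda>t. n * (off f - nrm f \<bullet> G (F y + t *\<^sub>R \<omega>))) has_real_derivative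
        (- n * (nrm f \<bullet> (matrix_inv (J y) *v \<omega>)))) (at 0)"
      by (auto intro!: derivative_eq_intros)
    from DERIV_chain2[OF DERIV_cutoff this] y
    have "((\<lambda>t. cut n (G (F y + t *\<^sub>R \<omega>)) f) has_real_derivative
        (cutoff' n (n * (off f - nrm f \<bullet> y)) * (- n * (nrm f \<bullet> (matrix_inv (J y) *v \<omega>))))) (at 0)"
      by (simp add: cut_def)
    then show ?thesis by (simp only: has_field_derivative_def)
  qed
  have "((\<lambda>s. psi n (G (F y + s *\<^sub>R \<omega>))) has_derivative
      (\<lambda>t. \<Sum>f\<in>facets. cutoff' n (n * (off f - nrm f \<bullet> y)) * (- n * (nrm f \<bullet> (matrix_inv (J y) *v \<omega>))) * t
        * (\<Prod>f'\<in>facets - {f}. cut n (G (F y + 0 *\<^sub>R \<omega>)) f'))) (at 0)"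
    unfolding psi_def by (rule has_derivative_prod) (rule fac)
  moreover have "(\<lambda>t. \<Sum>f\<in>facets. cutoff' n (n * (off f - nrm f \<bullet> y)) * (- n * (nrm f \<bullet> (matrix_inv (J y) *v \<omega>))) * t
        * (\<Prod>f'\<in>facets - {f}. cut n (G (F y + 0 *\<^sub>R \<omega>)) f')) = (*) (dpsi n \<omega> y)"
    using y by (auto simp: fun_eq_iff dpsi_def sum_distrib_left sum_distrib_right mult_ac intro!: sum.cong)
  ultimately show ?thesis by (simp only: has_field_derivative_def)
qed

lemma cut_low: "n > 0 \<Longrightarrow> n * (off f - nrm f \<bullet> y) \<le> 1/2 \<Longrightarrow> cut n y f = 0"
  unfolding cut_def by (rule cutoff_low(1))

lemma dir_test_psi:
  assumes n: "n \<ge> 1"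
  shows "dir_test (interior K) \<omega> (\<lambda>x. if x \<in> interior K then psi n (G x) else 0)
    (\<lambda>x. if x \<in> interior K then dpsi n \<omega> (G x) else 0)"
proof -
  \<comment> \<open>The profile vanishes up to 1/2, so points at scaled distance at least 1/2 from
    all facets carry the support; they form a compact subset of the interior.\<close>
  define C where "C = {y \<in> P. \<forall>f\<in>facets. 1/2 \<le> n * (off f - nrm f \<bullet> y)}"
  have "C = P \<inter> (\<Inter>f\<in>facets. {y. 1/2 \<le> n * (off f - nrm f \<bullet> y)})" by (auto simp: C_def)
  moreover have "closed (\<Inter>f\<in>facets. {y. 1/2 \<le> n * (off f - nrm f \<bullet> y)})"
    by (intro closed_INT ballI closed_Collect_le continuous_intros)
  ultimately have Cc: "compact C" using compact_polytope by (simp add: compact_Int_closed)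
  have CP: "C \<subseteq> interior P"
  proof
    fix y assume "y \<in> C"
    then have *: "1/2 \<le> n * (off f - nrm f \<bullet> y)" if "f facet_of P" for f using that by (simp add: C_def)
    have "nrm f \<bullet> y < off f" if "f facet_of P" for f
    proof (rule ccontr)
      assume "\<not> nrm f \<bullet> y < off f"
      then have "n * (off f - nrm f \<bullet> y) \<le> 0" using n by (intro mult_nonneg_nonpos) auto
      then show False using *[OF that] by simp
    qed
    then show "y \<in> interior P" by (simp add: interior_eq)
  qed
  have sub: "interior K \<subseteq> F ` U" unfolding interior_K using P_subset(1) by blast
  show ?thesis
  proof (rule dir_test_extend[where C = "F ` C"])
    show "open (interior K)" by simp
    show "compact (F ` C)"
      using CP P_subset(1) by (intro compact_continuous_image Cc continuous_on_subset[OF continuous_F]) auto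
    show "F ` C \<subseteq> interior K" unfolding interior_K using CP by blast
    show "continuous_on (interior K) (\<lambda>x. psi n (G x))"
      by (rule continuous_on_compose2[OF continuous_psi[of UNIV] continuous_on_subset[OF continuous_G sub]]) simp
    show "continuous_on (interior K) (\<lambda>x. dpsi n \<omega> (G x))"
      by (rule continuous_on_compose2[OF continuous_dpsi continuous_on_subset[OF continuous_G sub]])
        (use sub in auto)
    show "((\<lambda>s. psi n (G (x + s *\<^sub>R \<omega>))) has_real_derivative dpsi n \<omega> (G x)) (at 0)" if x: "x \<in> interior K" for x
    proof -
      obtain y where y: "y \<in> U" "x = F y" using x sub by blast
      then show ?thesis using psi_derivative[OF y(1)] by simp
    qed
    have low: "\<exists>y f. f facet_of P \<and> G x = y \<and> n * (off f - nrm f \<bullet> y) \<le> 1/2" if x: "x \<in> interior K - F ` C" for x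
    proof -
      obtain y where y: "y \<in> interior P" "x = F y" using x unfolding interior_K by blast
      then have "y \<notin> C" using x by blast
      then obtain f where "f facet_of P" "\<not> 1/2 \<le> n * (off f - nrm f \<bullet> y)"
        using y(1) interior_subset by (auto simp: C_def)
      then show ?thesis using y P_subset(1) by (intro exI[of _ y] exI[of _ f]) auto
    qed
    show "psi n (G x) = 0" if x: "x \<in> interior K - F ` C" for x
    proof -
      obtain f where f: "f facet_of P" "n * (off f - nrm f \<bullet> G x) \<le> 1/2" using low[OF x] by blast
      then have "cut n (G x) f = 0" using n by (intro cut_low) auto
      then show ?thesis unfolding psi_def using f(1) finite_facets by (intro prod_zero) auto
    qed
    show "dpsi n \<omega> (G x) = 0" if x: "x \<in> interior K - F ` C" for x
    proof -
      obtain f where f: "f facet_of P" "n * (off f - nrm f \<bullet> G x) \<le> 1/2" using low[OF x] by blast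
      have z: "cut n (G x) f = 0" "cutoff' n (n * (off f - nrm f \<bullet> G x)) = 0"
        using n f by (auto intro!: cut_low cutoff_low(2))
      \<comment> \<open>Each summand differentiates one factor. Either this is the vanishing factor,
        whose slope is 0 as well, or the vanishing factor remains in the product.\<close>
      show ?thesis unfolding dpsi_def
      proof (intro sum.neutral ballI)
        fix f1 assume "f1 \<in> facets"
        show "cutoff' n (n * (off f1 - nrm f1 \<bullet> G x)) * (- n * (nrm f1 \<bullet> (matrix_inv (J (G x)) *v \<omega>)))
            * (\<Prod>f'\<in>facets - {f1}. cut n (G x) f') = 0"
        proof (cases "f1 = f")
          case False
          then have "(\<Prod>f'\<in>facets - {f1}. cut n (G x) f') = 0"
            using z(1) f(1) finite_facets by (intro prod_zero) auto
          then show ?thesis by simp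
        qed (simp add: z)
      qed
    qed
  qed
qed

lemma change_of_variables_K:
  "(LINT x:interior K|lebesgue. H x) = (LINT y:interior P|lebesgue. \<bar>det (J y)\<bar> * H (F y))"
proof -
  have "(F has_derivative (\<lambda>v. J y *v v)) (at y within interior P)" if "y \<in> interior P" for y
    using F_derivative P_subset(1) that has_derivative_at_withinI by blast
  from lebesgue_change_of_variables[OF _ this inj_on_subset[OF inj P_subset(1)], of H]
  show ?thesis unfolding interior_K by simp
qed

lemma cut_bounds: "n \<ge> 1 \<Longrightarrow> 0 \<le> cut n y f" "n \<ge> 1 \<Longrightarrow> cut n y f \<le> 1"
  unfolding cut_def by (auto intro: cutoff_bounds)

lemma prod_cut_bounds:
  assumes "n \<ge> 1"
  shows "0 \<le> (\<Prod>f\<in>A. cut n y f)" "(\<Prod>f\<in>A. cut n y f) \<le> 1"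
  using cut_bounds[OF assms] by (auto intro: prod_nonneg prod_le_1)

lemma scaled_gap_at_top:
  assumes "(\<lambda>k. y k) \<longlonglongrightarrow> y0" "nrm f \<bullet> y0 < off f"
  shows "eventually (\<lambda>k. real (Suc k) * (off f - nrm f \<bullet> y k) \<ge> 2) sequentially"
proof -
  have "(\<lambda>k. off f - nrm f \<bullet> y k) \<longlonglongrightarrow> off f - nrm f \<bullet> y0" by (intro tendsto_intros assms)
  moreover have "filterlim (\<lambda>k. real (Suc k)) at_top sequentially"
    by (rule filterlim_compose[OF filterlim_real_sequentially filterlim_Suc])
  ultimately have "filterlim (\<lambda>k. (off f - nrm f \<bullet> y k) * real (Suc k)) at_top sequentially"
    using assms(2) by (intro filterlim_tendsto_pos_mult_at_top) auto
  then show ?thesis by (simp add: filterlim_at_top mult.commute)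
qed

lemma cut_eventually_1:
  assumes "(\<lambda>k. y k) \<longlonglongrightarrow> y0" "nrm f \<bullet> y0 < off f"
  shows "eventually (\<lambda>k. cut (real (Suc k)) (y k) f = 1) sequentially"
  using scaled_gap_at_top[OF assms]
proof eventually_elim
  case (elim k)
  have "1 / real (Suc k) \<le> 1" "real (Suc k) > 0" by simp_all
  with elim show ?case unfolding cut_def by (intro cutoff_high(1)) linarith+
qed

lemma cut_eventually_0:
  assumes "(\<lambda>k. y k) \<longlonglongrightarrow> y0" "nrm f \<bullet> y0 > off f"
  shows "eventually (\<lambda>k. cut (real (Suc k)) (y k) f = 0) sequentially"
proof -
  have "(\<lambda>k. nrm f \<bullet> y k) \<longlonglongrightarrow> nrm f \<bullet> y0" by (intro tendsto_intros assms)
  from order_tendstoD(1)[OF this assms(2)] show ?thesis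
  proof eventually_elim
    case (elim k)
    then have "real (Suc k) * (off f - nrm f \<bullet> y k) \<le> 0" by (intro mult_nonneg_nonpos) auto
    then show ?case by (intro cut_low) auto
  qed
qed

lemma interior_P_integrable:
  fixes q :: "real^'n::_ \<Rightarrow> real"
  assumes "continuous_on P q"
  shows "set_integrable lebesgue (interior P) q"
proof -
  have "set_integrable lborel P q"
    unfolding set_integrable_def by (rule borel_integrable_compact[OF compact_polytope assms])
  then have "set_integrable lebesgue P q"
    unfolding set_integrable_def by (subst integrable_completion) (auto simp: integrable_iff_bounded)
  then show ?thesis by (rule set_integrable_subset) (auto simp: interior_subset)
qed

text \<open>The layer of thickness \<open>1/n\<close> along a facet is blown up to the prism over the facet
  by the affine map \<open>T\<close>; the determinant cancels the factor \<open>n\<close> of the cutoff derivative.\<close>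

lemma facet_layer_limit:
  assumes f: "f facet_of P" and Q: "continuous_on P Q"
  shows "(\<lambda>k. LINT y:interior P|lebesgue. real (Suc k) * cutoff' (real (Suc k)) (real (Suc k) * (off f - nrm f \<bullet> y))
      * (\<Prod>f'\<in>facets - {f}. cut (real (Suc k)) y f') * Q y)
    \<longlonglongrightarrow> (LINT x|lebesgue. indicator (prism f) x * Q (prj f x))"
proof -
  let ?a = "nrm f" and ?b = "off f"
  have aa: "?a \<bullet> ?a = 1" using facet_props(1)[OF f] by (simp add: norm_eq_1)
  \<comment> \<open>Signed height above the facet hyperplane, between 0 and 1 on the prism.\<close>
  define s where "s = (\<lambda>x. ?a \<bullet> x - ?b)"
  \<comment> \<open>\<open>T k\<close> projects to the hyperplane and then moves inward by
    \<open>(1 + s) / (2 * n)\<close>, with \<open>n = k + 1\<close>. The scaled distance to the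
    facet becomes \<open>(1 + s) / 2\<close>, so the limiting plateau (1/2, 1] of the slope
    corresponds to heights in (0, 1].\<close>
  define T where "T = (\<lambda>k x. x - (s x + (1 + s x) / (2 * real (Suc k))) *\<^sub>R ?a)"
  define S where "S = (\<lambda>k. T k -` interior P)"
  \<comment> \<open>The factor 1/2 is the Jacobian \<open>1 / (2 * n)\<close> times the factor
    \<open>n\<close> of the integrand; the plateau height 2 will cancel it.\<close>
  define h where "h = (\<lambda>k x. indicator (S k) x * ((1/2) * cutoff' (real (Suc k)) ((1 + s x) / 2)
      * (\<Prod>f'\<in>facets - {f}. cut (real (Suc k)) (T k x) f') * Q (T k x)))"
  have aT: "?a \<bullet> T k x = ?b - (1 + s x) / (2 * real (Suc k))" for k x
    using aa by (simp add: T_def inner_diff_right s_def)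
  have cT: "continuous_on A (T k)" for A k unfolding T_def s_def by (intro continuous_intros) simp_all
  have oS: "open (S k)" for k unfolding S_def by (rule open_vimage[OF open_interior cT])
  have TS: "T k ` S k = interior P" for k
  proof -
    have "\<exists>x. T k x = y" for y
    proof -
      define t where "t = 2 * real (Suc k) * (?b - ?a \<bullet> y) - 1"
      have t: "(1 + t) / (2 * real (Suc k)) = ?b - ?a \<bullet> y" by (simp add: t_def del: of_nat_Suc)
      have "s (y + (t + (?b - ?a \<bullet> y)) *\<^sub>R ?a) = t" using aa by (simp add: s_def inner_add_right)
      then have "T k (y + (t + (?b - ?a \<bullet> y)) *\<^sub>R ?a) = y" unfolding T_def using t by simp
      then show ?thesis by blast
    qed
    then show ?thesis unfolding S_def by (metis image_vimage_eq inf_top_right surj_def)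
  qed
  have injT: "inj_on (T k) (S k)" for k
  proof (rule inj_onI)
    fix x x' assume eq: "T k x = T k x'"
    then have "?a \<bullet> T k x = ?a \<bullet> T k x'" by simp
    then have "s x = s x'" unfolding aT by simp
    then show "x = x'" using eq by (simp add: T_def)
  qed
  have derT: "(T k has_derivative (\<lambda>v. v - ((1 + 1 / (2 * real (Suc k))) * (?a \<bullet> v)) *\<^sub>R ?a)) (at x within S k)" for k x
    unfolding T_def s_def
    by (rule derivative_eq_intros refl | simp add: fun_eq_iff algebra_simps add_divide_distrib del: of_nat_Suc)+
  \<comment> \<open>Along the normal, \<open>T k\<close> scales by
    \<open>1 - (1 + 1 / (2 * n)) = - 1 / (2 * n)\<close>, of which only the absolute value
    enters.\<close>
  have cov: "(LINT y:interior P|lebesgue. q y) = (LINT x:S k|lebesgue. 1 / (2 * real (Suc k)) * q (T k x))" for q k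
    using lebesgue_change_of_variables[OF _ derT injT, of k q] oS[of k]
      det_shrink_along[OF facet_props(1)[OF f], of "1 + 1 / (2 * real (Suc k))"]
    unfolding TS by (simp add: borel_open)
  have eqh: "(LINT y:interior P|lebesgue. real (Suc k) * cutoff' (real (Suc k)) (real (Suc k) * (?b - ?a \<bullet> y))
      * (\<Prod>f'\<in>facets - {f}. cut (real (Suc k)) y f') * Q y) = (LINT x|lebesgue. h k x)" for k
  proof -
    have e: "real (Suc k) * (?b - ?a \<bullet> T k x) = (1 + s x) / 2" for x
      unfolding aT by (simp add: field_simps del: of_nat_Suc)
    have c: "1 / (2 * real (Suc k)) * (real (Suc k) * p) = (1/2) * p" for p by (simp add: field_simps del: of_nat_Suc)
    show ?thesis
      unfolding cov[of _ k] unfolding set_lebesgue_integral_def h_def e mult.assoc c by (simp del: of_nat_Suc)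
  qed
  obtain B where B: "\<And>y. y \<in> P \<Longrightarrow> norm y \<le> B"
    using compact_imp_bounded[OF compact_polytope] unfolding bounded_iff by blast
  obtain M where M: "\<And>y. y \<in> P \<Longrightarrow> \<bar>Q y\<bar> \<le> M"
    using compact_imp_bounded[OF compact_continuous_image[OF Q compact_polytope]] by (auto simp: bounded_iff)
  have P0: "P \<noteq> {}" using solid interior_subset by blast
  then obtain p where "p \<in> P" by blast
  then have M0: "M \<ge> 0" using M[of p] abs_ge_zero[of "Q p"] by linarith
  \<comment> \<open>A nonzero slope forces \<open>0 < s x < 3\<close>, and then the inward
    displacement is at most 2. As \<open>T k x\<close> lies in \<open>P\<close>, which has norm
    bound \<open>B\<close>, the radius \<open>B + 5\<close> suffices.\<close>
  have hb: "\<bar>h k x\<bar> \<le> M * indicator (cball 0 (B + 5)) x" for k x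
  proof (cases "h k x = 0")
    case True
    then show ?thesis using M0 by (simp add: indicator_def)
  next
    case False
    let ?n = "real (Suc k)"
    have n1: "1 / ?n \<le> 1" "?n > 0" by auto
    have xS: "x \<in> S k" and c0: "cutoff' ?n ((1 + s x) / 2) \<noteq> 0"
      using False by (auto simp: h_def indicator_def split: if_splits)
    then have TP: "T k x \<in> P" using interior_subset by (auto simp: S_def)
    have s0: "(1 + s x) / 2 > 1/2" using c0 cutoff_low(2)[of ?n] n1(2) by (meson not_le)
    have s1: "(1 + s x) / 2 < 1 + 1 / ?n" using c0 cutoff_high(2)[of ?n] n1(2) by (meson not_le)
    have "(1 + s x) / 2 < 2" using s1 n1(1) by linarith
    then have s3: "0 < s x" "s x < 3" using s0 by simp_all
    have "(1 + s x) / (2 * ?n) = ((1 + s x) / 2) * (1 / ?n)" by simp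
    also have "\<dots> \<le> 2 * 1" using s3 n1 by (intro mult_mono) auto
    finally have s4: "(1 + s x) / (2 * ?n) \<le> 2" by simp
    have s5: "0 \<le> (1 + s x) / (2 * ?n)" using s3 by simp
    have "x = T k x + (s x + (1 + s x) / (2 * ?n)) *\<^sub>R ?a" by (simp add: T_def)
    then have "norm x \<le> norm (T k x) + norm ((s x + (1 + s x) / (2 * ?n)) *\<^sub>R ?a)" by (metis norm_triangle_ineq)
    also have "\<dots> \<le> B + 5" using B[OF TP] s3 s4 s5 facet_props(1)[OF f] by simp
    finally have xb: "x \<in> cball 0 (B + 5)" by simp
    let ?c = "(1/2) * cutoff' ?n ((1 + s x) / 2)" and ?p = "\<Prod>f'\<in>facets - {f}. cut ?n (T k x) f'"
    have cb: "0 \<le> ?c" "?c \<le> 1" using cutoff'_bounds[OF n1(2)] by (simp_all add: field_simps)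
    have pb: "0 \<le> ?p" "?p \<le> 1" by (rule prod_cut_bounds; simp)+
    have "\<bar>h k x\<bar> = (?c * ?p) * \<bar>Q (T k x)\<bar>" using xS cb pb by (simp add: h_def abs_mult)
    also have "\<dots> \<le> (1 * 1) * M" using cb pb M[OF TP] by (intro mult_mono) auto
    finally show ?thesis using xb by simp
  qed
  \<comment> \<open>Two null sets are left out: at height 0 the limiting slope is 0 although the
    prism contains its base, and where the projection meets another facet hyperplane, a factor
    \<open>cut\<close> may tend to a value strictly between 0 and 1.\<close>
  have lim: "(\<lambda>k. h k x) \<longlonglongrightarrow> indicator (prism f) x * Q (prj f x)"
    if s0: "s x \<noteq> 0" and gen: "\<And>f'. f' facet_of P \<Longrightarrow> f' \<noteq> f \<Longrightarrow> nrm f' \<bullet> prj f x \<noteq> off f'" for x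
  proof -
    have Tlim: "(\<lambda>k. T k x) \<longlonglongrightarrow> prj f x"
    proof -
      have "(\<lambda>k. (1 + s x) / 2 * (1 / real (Suc k))) \<longlonglongrightarrow> (1 + s x) / 2 * 0"
        by (intro tendsto_intros lim_1_over_n[THEN LIMSEQ_Suc])
      then have "(\<lambda>k. (1 + s x) / (2 * real (Suc k))) \<longlonglongrightarrow> 0" by simp
      then have "(\<lambda>k. T k x) \<longlonglongrightarrow> x - (s x + 0) *\<^sub>R ?a" unfolding T_def by (intro tendsto_intros)
      then show ?thesis by (simp add: prj_def s_def)
    qed
    have ev: "eventually (\<lambda>k. cutoff' (real (Suc k)) ((1 + s x) / 2) = (if 1/2 < (1 + s x) / 2 \<and> (1 + s x) / 2 \<le> 1 then 2 else 0)) sequentially"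
      by (rule cutoff'_eventually)
    show ?thesis
    proof (cases "0 < s x \<and> s x \<le> 1")
      case False
      have "eventually (\<lambda>k. h k x = 0) sequentially"
        using ev by eventually_elim (use False in \<open>auto simp: h_def\<close>)
      moreover have "x \<notin> prism f" using False s0 by (auto simp: prism_def s_def)
      ultimately show ?thesis by (simp add: tendsto_eventually)
    next
      case True
      show ?thesis
      proof (cases "\<forall>f'. f' facet_of P \<longrightarrow> f' \<noteq> f \<longrightarrow> nrm f' \<bullet> prj f x < off f'")
        case False
        then obtain f' where f': "f' facet_of P" "f' \<noteq> f" "nrm f' \<bullet> prj f x > off f'"
          using gen by (meson linorder_neqE_linordered_idom)
        have "eventually (\<lambda>k. h k x = 0) sequentially"
          using cut_eventually_0[OF Tlim f'(3)]
        proof eventually_elim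
          case (elim k)
          then have "(\<Prod>f'\<in>facets - {f}. cut (real (Suc k)) (T k x) f') = 0"
            using f' finite_facets by (intro prod_zero) auto
          then show ?case by (simp add: h_def)
        qed
        moreover have "x \<notin> prism f" using False by (auto simp: prism_def rel_interior_facet[OF f])
        ultimately show ?thesis by (simp add: tendsto_eventually)
      next
        case inside: True
        then have xp: "x \<in> prism f" using True nrm_prj[OF f] by (auto simp: prism_def rel_interior_facet[OF f] s_def)
        have "eventually (\<lambda>k. \<forall>f'\<in>facets - {f}. real (Suc k) * (off f' - nrm f' \<bullet> T k x) \<ge> 2) sequentially"
          using inside by (intro eventually_ball_finite ballI finite_Diff finite_facets scaled_gap_at_top[OF Tlim]) auto
        moreover have "eventually (\<lambda>k. \<forall>f'\<in>facets - {f}. cut (real (Suc k)) (T k x) f' = 1) sequentially"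
          using inside by (intro eventually_ball_finite ballI finite_Diff finite_facets cut_eventually_1[OF Tlim]) auto
        ultimately have evT: "eventually (\<lambda>k. T k x \<in> interior P \<and> h k x = Q (T k x)) sequentially"
          using ev
        proof eventually_elim
          case (elim k)
          have "nrm f' \<bullet> T k x < off f'" if f': "f' facet_of P" for f'
          proof (cases "f' = f")
            case True
            have "(1 + s x) / (2 * real (Suc k)) > 0" using \<open>0 < s x \<and> s x \<le> 1\<close> by simp
            then show ?thesis unfolding True aT by simp
          next
            case False
            then have "real (Suc k) * (off f' - nrm f' \<bullet> T k x) > 0" using elim(1) f' by force
            then show ?thesis by (simp add: zero_less_mult_iff)
          qed
          then have Tin: "T k x \<in> interior P" by (simp add: interior_eq)
          then have "x \<in> S k" by (simp add: S_def)
          moreover have "(\<Prod>f'\<in>facets - {f}. cut (real (Suc k)) (T k x) f') = 1" using elim(2) by (intro prod.neutral) auto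
          moreover have "cutoff' (real (Suc k)) ((1 + s x) / 2) = 2" using elim(3) True by simp
          ultimately show ?case using Tin by (simp add: h_def)
        qed
        have "(\<lambda>k. Q (T k x)) \<longlonglongrightarrow> Q (prj f x)"
          by (rule continuous_on_tendsto_compose[OF Q Tlim prj_prism[OF f xp]])
            (use evT in \<open>auto elim!: eventually_mono simp: subsetD[OF interior_subset]\<close>)
        moreover have "eventually (\<lambda>k. Q (T k x) = h k x) sequentially"
          using evT by eventually_elim simp
        ultimately have "(\<lambda>k. h k x) \<longlonglongrightarrow> Q (prj f x)" by (rule Lim_transform_eventually)
        then show ?thesis using xp by simp
      qed
    qed
  qed
  have Qr: "continuous_on (rel_interior f) Q" "\<And>y. y \<in> rel_interior f \<Longrightarrow> \<bar>Q y\<bar> \<le> M"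
    using M f rel_interior_subset facet_of_imp_subset by (blast intro: continuous_on_subset[OF Q])+
  have "(\<lambda>k. LINT x|lebesgue. h k x) \<longlonglongrightarrow> (LINT x|lebesgue. indicator (prism f) x * Q (prj f x))"
  proof (rule integral_dominated_convergence[where w = "\<lambda>x. M * indicator (cball 0 (B + 5)) x"])
    show "(\<lambda>x. indicator (prism f) x * Q (prj f x)) \<in> borel_measurable lebesgue"
      using prism_integrable(2)[OF f Qr] by (simp add: borel_measurable_integrable)
    show "h k \<in> borel_measurable lebesgue" for k
    proof -
      have "continuous_on (S k) (\<lambda>x. (1/2) * cutoff' (real (Suc k)) ((1 + s x) / 2)
          * (\<Prod>f'\<in>facets - {f}. cut (real (Suc k)) (T k x) f') * Q (T k x))"
        by (intro continuous_intros continuous_on_compose2[OF continuous_cutoff'[of UNIV]]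
            continuous_on_compose2[OF continuous_cut[of UNIV] cT] continuous_on_compose2[OF Q cT])
          (use interior_subset in \<open>auto simp: s_def S_def intro!: continuous_intros\<close>)
      from borel_measurable_continuous_on_indicator[OF _ this] oS[of k]
      have "h k \<in> borel_measurable borel" by (simp add: h_def[abs_def] borel_open)
      then show ?thesis by (simp add: measurable_completion)
    qed
    show "integrable lebesgue (\<lambda>x. M * indicator (cball (0 :: real^'n::_) (B + 5)) x :: real)"
      using emeasure_bounded_finite[OF bounded_cball[of "0 :: real^'n::_" "B + 5"]]
      by (intro integrable_mult_right) (simp add: integrable_completion integrable_indicator_iff)
    show "AE x in lebesgue. norm (h k x) \<le> M * indicator (cball 0 (B + 5)) x" for k
      using hb by (intro AE_I2) simp
    have n0: "negligible {x. ?a \<bullet> x = ?b}" using aa by (intro negligible_hyperplane) auto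
    have n1: "negligible (\<Union>f'\<in>facets - {f}. {x. nrm f' \<bullet> prj f x = off f'})"
      unfolding prj_def
      by (rule negligible_Union) (use finite_facets facet_negligible_inter[OF f] in auto)
    have "negligible ({x. ?a \<bullet> x = ?b} \<union> (\<Union>f'\<in>facets - {f}. {x. nrm f' \<bullet> prj f x = off f'}))"
      by (rule negligible_Un[OF n0 n1])
    then have "AE x in lebesgue. x \<notin> {x. ?a \<bullet> x = ?b} \<union> (\<Union>f'\<in>facets - {f}. {x. nrm f' \<bullet> prj f x = off f'})"
      by (intro AE_not_in) (simp add: negligible_iff_null_sets)
    then show "AE x in lebesgue. (\<lambda>k. h k x) \<longlonglongrightarrow> indicator (prism f) x * Q (prj f x)"
    proof eventually_elim
      case (elim x)
      show ?case by (rule lim) (use elim in \<open>auto simp: s_def\<close>)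
    qed
  qed
  then show ?thesis unfolding eqh .
qed

text \<open>Testing the weak derivative \<open>D\<close> of \<open>w\<close> with the cutoffs \<open>psi\<close> and letting them tend to 1,
  the derivatives of the cutoffs concentrate on the facets.\<close>

theorem flux_formula:
  assumes w: "continuous_on K w" and D: "set_integrable lebesgue (interior K) D"
    and ibp: "\<And>\<phi> d\<phi>. dir_test (interior K) \<omega> \<phi> d\<phi> \<Longrightarrow>
      (LINT x:interior K|lebesgue. w x * d\<phi> x) = - (LINT x:interior K|lebesgue. D x * \<phi> x)"
  shows "(LINT x:interior K|lebesgue. D x) =
    (\<Sum>f\<in>facets. LINT x|lebesgue. indicator (prism f) x * (w (F (prj f x)) * conormal f \<omega> (prj f x)))"
proof -
  define Q where "Q = (\<lambda>f y. w (F y) * conormal f \<omega> y)"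
  have cwF: "continuous_on P (\<lambda>y. w (F y))"
    by (rule continuous_on_compose2[OF w continuous_on_subset[OF continuous_F P_subset(2)]]) (auto simp: body_def)
  have cQ: "continuous_on P (Q f)" for f
    unfolding Q_def by (intro continuous_intros cwF continuous_on_subset[OF continuous_conormal P_subset(2)])
  define \<phi> where "\<phi> = (\<lambda>k::nat. \<lambda>x. if x \<in> interior K then psi (real (Suc k)) (G x) else 0)"
  have step: "(LINT x:interior K|lebesgue. D x * \<phi> k x) =
      (\<Sum>f\<in>facets. LINT y:interior P|lebesgue. real (Suc k) * cutoff' (real (Suc k)) (real (Suc k) * (off f - nrm f \<bullet> y))
      * (\<Prod>f'\<in>facets - {f}. cut (real (Suc k)) y f') * Q f y)" for k
  proof -
    let ?n = "real (Suc k)"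
    let ?q = "\<lambda>f y. ?n * cutoff' ?n (?n * (off f - nrm f \<bullet> y)) * (\<Prod>f'\<in>facets - {f}. cut ?n y f') * Q f y"
    have "(LINT x:interior K|lebesgue. D x * \<phi> k x) =
        - (LINT x:interior K|lebesgue. w x * (if x \<in> interior K then dpsi ?n \<omega> (G x) else 0))"
      using ibp[OF dir_test_psi[of ?n]] unfolding \<phi>_def by simp
    also have "\<dots> = - (LINT y:interior P|lebesgue. \<bar>det (J y)\<bar> * (w (F y) * (if F y \<in> interior K then dpsi ?n \<omega> (G (F y)) else 0)))"
      unfolding change_of_variables_K ..
    \<comment> \<open>The minus sign of the cutoffs, which decrease towards the facets, will cancel
      the one from integration by parts. The Jacobian determinant completes the transformed
      direction to the conormal.\<close>
    also have "(LINT y:interior P|lebesgue. \<bar>det (J y)\<bar> * (w (F y) * (if F y \<in> interior K then dpsi ?n \<omega> (G (F y)) else 0)))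
        = (LINT y:interior P|lebesgue. - (\<Sum>f\<in>facets. ?q f y))"
    proof (rule set_lebesgue_integral_cong)
      show "interior P \<in> sets lebesgue" by simp
      show "\<forall>y. y \<in> interior P \<longrightarrow> \<bar>det (J y)\<bar> * (w (F y) * (if F y \<in> interior K then dpsi ?n \<omega> (G (F y)) else 0))
          = - (\<Sum>f\<in>facets. ?q f y)"
      proof (intro allI impI)
        fix y assume y: "y \<in> interior P"
        then have "F y \<in> interior K" "G (F y) = y" using P_subset(1) by (auto simp: interior_K)
        then have "\<bar>det (J y)\<bar> * (w (F y) * (if F y \<in> interior K then dpsi ?n \<omega> (G (F y)) else 0))
            = (\<Sum>f\<in>facets. \<bar>det (J y)\<bar> * (w (F y) * (cutoff' ?n (?n * (off f - nrm f \<bullet> y)) * (- ?n * (nrm f \<bullet> (matrix_inv (J y) *v \<omega>)))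
     * (\<Prod>f'\<in>facets - {f}. cut ?n y f'))))"
          by (simp add: dpsi_def sum_distrib_left del: of_nat_Suc)
        also have "\<dots> = (\<Sum>f\<in>facets. - ?q f y)"
          by (rule sum.cong[OF refl]) (simp add: Q_def conormal_def mult_ac del: of_nat_Suc)
        finally show "\<bar>det (J y)\<bar> * (w (F y) * (if F y \<in> interior K then dpsi ?n \<omega> (G (F y)) else 0))
          = - (\<Sum>f\<in>facets. ?q f y)" by (simp only: sum_negf)
      qed
    qed
    also have "\<dots> = - (LINT y:interior P|lebesgue. (\<Sum>f\<in>facets. ?q f y))"
      by (simp add: set_lebesgue_integral_def)
    also have "(LINT y:interior P|lebesgue. (\<Sum>f\<in>facets. ?q f y)) = (\<Sum>f\<in>facets. LINT y:interior P|lebesgue. ?q f y)"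
    proof -
      have "set_integrable lebesgue (interior P) (?q f)" for f
        by (intro interior_P_integrable continuous_intros continuous_cut continuous_cutoff'_facet cQ)
      then show ?thesis
        unfolding set_lebesgue_integral_def set_integrable_def scaleR_sum_right
        by (intro Bochner_Integration.integral_sum) auto
    qed
    finally show ?thesis by simp
  qed
  have lim1: "(\<lambda>k. LINT x:interior K|lebesgue. D x * \<phi> k x) \<longlonglongrightarrow> (LINT x:interior K|lebesgue. D x)"
    unfolding set_lebesgue_integral_def
  proof (rule integral_dominated_convergence[where w = "\<lambda>x. norm (indicator (interior K) x *\<^sub>R D x)"])
    have Dm: "(\<lambda>x. indicator (interior K) x *\<^sub>R D x) \<in> borel_measurable lebesgue"
      and Di: "integrable lebesgue (\<lambda>x. indicator (interior K) x *\<^sub>R D x)"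
      using D by (auto simp: set_integrable_def borel_measurable_integrable)
    then show "(\<lambda>x. indicator (interior K) x *\<^sub>R D x) \<in> borel_measurable lebesgue"
      and "integrable lebesgue (\<lambda>x. norm (indicator (interior K) x *\<^sub>R D x))" by auto
    have \<phi>m: "\<phi> k \<in> borel_measurable lebesgue" for k
    proof -
      have "continuous_on UNIV (\<phi> k)" using dir_test_psi[of "real (Suc k)" \<omega>] by (simp add: dir_test_def dir_C1_def \<phi>_def)
      then have "\<phi> k \<in> borel_measurable borel" by (rule borel_measurable_continuous_onI)
      then show ?thesis by (simp add: measurable_completion)
    qed
    show "(\<lambda>x. indicator (interior K) x *\<^sub>R (D x * \<phi> k x)) \<in> borel_measurable lebesgue" for k
      using borel_measurable_times[OF Dm \<phi>m[of k]] by (simp add: mult.assoc)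
    show "AE x in lebesgue. norm (indicator (interior K) x *\<^sub>R (D x * \<phi> k x)) \<le> norm (indicator (interior K) x *\<^sub>R D x)" for k
    proof (rule AE_I2)
      fix x
      have "\<bar>\<phi> k x\<bar> \<le> 1" using prod_cut_bounds[of "real (Suc k)"] by (simp add: \<phi>_def psi_def)
      then have "\<bar>D x\<bar> * \<bar>\<phi> k x\<bar> \<le> \<bar>D x\<bar> * 1" by (intro mult_left_mono) auto
      then show "norm (indicator (interior K) x *\<^sub>R (D x * \<phi> k x)) \<le> norm (indicator (interior K) x *\<^sub>R D x)"
        by (simp add: indicator_def abs_mult)
    qed
    show "AE x in lebesgue. (\<lambda>k. indicator (interior K) x *\<^sub>R (D x * \<phi> k x)) \<longlonglongrightarrow> indicator (interior K) x *\<^sub>R D x"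
    proof (rule AE_I2)
      fix x
      show "(\<lambda>k. indicator (interior K) x *\<^sub>R (D x * \<phi> k x)) \<longlonglongrightarrow> indicator (interior K) x *\<^sub>R D x"
      proof (cases "x \<in> interior K")
        case True
        then obtain y where y: "y \<in> interior P" "x = F y" unfolding interior_K by blast
        have Gx: "G x = y" using y P_subset(1) by auto
        \<comment> \<open>A fixed interior point has a positive distance from each of the finitely
          many facets, so the shrinking layers leave it.\<close>
        have "eventually (\<lambda>k. \<forall>f\<in>facets. cut (real (Suc k)) y f = 1) sequentially"
          using y(1) by (intro eventually_ball_finite ballI finite_facets cut_eventually_1[OF tendsto_const]) (auto simp: interior_eq)
        then have "eventually (\<lambda>k. \<phi> k x = 1) sequentially"
          by eventually_elim (use True Gx in \<open>simp add: \<phi>_def psi_def\<close>)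
        then have "eventually (\<lambda>k. D x * \<phi> k x = D x) sequentially" by eventually_elim simp
        then have "(\<lambda>k. D x * \<phi> k x) \<longlonglongrightarrow> D x" by (rule tendsto_eventually)
        then show ?thesis using True by simp
      qed simp
    qed
  qed
  have lim2: "(\<lambda>k. LINT x:interior K|lebesgue. D x * \<phi> k x) \<longlonglongrightarrow>
      (\<Sum>f\<in>facets. LINT x|lebesgue. indicator (prism f) x * Q f (prj f x))"
    unfolding step by (intro tendsto_sum facet_layer_limit cQ) auto
  show ?thesis using LIMSEQ_unique[OF lim1 lim2] unfolding Q_def .
qed

end

section \<open>Integrals over faces\<close>

text \<open>Restricted to the open face; available for each face that is incoming or outgoing in
  some direction.\<close>

definition has_normals :: "(real^'n) element \<Rightarrow> (real^'n) set \<Rightarrow> bool" where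
  "has_normals E e \<longleftrightarrow> (\<forall>x\<in>open_face E e. \<exists>\<nu>. is_outward_normal (body E) x \<nu>)"

context curved_element
begin

definition surf :: "(real^'n::_) set \<Rightarrow> real^'n::_ \<Rightarrow> real" where
  "surf f y = surface_element F (nrm f) y"

lemma surf_eq: "surf f y = \<bar>det (J y)\<bar> * norm (matrix_inv (transpose (J y)) *v nrm f)"
  by (simp add: surf_def surface_element_def J_def)

lemma surf_nonneg: "surf f y \<ge> 0"
  by (simp add: surf_eq)

lemma continuous_conormal_vector: "continuous_on U (\<lambda>y. matrix_inv (transpose (J y)) *v v)"
proof (rule continuous_on_matrix_inv_vector)
  show "continuous_on U (\<lambda>y. transpose (J y) $ i $ j)" for i j
    using continuous_J[of j i] by (simp add: transpose_def)
  show "det (transpose (J y)) \<noteq> 0" if "y \<in> U" for y using det_J[OF that] by (simp add: det_transpose)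
qed

lemma continuous_surf: "continuous_on U (surf f)"
  unfolding surf_eq[abs_def] by (intro continuous_intros continuous_det_J continuous_conormal_vector)

lemma continuous_unit_normal:
  assumes "f facet_of P"
  shows "continuous_on U (unit_normal f)"
  unfolding unit_normal_def[abs_def] sgn_div_norm
  using conormal_eq(4)[OF _ assms]
  by (intro continuous_intros continuous_conormal_vector) fastforce

lemma facet_subset_U: "f facet_of P \<Longrightarrow> f \<subseteq> U" "f facet_of P \<Longrightarrow> rel_interior f \<subseteq> U"
  using P_subset(2) facet_of_imp_subset rel_interior_subset by blast+

lemma compact_facet: "f facet_of P \<Longrightarrow> compact f"
  using face_of_imp_compact[of P f] facet_of_imp_face_of compact_polytope polytope_imp_convex[OF poly] by blast

text \<open>Describes the relative interior by compact sets only, which makes its image under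
  \<open>F\<close> a difference of compact sets.\<close>

lemma rel_interior_facet_eq:
  assumes "f facet_of P"
  shows "rel_interior f = f - (\<Union>f'\<in>facets - {f}. f')"
proof
  have sub: "f \<subseteq> P" using assms by (rule facet_of_imp_subset)
  show "rel_interior f \<subseteq> f - (\<Union>f'\<in>facets - {f}. f')"
  proof
    fix y assume y: "y \<in> rel_interior f"
    have "y \<notin> f'" if "f' \<in> facets - {f}" for f'
    proof
      assume "y \<in> f'"
      then have "nrm f' \<bullet> y = off f'" using facet_props(3)[of f'] that by blast
      then show False using y that unfolding rel_interior_facet[OF assms] by auto
    qed
    then show "y \<in> f - (\<Union>f'\<in>facets - {f}. f')" using y rel_interior_subset by blast
  qed
  show "f - (\<Union>f'\<in>facets - {f}. f') \<subseteq> rel_interior f"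
  proof
    fix y assume y: "y \<in> f - (\<Union>f'\<in>facets - {f}. f')"
    then have yP: "y \<in> P" using sub by blast
    have "nrm f' \<bullet> y < off f'" if f': "f' facet_of P" "f' \<noteq> f" for f'
    proof -
      have "y \<notin> f'" using y f' by blast
      then have "nrm f' \<bullet> y \<noteq> off f'" using facet_props(3)[OF f'(1)] yP by blast
      then show ?thesis using yP f'(1) by (auto simp: polytope_eq order_less_le)
    qed
    moreover have "nrm f \<bullet> y = off f" using y facet_props(3)[OF assms] by blast
    ultimately show "y \<in> rel_interior f" unfolding rel_interior_facet[OF assms] by blast
  qed
qed

lemma borel_open_face:
  assumes f: "f facet_of P"
  shows "F ` rel_interior f \<in> sets borel"
proof -
  have fs: "f \<subseteq> P" "f \<subseteq> U" using f facet_of_imp_subset facet_subset_U by blast+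
  let ?B = "f \<inter> (\<Union>f'\<in>facets - {f}. f')"
  have "compact ?B"
    using finite_facets by (intro compact_Int compact_facet f compact_UN) (auto intro: compact_facet)
  then have "compact (F ` ?B)" "compact (F ` f)"
    using fs compact_facet[OF f]
    by (auto intro!: compact_continuous_image continuous_on_subset[OF continuous_F])
  then have "F ` f - F ` ?B \<in> sets borel" by (intro sets.Diff) (auto simp: compact_imp_closed)
  moreover have "F ` rel_interior f = F ` f - F ` ?B"
  proof -
    have "rel_interior f = f - ?B" using rel_interior_facet_eq[OF f] by blast
    moreover have "F ` (f - ?B) = F ` f - F ` ?B"
      by (rule inj_on_image_set_diff[OF inj]) (use fs in auto)
    ultimately show ?thesis by simp
  qed
  ultimately show ?thesis by simp
qed

text \<open>By Cauchy-Schwarz, no point of the facet hyperplane is nearer to \<open>x\<close> than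
  the foot \<open>prj f x\<close>. This identifies the projection in
  \<open>face_measure\<close>.\<close>

lemma closest_point_prism:
  assumes f: "f facet_of P" and x: "prj f x \<in> f"
  shows "closest_point f x = prj f x"
proof -
  have cf: "convex f" "closed f"
    using f poly compact_facet[OF f] by (auto intro: face_of_imp_convex facet_of_imp_face_of compact_imp_closed)
  have "dist x (prj f x) \<le> dist x z" if z: "z \<in> f" for z
  proof -
    have "nrm f \<bullet> (x - z) = nrm f \<bullet> x - off f"
      using z facet_props(3)[OF f] by (auto simp: inner_diff_right)
    then have "\<bar>nrm f \<bullet> x - off f\<bar> \<le> norm (nrm f) * norm (x - z)"
      using Cauchy_Schwarz_ineq2[of "nrm f" "x - z"] by simp
    then show ?thesis using facet_props(1)[OF f] by (simp add: prj_def dist_norm)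
  qed
  then show ?thesis using closest_point_unique[OF cf x] by simp
qed

lemma prism_hull_eq:
  assumes f: "f facet_of P"
  shows "{y + t *\<^sub>R nrm f |y t. y \<in> f \<and> 0 \<le> t \<and> t \<le> 1} =
    {x. 0 \<le> nrm f \<bullet> x - off f} \<inter> {x. nrm f \<bullet> x - off f \<le> 1} \<inter> prj f -` f"
    (is "?L = ?R")
proof
  have aa: "nrm f \<bullet> nrm f = 1" using facet_props(1)[OF f] by (simp add: norm_eq_1)
  show "?L \<subseteq> ?R"
  proof
    fix x assume "x \<in> ?L"
    then obtain y t where y: "x = y + t *\<^sub>R nrm f" "y \<in> f" "0 \<le> t" "t \<le> 1" by blast
    have "nrm f \<bullet> y = off f" using y(2) facet_props(3)[OF f] by blast
    then have s: "nrm f \<bullet> x - off f = t" using aa by (simp add: y(1) inner_add_right)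
    then have "prj f x = y" by (simp add: prj_def y(1))
    then show "x \<in> ?R" using s y by simp
  qed
  show "?R \<subseteq> ?L"
  proof
    fix x assume "x \<in> ?R"
    then show "x \<in> ?L"
      by (intro CollectI exI[of _ "prj f x"] exI[of _ "nrm f \<bullet> x - off f"]) (auto simp: prj_def)
  qed
qed

text \<open>The surface measure is a push-forward of a density on a restricted Lebesgue measure;
  undoing the three layers leaves one Lebesgue integral over the prism.\<close>

lemma face_integral:
  fixes p :: "real^'n::_ \<Rightarrow> real"
  assumes f: "f facet_of P" and p: "continuous_on (F ` rel_interior f) p"
  shows "(LINT x:open_face E (F ` f)|face_measure E (F ` f). p x) =
      (LINT x|lebesgue. indicator (prism f) x * (surf f (prj f x) * p (F (prj f x))))" (is ?thesis1)
    and "bounded (p ` F ` rel_interior f) \<Longrightarrow>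
      set_integrable (face_measure E (F ` f)) (open_face E (F ` f)) p" (is "_ \<Longrightarrow> ?thesis2")
proof -
  let ?a = "nrm f" and ?\<pi> = "closest_point f" and ?O = "F ` rel_interior f"
  let ?R = "{y + t *\<^sub>R ?a |y t. y \<in> f \<and> 0 \<le> t \<and> t \<le> 1}"
  let ?\<mu> = "density (lebesgue_on ?R) (\<lambda>x. ennreal (surf f (?\<pi> x)))"
  let ?g = "\<lambda>x. indicator ?O x *\<^sub>R p x"
  have cf: "convex f" "closed f" "f \<noteq> {}"
    using f poly compact_facet[OF f] facet_ne[OF f]
    by (auto intro: face_of_imp_convex facet_of_imp_face_of compact_imp_closed)
  have \<pi>f: "?\<pi> x \<in> f" for x by (rule closest_point_in_set[OF cf(2,3)])
  have c\<pi>: "continuous_on UNIV ?\<pi>" by (rule continuous_on_closest_point[OF cf])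
  have Fpi: "(\<lambda>x. F (?\<pi> x)) \<in> borel_measurable borel"
    by (rule borel_measurable_continuous_onI, rule continuous_on_compose2[OF continuous_F c\<pi>])
      (use \<pi>f facet_subset_U(1)[OF f] in auto)
  have Spi: "(\<lambda>x. surf f (?\<pi> x)) \<in> borel_measurable borel"
    by (rule borel_measurable_continuous_onI, rule continuous_on_compose2[OF continuous_surf c\<pi>])
      (use \<pi>f facet_subset_U(1)[OF f] in auto)
  have leb: "k \<in> measurable (lebesgue_on ?R) borel" if "k \<in> measurable borel borel" for k :: "real^'n::_ \<Rightarrow> 'b::topological_space"
    using that by (intro measurable_restrict_space1 measurable_completion) simp
  have gm: "?g \<in> borel_measurable borel"
    by (rule borel_measurable_continuous_on_indicator[OF borel_open_face[OF f] p])
  have fm: "face_measure E (F ` f) = distr ?\<mu> borel (\<lambda>x. F (?\<pi> x))"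
    unfolding face_measure_def Let_def ref_facet_image[OF f] surf_def ..
  have Rm: "?R \<in> sets lebesgue"
  proof -
    have "closed (prj f -` f)" by (rule closed_vimage[OF cf(2) continuous_prj])
    moreover have "closed {x. 0 \<le> ?a \<bullet> x - off f}" "closed {x. ?a \<bullet> x - off f \<le> 1}"
      by (intro closed_Collect_le continuous_intros)+
    ultimately have "closed ?R" unfolding prism_hull_eq[OF f] by (intro closed_Int)
    then show ?thesis by simp
  qed
  \<comment> \<open>The closed prism \<open>?R\<close> differs from \<open>prism f\<close> only over
    the relative boundary of the facet, where the indicator of the open face is 0.\<close>
  have key: "indicator ?R x *\<^sub>R (surf f (?\<pi> x) *\<^sub>R ?g (F (?\<pi> x))) =
      indicator (prism f) x * (surf f (prj f x) * p (F (prj f x)))" for x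
  proof (cases "x \<in> ?R")
    case True
    then have s: "0 \<le> ?a \<bullet> x - off f" "?a \<bullet> x - off f \<le> 1" "prj f x \<in> f" unfolding prism_hull_eq[OF f] by auto
    have "F (prj f x) \<in> ?O \<longleftrightarrow> prj f x \<in> rel_interior f"
      using s(3) facet_subset_U[OF f] inj by (auto dest: inj_onD)
    then show ?thesis using True s closest_point_prism[OF f s(3)] by (simp add: prism_def indicator_def)
  next
    case False
    then have "x \<notin> prism f" unfolding prism_hull_eq[OF f] prism_def using rel_interior_subset[of f] by auto
    then show ?thesis using False by simp
  qed
  have gF: "(\<lambda>x. ?g (F (?\<pi> x))) \<in> borel_measurable (lebesgue_on ?R)"
    by (rule leb, rule measurable_compose[OF Fpi gm])
  have Fm: "(\<lambda>x. F (?\<pi> x)) \<in> measurable ?\<mu> borel"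
    using leb[OF Fpi] by simp
  have "(LINT x:open_face E (F ` f)|face_measure E (F ` f). p x) = (LINT x|distr ?\<mu> borel (\<lambda>x. F (?\<pi> x)). ?g x)"
    unfolding set_lebesgue_integral_def fm open_face_image[OF f] ..
  also have "\<dots> = (LINT x|?\<mu>. ?g (F (?\<pi> x)))"
    by (rule integral_distr[OF Fm gm])
  also have "\<dots> = (LINT x|lebesgue_on ?R. surf f (?\<pi> x) *\<^sub>R ?g (F (?\<pi> x)))"
    by (rule integral_density[OF gF leb[OF Spi]]) (simp add: surf_nonneg)
  also have "\<dots> = (LINT x|lebesgue. indicator ?R x *\<^sub>R (surf f (?\<pi> x) *\<^sub>R ?g (F (?\<pi> x))))"
    using Rm by (subst integral_restrict_space) auto
  also have "\<dots> = (LINT x|lebesgue. indicator (prism f) x * (surf f (prj f x) * p (F (prj f x))))"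
    unfolding key ..
  finally show ?thesis1 .
  assume bd: "bounded (p ` ?O)"
  then obtain B where B: "\<And>y. y \<in> rel_interior f \<Longrightarrow> \<bar>p (F y)\<bar> \<le> B" by (auto simp: bounded_iff)
  have "bounded (surf f ` f)"
    by (intro compact_imp_bounded compact_continuous_image compact_facet f
        continuous_on_subset[OF continuous_surf] facet_subset_U)
  then obtain C where C: "\<And>y. y \<in> f \<Longrightarrow> \<bar>surf f y\<bar> \<le> C" by (auto simp: bounded_iff)
  have "continuous_on (rel_interior f) (\<lambda>y. surf f y * p (F y))"
    by (intro continuous_intros continuous_on_subset[OF continuous_surf] facet_subset_U f
        continuous_on_compose2[OF p continuous_on_subset[OF continuous_F]]) auto
  moreover have "\<bar>surf f y * p (F y)\<bar> \<le> C * B" if y: "y \<in> rel_interior f" for y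
    unfolding abs_mult using C B[OF y] y rel_interior_subset[of f] abs_ge_zero[of "surf f y"]
    by (intro mult_mono) (auto intro: order_trans[OF abs_ge_zero])
  ultimately have "integrable lebesgue (\<lambda>x. indicator (prism f) x * (surf f (prj f x) * p (F (prj f x))))"
    by (rule prism_integrable(2)[OF f, of "\<lambda>y. surf f y * p (F y)" "C * B"])
  then have "integrable lebesgue (\<lambda>x. indicator ?R x *\<^sub>R (surf f (?\<pi> x) *\<^sub>R ?g (F (?\<pi> x))))"
    unfolding key .
  then have "integrable (lebesgue_on ?R) (\<lambda>x. surf f (?\<pi> x) *\<^sub>R ?g (F (?\<pi> x)))"
    using Rm by (subst integrable_restrict_space) auto
  then have "integrable ?\<mu> (\<lambda>x. ?g (F (?\<pi> x)))"
    by (subst integrable_density[OF gF leb[OF Spi]]) (simp_all add: surf_nonneg)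
  then show ?thesis2
    unfolding set_integrable_def fm open_face_image[OF f]
    by (subst integrable_distr_eq[OF Fm gm])
qed

lemma normal_facet:
  assumes f: "f facet_of P" and n: "has_normals E (F ` f)" and y: "y \<in> rel_interior f"
  shows "outward_normal K (F y) = unit_normal f y" "is_outward_normal K (F y) (unit_normal f y)"
proof -
  have "F y \<in> open_face E (F ` f)" using y by (simp add: open_face_image[OF f])
  then obtain \<nu> where \<nu>: "is_outward_normal K (F y) \<nu>" using n unfolding has_normals_def by blast
  show "outward_normal K (F y) = unit_normal f y" by (rule outward_normal_eq[OF f y \<nu>])
  show "is_outward_normal K (F y) (unit_normal f y)" using normal_unique[OF f y \<nu>] \<nu> by simp
qed

lemma continuous_outward_normal:
  assumes f: "f facet_of P" and n: "has_normals E (F ` f)"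
  shows "continuous_on (F ` rel_interior f) (outward_normal K)"
proof (rule continuous_on_eq)
  show "continuous_on (F ` rel_interior f) (\<lambda>x. unit_normal f (G x))"
    by (rule continuous_on_compose2[OF continuous_unit_normal[OF f] continuous_on_subset[OF continuous_G]])
      (use facet_subset_U(2)[OF f] in auto)
  fix x assume "x \<in> F ` rel_interior f"
  then obtain y where y: "y \<in> rel_interior f" "x = F y" by blast
  then show "unit_normal f (G x) = outward_normal K x"
    using normal_facet(1)[OF f n y(1)] facet_subset_U(2)[OF f] by auto
qed

text \<open>Surface density and normal merge into \<open>conormal\<close>, which matches the prism
  integrals of \<open>flux_formula\<close>.\<close>

lemma face_flux:
  assumes f: "f facet_of P" and n: "has_normals E (F ` f)" and w: "continuous_on (F ` rel_interior f) w"
  shows "(LINT x:open_face E (F ` f)|face_measure E (F ` f). w x * (\<omega> \<bullet> outward_normal K x)) =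
      (LINT x|lebesgue. indicator (prism f) x * (w (F (prj f x)) * conormal f \<omega> (prj f x)))"
proof -
  have "continuous_on (F ` rel_interior f) (\<lambda>x. w x * (\<omega> \<bullet> outward_normal K x))"
    by (intro continuous_intros w continuous_outward_normal f n)
  from face_integral(1)[OF f this]
  have "(LINT x:open_face E (F ` f)|face_measure E (F ` f). w x * (\<omega> \<bullet> outward_normal K x)) =
    (LINT x|lebesgue. indicator (prism f) x * (surf f (prj f x) * (w (F (prj f x)) * (\<omega> \<bullet> outward_normal K (F (prj f x))))))" .
  also have "\<dots> = (LINT x|lebesgue. indicator (prism f) x * (w (F (prj f x)) * conormal f \<omega> (prj f x)))"
  proof (rule Bochner_Integration.integral_cong[OF refl])
    fix x
    show "indicator (prism f) x * (surf f (prj f x) * (w (F (prj f x)) * (\<omega> \<bullet> outward_normal K (F (prj f x))))) =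
      indicator (prism f) x * (w (F (prj f x)) * conormal f \<omega> (prj f x))"
    proof (cases "x \<in> prism f")
      case True
      then have y: "prj f x \<in> rel_interior f" by (simp add: prism_def)
      then have "surf f (prj f x) * (\<omega> \<bullet> outward_normal K (F (prj f x))) = conormal f \<omega> (prj f x)"
        using normal_facet(1)[OF f n y] conormal_eq(1)[OF _ f, of "prj f x" \<omega>] facet_subset_U(2)[OF f]
        by (auto simp: surf_def)
      then show ?thesis by (metis mult.left_commute)
    qed simp
  qed
  finally show ?thesis .
qed

text \<open>Stated for any pair \<open>w\<close>, \<open>D\<close> linked by integration by parts,
  so as to cover squares of Sobolev functions as well as functions with a classical
  derivative.\<close>

lemma green:
  assumes n: "\<And>e. e \<in> faces E \<Longrightarrow> has_normals E e"
    and w: "continuous_on K w" and D: "set_integrable lebesgue (interior K) D"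
    and ibp: "\<And>\<phi> d\<phi>. dir_test (interior K) \<omega> \<phi> d\<phi> \<Longrightarrow>
      (LINT x:interior K|lebesgue. w x * d\<phi> x) = - (LINT x:interior K|lebesgue. D x * \<phi> x)"
  shows "(LINT x:interior K|lebesgue. D x) =
    (\<Sum>e\<in>faces E. LINT x:open_face E e|face_measure E e. w x * (\<omega> \<bullet> outward_normal K x))"
proof -
  have fK: "F ` rel_interior f \<subseteq> K" if "f facet_of P" for f
    using that rel_interior_subset facet_of_imp_subset unfolding body_def by blast
  have "(\<Sum>e\<in>faces E. LINT x:open_face E e|face_measure E e. w x * (\<omega> \<bullet> outward_normal K x)) =
    (\<Sum>f\<in>facets. LINT x:open_face E (F ` f)|face_measure E (F ` f). w x * (\<omega> \<bullet> outward_normal K x))"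
    unfolding faces_eq by (subst sum.reindex[OF inj_faces]) simp
  also have "\<dots> = (\<Sum>f\<in>facets. LINT x|lebesgue. indicator (prism f) x * (w (F (prj f x)) * conormal f \<omega> (prj f x)))"
  proof (rule sum.cong[OF refl])
    fix f assume "f \<in> facets"
    then have f: "f facet_of P" by simp
    show "(LINT x:open_face E (F ` f)|face_measure E (F ` f). w x * (\<omega> \<bullet> outward_normal K x)) =
      (LINT x|lebesgue. indicator (prism f) x * (w (F (prj f x)) * conormal f \<omega> (prj f x)))"
      by (rule face_flux[OF f n continuous_on_subset[OF w fK[OF f]]]) (use f in \<open>auto simp: faces_eq\<close>)
  qed
  finally show ?thesis using flux_formula[OF w D ibp] by simp
qed

text \<open>The normals have length 1, so \<open>k\<close> is evaluated on [-1, 1] and is bounded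
  there. The cases needed are the identity and the absolute value.\<close>

lemma face_normal_integrable:
  fixes q :: "real^'n::_ \<Rightarrow> real" and k :: "real \<Rightarrow> real"
  assumes e: "e \<in> faces E" and n: "has_normals E e"
    and q: "continuous_on (open_face E e) q" "bounded (q ` open_face E e)"
    and k: "continuous_on UNIV k" and \<omega>: "norm \<omega> \<le> 1"
  shows "set_integrable (face_measure E e) (open_face E e) (\<lambda>x. q x * k (\<omega> \<bullet> outward_normal K x))"
proof -
  obtain f where f: "f facet_of P" and ef: "e = F ` f" using e by (auto simp: faces_eq)
  have o: "open_face E e = F ` rel_interior f" unfolding ef by (rule open_face_image[OF f])
  have nn: "has_normals E (F ` f)" using n ef by simp
  have cn: "continuous_on (F ` rel_interior f) (\<lambda>x. k (\<omega> \<bullet> outward_normal K x))"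
    by (rule continuous_on_compose2[OF k]) (auto intro!: continuous_intros continuous_outward_normal f nn)
  have "bounded (k ` {-1..1})"
    by (intro compact_imp_bounded compact_continuous_image continuous_on_subset[OF k]) auto
  then obtain C where C: "\<And>t. \<bar>t\<bar> \<le> 1 \<Longrightarrow> \<bar>k t\<bar> \<le> C" by (fastforce simp: bounded_iff)
  obtain B where B: "\<And>x. x \<in> open_face E e \<Longrightarrow> \<bar>q x\<bar> \<le> B" using q(2) by (auto simp: bounded_iff)
  have "\<bar>q x * k (\<omega> \<bullet> outward_normal K x)\<bar> \<le> B * C" if x: "x \<in> F ` rel_interior f" for x
  proof -
    obtain y where y: "y \<in> rel_interior f" "x = F y" using x by blast
    have "norm (outward_normal K x) = 1"
      unfolding y(2) normal_facet(1)[OF f nn y(1)] using conormal_eq(2)[OF _ f] facet_subset_U(2)[OF f] y(1) by blast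
    then have "\<bar>\<omega> \<bullet> outward_normal K x\<bar> \<le> 1"
      using Cauchy_Schwarz_ineq2[of \<omega> "outward_normal K x"] \<omega> by simp
    then show ?thesis unfolding abs_mult using B[of x] x C o
      by (intro mult_mono) (auto intro: order_trans[OF abs_ge_zero])
  qed
  then have bd: "bounded ((\<lambda>x. q x * k (\<omega> \<bullet> outward_normal K x)) ` F ` rel_interior f)"
    unfolding bounded_iff by force
  have "continuous_on (F ` rel_interior f) (\<lambda>x. q x * k (\<omega> \<bullet> outward_normal K x))"
    by (intro continuous_on_mult q(1)[unfolded o] cn)
  from face_integral(2)[OF f this bd] show ?thesis by (simp only: ef)
qed

lemma bounded_on_open_face:
  fixes c :: "real^'n::_ \<Rightarrow> real"
  assumes "continuous_on K c" "e \<in> faces E"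
  shows "continuous_on (open_face E e) c" "bounded (c ` open_face E e)" "open_face E e \<subseteq> e" "e \<subseteq> K"
proof -
  obtain f where f: "f facet_of P" and ef: "e = F ` f" using assms(2) by (auto simp: faces_eq)
  have o: "open_face E e = F ` rel_interior f" unfolding ef by (rule open_face_image[OF f])
  show 1: "open_face E e \<subseteq> e" unfolding o unfolding ef by (rule image_mono[OF rel_interior_subset])
  show 2: "e \<subseteq> K" unfolding ef body_def using f facet_of_imp_subset by blast
  show "continuous_on (open_face E e) c" using 1 2 by (intro continuous_on_subset[OF assms(1)]) blast
  have "bounded (c ` K)" by (intro compact_imp_bounded compact_continuous_image assms(1) compact_K)
  then show "bounded (c ` open_face E e)" by (rule bounded_subset) (use 1 2 in blast)
qed

lemma green_square:
  assumes n: "\<And>e. e \<in> faces E \<Longrightarrow> has_normals E e"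
    and c: "continuous_on K c" "AE x in lebesgue_on K. v x = c x" and v: "H1_on (interior K) v"
  shows "(LINT x:interior K|lebesgue. 2 * c x * dir_deriv \<omega> E v x) =
    (\<Sum>e\<in>faces E. LINT x:open_face E e|face_measure E e. (c x)\<^sup>2 * (\<omega> \<bullet> outward_normal K x))"
    and "L2_on (interior K) (dir_deriv \<omega> E v)" "L2_on (interior K) c"
proof -
  let ?V = "interior K"
  have bV: "bounded ?V" using compact_imp_bounded[OF compact_K] interior_subset by (rule bounded_subset)
  have Vl: "?V \<in> lmeasurable" using bV by (simp add: lmeasurable_open)
  have ae: "AE x in lebesgue_on ?V. v x = c x"
  proof -
    have "AE x in lebesgue. x \<in> K \<longrightarrow> v x = c x"
      using c(2) compact_K by (subst (asm) AE_restrict_space_iff) (auto simp: compact_imp_closed)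
    then have "AE x in lebesgue. x \<in> ?V \<longrightarrow> v x = c x"
      by eventually_elim (use interior_subset in blast)
    then show ?thesis by (subst AE_restrict_space_iff) auto
  qed
  have cV: "continuous_on ?V c" by (rule continuous_on_subset[OF c(1) interior_subset])
  have vL: "L2_on ?V v" and ex: "\<exists>G. is_L2_weak_gradient ?V v G" using v by (auto simp: H1_on_def)
  have G: "is_L2_weak_gradient ?V v (weak_gradient ?V v)"
    unfolding weak_gradient_def by (rule someI_ex[OF ex])
  show DL: "L2_on ?V (dir_deriv \<omega> E v)"
    unfolding dir_deriv_def[abs_def] by (rule L2_on_dir_gradient[OF G])
  show cL: "L2_on ?V c"
  proof -
    have m: "c \<in> borel_measurable (lebesgue_on ?V)"
      by (rule continuous_imp_measurable_on_sets_lebesgue[OF cV]) simp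
    have "integrable (lebesgue_on ?V) (\<lambda>x. (c x)\<^sup>2)"
      by (rule integrable_cong_AE_imp[of _ "\<lambda>x. (v x)\<^sup>2"])
        (use vL ae m in \<open>auto simp: L2_on_def\<close>)
    then show ?thesis using m by (simp add: L2_on_def)
  qed
  have "set_integrable lebesgue ?V (\<lambda>x. c x * dir_deriv \<omega> E v x)"
    using L2_on_integrable[OF cL DL] by (simp add: set_integrable_def integrable_restrict_space)
  then have "set_integrable lebesgue ?V (\<lambda>x. 2 * (c x * dir_deriv \<omega> E v x))"
    by (rule set_integrable_mult_right)
  then have D: "set_integrable lebesgue ?V (\<lambda>x. 2 * c x * dir_deriv \<omega> E v x)"
    by (simp only: mult.assoc)
  show "(LINT x:?V|lebesgue. 2 * c x * dir_deriv \<omega> E v x) =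
    (\<Sum>e\<in>faces E. LINT x:open_face E e|face_measure E e. (c x)\<^sup>2 * (\<omega> \<bullet> outward_normal K x))"
  proof (rule green[OF n _ D])
    show "continuous_on K (\<lambda>x. (c x)\<^sup>2)" by (intro continuous_intros c(1))
    show "(LINT x:?V|lebesgue. (c x)\<^sup>2 * d\<phi> x) = - (LINT x:?V|lebesgue. 2 * c x * dir_deriv \<omega> E v x * \<phi> x)"
      if "dir_test ?V \<omega> \<phi> d\<phi>" for \<phi> d\<phi>
      using weak_derivative_square[OF open_interior bV vL G cV ae that] by (simp add: dir_deriv_def)
  qed
qed

end

section \<open>Interior faces\<close>

text \<open>Otherwise the direction \<open>- (\<nu> + \<nu>')\<close> would lead from
  \<open>p\<close> into both interiors.\<close>

lemma outward_normals_opposite: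
  fixes p :: "'a::euclidean_space"
  assumes "is_outward_normal S p \<nu>" "is_outward_normal S' p \<nu>'" "interior S \<inter> interior S' = {}"
  shows "\<nu>' = - \<nu>"
proof (rule ccontr)
  assume neq: "\<nu>' \<noteq> - \<nu>"
  have n: "\<nu> \<bullet> \<nu> = 1" "\<nu>' \<bullet> \<nu>' = 1" using assms by (auto simp: is_outward_normal_def norm_eq_1)
  have "(\<nu> + \<nu>') \<bullet> (\<nu> + \<nu>') > 0" using neq by (simp add: add_eq_0_iff)
  then have pos: "\<nu> \<bullet> \<nu>' > - 1" using n by (simp add: inner_add_left inner_add_right inner_commute)
  define z where "z = - (\<nu> + \<nu>')"
  have "\<nu> \<bullet> z < 0" "\<nu>' \<bullet> z < 0" using pos n by (simp_all add: z_def inner_add_right inner_diff_right inner_commute)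
  from outward_normal_inside[OF assms(1) this(1)] outward_normal_inside[OF assms(2) this(2)]
  have "eventually (\<lambda>t::real. False) (at_right 0)"
    by eventually_elim (use assms(3) in blast)
  then show False by simp
qed

text \<open>Tietze's theorem extends \<open>q\<close> with the same bound; the extension is cut off
  near the complement of \<open>N\<close> and mollified at a radius tied to the cutoff, which keeps
  the supports in \<open>N\<close>. The uniform bound \<open>B\<close> serves dominated convergence
  on the face.\<close>

lemma smooth_approximation:
  fixes q :: "'a::euclidean_space \<Rightarrow> real"
  assumes N: "open N" "bounded N" and q: "continuous_on S q" "compact S" "\<And>x. x \<in> S \<Longrightarrow> \<bar>q x\<bar> \<le> B" and B: "B \<ge> 0"
  shows "\<exists>w dw. (\<forall>k::nat. dir_C1 \<omega> (w k) (dw k) \<and> (\<exists>C. compact C \<and> C \<subseteq> N \<and> (\<forall>x. x \<notin> C \<longrightarrow> w k x = 0)) \<and>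
      (\<forall>x. \<bar>w k x\<bar> \<le> B)) \<and> (\<forall>x\<in>S \<inter> N. (\<lambda>k. w k x) \<longlonglongrightarrow> q x)"
proof -
  have "closedin (top_of_set UNIV) S" using q(2) by (simp add: compact_imp_closed)
  then obtain g where g: "continuous_on UNIV g" "\<And>x. x \<in> S \<Longrightarrow> g x = q x" "\<And>x. \<bar>g x\<bar> \<le> B"
    using Tietze[OF q(1) _ B, of UNIV] q(3) by auto
  have Nc: "- N \<noteq> {}"
  proof
    assume "- N = {}"
    then have "N = UNIV" by auto
    then show False using N(2) not_bounded_UNIV by blast
  qed
  define d where "d = (\<lambda>x. infdist x (- N))"
  have dc: "continuous_on A d" for A unfolding d_def by (intro continuous_intros)
  have dlip: "\<bar>d x - d y\<bar> \<le> dist x y" for x y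
    unfolding d_def using infdist_triangle[of x "- N" y] infdist_triangle[of y "- N" x] by (simp add: dist_commute)
  have dN: "d x > 0 \<longleftrightarrow> x \<in> N" for x
    using in_closed_iff_infdist_zero[of "- N" x] N(1) Nc infdist_nonneg[of x "- N"]
    unfolding d_def by (auto simp: closed_Compl order_less_le)
  \<comment> \<open>\<open>\<eta> k\<close> is 0 where \<open>d x\<close> is at most
    \<open>1 / (k + 1) = 2 * r k\<close> and 1 where it is at least \<open>2 / (k + 1)\<close>.
    Mollifying at radius \<open>r k\<close> then leaves the support within
    \<open>d x \<ge> r k\<close>.\<close>
  define \<eta> where "\<eta> = (\<lambda>(k::nat) x. max 0 (min 1 (real (Suc k) * d x - 1)))"
  define u where "u = (\<lambda>k x. g x * \<eta> k x)"
  define r where "r = (\<lambda>k::nat. 1 / (2 * real (Suc k)))"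
  have r: "r k > 0" for k by (simp add: r_def)
  have \<eta>b: "0 \<le> \<eta> k x" "\<eta> k x \<le> 1" for k x by (auto simp: \<eta>_def)
  have ub: "\<bar>u k x\<bar> \<le> B" for k x
    using mult_mono[OF g(3)[of x] \<eta>b(2)[of k x]] B \<eta>b(1)[of k x] by (simp add: u_def abs_mult)
  have compactC: "compact {x. c \<le> d x}" "{x. c \<le> d x} \<subseteq> N" if "c > 0" for c
  proof -
    show sub: "{x. c \<le> d x} \<subseteq> N" using that dN by (auto intro: less_le_trans)
    have "closed {x. c \<le> d x}" by (intro closed_Collect_le continuous_intros dc)
    then show "compact {x. c \<le> d x}" using bounded_subset[OF N(2) sub] by (simp add: compact_eq_bounded_closed)
  qed
  have u0: "u k x = 0" if "x \<notin> {x. 2 * r k \<le> d x}" for k x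
  proof -
    have "2 * r k = 1 / real (Suc k)" by (simp add: r_def del: of_nat_Suc)
    then have "d x < 1 / real (Suc k)" using that by (simp add: not_le)
    then have "real (Suc k) * d x < 1" by (simp add: field_simps)
    then show ?thesis by (simp add: u_def \<eta>_def max_def)
  qed
  have uc: "continuous_on UNIV (u k)" for k
    unfolding u_def \<eta>_def by (intro continuous_intros g(1) dc)
  have ui: "integrable lborel (u k)" for k
    by (rule continuous_compact_support_integrable[OF uc compactC(1)[of "2 * r k"] u0]) (use r in auto)
  define w where "w = (\<lambda>k. convolve (u k) (mollifier (r k)))"
  define dw where "dw = (\<lambda>k. convolve (u k) (mollifier_deriv (r k) \<omega>))"
  have 1: "dir_C1 \<omega> (w k) (dw k)" for k unfolding w_def dw_def by (rule dir_C1_mollify[OF ui r])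
  have 2: "\<bar>w k x\<bar> \<le> B" for k x
    using mollify_close[OF ui[of k] r[of k], of x 0 B] ub by (simp add: w_def)
  have 3: "w k x = 0" if x: "x \<notin> {x. r k \<le> d x}" for k x
  proof -
    have "u k y = 0" if "dist x y \<le> r k" for y
      using u0[of y k] dlip[of x y] that x by auto
    then show ?thesis using mollify_close[OF ui[of k] r[of k], of x 0 0] by (simp add: w_def)
  qed
  have 4: "(\<lambda>k. w k x) \<longlonglongrightarrow> q x" if x: "x \<in> S \<inter> N" for x
  proof (rule LIMSEQ_I)
    fix \<epsilon> :: real assume \<epsilon>: "\<epsilon> > 0"
    have "isCont g x" using g(1) continuous_on_eq_continuous_at[OF open_UNIV] by blast
    then obtain \<delta> where \<delta>: "\<delta> > 0" "\<And>y. dist y x < \<delta> \<Longrightarrow> dist (g y) (g x) < \<epsilon> / 2"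
      using \<epsilon> unfolding continuous_at_eps_delta by (metis half_gt_zero)
    have dx: "d x > 0" using x dN by blast
    \<comment> \<open>Once \<open>r k\<close> and \<open>1 / (k + 1)\<close> are below
      \<open>d x / 5\<close>, every point within \<open>r k\<close> of \<open>x\<close> has distance
      more than \<open>2 / (k + 1)\<close> to the complement, so that \<open>u k\<close> agrees with
      \<open>g\<close> there.\<close>
    define m where "m = min \<delta> (d x / 5)"
    have "m > 0" using \<delta>(1) dx by (simp add: m_def)
    then have "eventually (\<lambda>k. 1 / real (Suc k) < m) sequentially"
      using order_tendstoD(2)[OF lim_1_over_n[THEN LIMSEQ_Suc], of m] by simp
    then obtain k0 where k0: "\<And>k. k \<ge> k0 \<Longrightarrow> 1 / real (Suc k) < m" by (auto simp: eventually_sequentially)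
    have "norm (w k x - q x) < \<epsilon>" if k: "k \<ge> k0" for k
    proof -
      have rm: "r k < m" "1 / real (Suc k) < d x / 5" using k0[OF k] by (auto simp: r_def m_def field_simps)
      have "\<bar>w k x - g x\<bar> \<le> \<epsilon> / 2"
        unfolding w_def
      proof (rule mollify_close[OF ui r])
        fix y assume y: "dist x y \<le> r k"
        have "d y \<ge> d x - r k" using dlip[of x y] y by simp
        moreover have "r k < d x / 5" using rm(1) by (simp add: m_def)
        ultimately have "d y > 2 * (1 / real (Suc k))" using rm(2) dx by linarith
        then have "real (Suc k) * d y > 2" by (simp add: field_simps)
        then have "u k y = g y" by (simp add: u_def \<eta>_def)
        moreover have "dist y x < \<delta>" using y rm(1) by (simp add: dist_commute m_def)
        ultimately show "\<bar>u k y - g x\<bar> \<le> \<epsilon> / 2" using \<delta>(2)[of y] by (simp add: dist_real_def)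
      qed
      then show ?thesis using g(2)[of x] x \<epsilon> by simp
    qed
    then show "\<exists>k0. \<forall>k\<ge>k0. norm (w k x - q x) < \<epsilon>" by blast
  qed
  have 5: "\<exists>C. compact C \<and> C \<subseteq> N \<and> (\<forall>x. x \<notin> C \<longrightarrow> w k x = 0)" for k
    using compactC[OF r[of k]] 3[of _ k] by blast
  show ?thesis using 1 2 4 5 by blast
qed

context curved_element
begin

text \<open>The other facets and the complement of \<open>U\<close> keep away from a relatively
  interior point of \<open>f\<close>, so in reference coordinates the element is locally one side of
  a single hyperplane.\<close>

lemma local_side:
  assumes f: "f facet_of P" and y: "y \<in> rel_interior f" and V: "open V" "F y \<in> V"
  obtains r where "r > 0" "ball y r \<subseteq> U" "F ` ball y r \<subseteq> V"
    "\<And>z. z \<in> ball y r \<Longrightarrow> F z \<in> K \<longleftrightarrow> nrm f \<bullet> z \<le> off f"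
    "\<And>z. z \<in> ball y r \<Longrightarrow> F z \<in> interior K \<longleftrightarrow> nrm f \<bullet> z < off f"
    "\<And>z. z \<in> ball y r \<Longrightarrow> F z \<in> F ` f \<longleftrightarrow> nrm f \<bullet> z = off f"
proof -
  define O' where "O' = (U \<inter> F -` V) \<inter> (\<Inter>f'\<in>facets - {f}. {z. nrm f' \<bullet> z < off f'})"
  have "open (U \<inter> F -` V)"
    using continuous_F U(1) V(1) by (simp add: continuous_on_open_vimage Int_commute)
  moreover have "open (\<Inter>f'\<in>facets - {f}. {z. nrm f' \<bullet> z < off f'})"
    by (intro open_INT finite_Diff finite_facets ballI open_halfspace_lt)
  ultimately have "open O'" unfolding O'_def by (rule open_Int)
  moreover have "y \<in> O'"
    using y V(2) facet_subset_U(2)[OF f] unfolding O'_def rel_interior_facet[OF f] by auto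
  ultimately obtain r where r: "r > 0" "ball y r \<subseteq> O'" by (meson openE)
  have zP: "z \<in> P \<longleftrightarrow> nrm f \<bullet> z \<le> off f" "z \<in> interior P \<longleftrightarrow> nrm f \<bullet> z < off f" "z \<in> f \<longleftrightarrow> nrm f \<bullet> z = off f"
    and zU: "z \<in> U" if "z \<in> ball y r" for z
  proof -
    have z: "z \<in> U" "\<And>f'. f' facet_of P \<Longrightarrow> f' \<noteq> f \<Longrightarrow> nrm f' \<bullet> z < off f'"
      using that r(2) by (auto simp: O'_def)
    show "z \<in> U" by (rule z(1))
    show 1: "z \<in> P \<longleftrightarrow> nrm f \<bullet> z \<le> off f" unfolding polytope_eq using z(2) f by (metis less_imp_le)
    show "z \<in> interior P \<longleftrightarrow> nrm f \<bullet> z < off f" unfolding interior_eq using z(2) f by metis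
    have "z \<in> f \<longleftrightarrow> z \<in> P \<and> nrm f \<bullet> z = off f" using facet_props(3)[OF f] by blast
    then show "z \<in> f \<longleftrightarrow> nrm f \<bullet> z = off f" using 1 by auto
  qed
  have mem: "F z \<in> F ` A \<longleftrightarrow> z \<in> A" if "z \<in> ball y r" "A \<subseteq> U" for z A
    using inj zU[OF that(1)] that(2) by (auto dest: inj_onD)
  show ?thesis
  proof (rule that[OF r(1)])
    show "ball y r \<subseteq> U" using zU by blast
    show "F ` ball y r \<subseteq> V" using r(2) by (auto simp: O'_def)
    fix z assume z: "z \<in> ball y r"
    show "F z \<in> K \<longleftrightarrow> nrm f \<bullet> z \<le> off f" unfolding body_def mem[OF z P_subset(2)] by (rule zP(1)[OF z])
    show "F z \<in> interior K \<longleftrightarrow> nrm f \<bullet> z < off f" unfolding interior_K mem[OF z P_subset(1)] by (rule zP(2)[OF z])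
    show "F z \<in> F ` f \<longleftrightarrow> nrm f \<bullet> z = off f" unfolding mem[OF z facet_subset_U(1)[OF f]] by (rule zP(3)[OF z])
  qed
qed

text \<open>The integration by parts that \<open>green\<close> asks for is the vanishing integral of
  the derivative of \<open>w * \<phi>\<close>.\<close>

lemma green_dir_C1:
  assumes n: "\<And>e. e \<in> faces E \<Longrightarrow> has_normals E e" and w: "dir_C1 \<omega> w dw"
  shows "(LINT x:interior K|lebesgue. dw x) =
    (\<Sum>e\<in>faces E. LINT x:open_face E e|face_measure E e. w x * (\<omega> \<bullet> outward_normal K x))"
    and "set_integrable lebesgue (interior K) dw"
proof -
  have cw: "continuous_on UNIV w" "continuous_on UNIV dw" using w by (auto simp: dir_C1_def)
  have "set_integrable lborel K dw"
    unfolding set_integrable_def by (rule borel_integrable_compact[OF compact_K continuous_on_subset[OF cw(2)]]) simp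
  then have "set_integrable lebesgue K dw"
    unfolding set_integrable_def by (subst integrable_completion) (auto simp: integrable_iff_bounded)
  then show D: "set_integrable lebesgue (interior K) dw"
    by (rule set_integrable_subset) (auto simp: interior_subset)
  show "(LINT x:interior K|lebesgue. dw x) =
    (\<Sum>e\<in>faces E. LINT x:open_face E e|face_measure E e. w x * (\<omega> \<bullet> outward_normal K x))"
  proof (rule green[OF n _ D])
    show "continuous_on K w" by (rule continuous_on_subset[OF cw(1)]) simp
    fix \<phi> d\<phi> assume \<phi>: "dir_test (interior K) \<omega> \<phi> d\<phi>"
    then obtain C where C: "compact C" "C \<subseteq> interior K" "\<And>x. x \<notin> C \<Longrightarrow> \<phi> x = 0" "\<And>x. x \<notin> C \<Longrightarrow> d\<phi> x = 0"
      and \<phi>1: "dir_C1 \<omega> \<phi> d\<phi>" unfolding dir_test_def by blast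
    have c\<phi>: "continuous_on UNIV \<phi>" "continuous_on UNIV d\<phi>" using \<phi>1 by (auto simp: dir_C1_def)
    have conv: "(LINT x:interior K|lebesgue. h x) = (LINT x|lborel. h x)" "integrable lborel h"
      if "continuous_on UNIV h" "\<And>x. x \<notin> C \<Longrightarrow> h x = 0" for h :: "real^'n::_ \<Rightarrow> real"
    proof -
      have "(\<lambda>x. indicator (interior K) x *\<^sub>R h x) = h"
        using that(2) C(2) by (auto simp: indicator_def fun_eq_iff)
      then show "(LINT x:interior K|lebesgue. h x) = (LINT x|lborel. h x)"
        unfolding set_lebesgue_integral_def
        using borel_measurable_continuous_onI[OF that(1)] by (simp add: integral_completion)
      show "integrable lborel h" by (rule continuous_compact_support_integrable[OF that(1) C(1) that(2)])
    qed
    have "(LINT x|lborel. dw x * \<phi> x + w x * d\<phi> x) = 0"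
      by (rule dir_C1_integral_zero[OF dir_C1_mult[OF w \<phi>1] C(1)]) (use C in auto)
    moreover have c: "continuous_on UNIV (\<lambda>x. dw x * \<phi> x)" "continuous_on UNIV (\<lambda>x. w x * d\<phi> x)"
      by (intro continuous_intros cw c\<phi>)+
    moreover have z: "dw x * \<phi> x = 0" "w x * d\<phi> x = 0" if "x \<notin> C" for x using C that by auto
    ultimately show "(LINT x:interior K|lebesgue. w x * d\<phi> x) = - (LINT x:interior K|lebesgue. dw x * \<phi> x)"
      using conv[OF c(1) z(1)] conv[OF c(2) z(2)] by simp
  qed
qed

lemma face_flux_tendsto:
  fixes w :: "nat \<Rightarrow> real^'n::_ \<Rightarrow> real"
  assumes e: "e \<in> faces E" "has_normals E e" and \<omega>: "norm \<omega> \<le> 1"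
    and w: "\<And>k. continuous_on (open_face E e) (w k)" "\<And>k x. x \<in> open_face E e \<Longrightarrow> \<bar>w k x\<bar> \<le> B"
    and q: "continuous_on (open_face E e) q" "\<And>x. x \<in> open_face E e \<Longrightarrow> (\<lambda>k. w k x) \<longlonglongrightarrow> q x"
  shows "(\<lambda>k. LINT x:open_face E e|face_measure E e. w k x * (\<omega> \<bullet> outward_normal K x))
    \<longlonglongrightarrow> (LINT x:open_face E e|face_measure E e. q x * (\<omega> \<bullet> outward_normal K x))"
proof -
  have bw: "bounded (w k ` open_face E e)" for k using w(2) unfolding bounded_iff by fastforce
  have qb: "\<bar>q x\<bar> \<le> B" if "x \<in> open_face E e" for x
    by (rule LIMSEQ_le_const2[OF tendsto_rabs[OF q(2)[OF that]]]) (use w(2)[OF that] in blast)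
  have bq: "bounded (q ` open_face E e)" using qb unfolding bounded_iff by fastforce
  have iw: "set_integrable (face_measure E e) (open_face E e) (\<lambda>x. w k x * (\<omega> \<bullet> outward_normal K x))" for k
    using face_normal_integrable[OF e w(1) bw continuous_on_id \<omega>] .
  have iq: "set_integrable (face_measure E e) (open_face E e) (\<lambda>x. q x * (\<omega> \<bullet> outward_normal K x))"
    using face_normal_integrable[OF e q(1) bq continuous_on_id \<omega>] .
  have iB: "set_integrable (face_measure E e) (open_face E e) (\<lambda>x. B * \<bar>\<omega> \<bullet> outward_normal K x\<bar>)"
    by (rule face_normal_integrable[OF e continuous_on_const _ _ \<omega>])
      (auto intro!: continuous_intros simp: bounded_iff)
  show ?thesis
    unfolding set_lebesgue_integral_def
  proof (rule integral_dominated_convergence[where w = "\<lambda>x. indicator (open_face E e) x *\<^sub>R (B * \<bar>\<omega> \<bullet> outward_normal K x\<bar>)"])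
    show "AE x in face_measure E e. norm (indicator (open_face E e) x *\<^sub>R (w k x * (\<omega> \<bullet> outward_normal K x)))
        \<le> indicator (open_face E e) x *\<^sub>R (B * \<bar>\<omega> \<bullet> outward_normal K x\<bar>)" for k
      using w(2) by (intro AE_I2) (auto simp: indicator_def abs_mult intro!: mult_right_mono)
    show "AE x in face_measure E e. (\<lambda>k. indicator (open_face E e) x *\<^sub>R (w k x * (\<omega> \<bullet> outward_normal K x)))
        \<longlonglongrightarrow> indicator (open_face E e) x *\<^sub>R (q x * (\<omega> \<bullet> outward_normal K x))"
    proof (rule AE_I2)
      fix x
      show "(\<lambda>k. indicator (open_face E e) x *\<^sub>R (w k x * (\<omega> \<bullet> outward_normal K x)))
        \<longlonglongrightarrow> indicator (open_face E e) x *\<^sub>R (q x * (\<omega> \<bullet> outward_normal K x))"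
      proof (cases "x \<in> open_face E e")
        case True
        show ?thesis by (intro tendsto_intros q(2)[OF True])
      qed simp
    qed
  qed (use iw iq iB in \<open>auto simp: set_integrable_def borel_measurable_integrable\<close>)
qed

lemma open_face_disjoint:
  assumes "e \<in> faces E" "e1 \<in> faces E" "e1 \<noteq> e"
  shows "open_face E e \<inter> e1 = {}"
proof -
  obtain f f1 where f: "f facet_of P" "e = F ` f" "f1 facet_of P" "e1 = F ` f1" "f1 \<noteq> f"
    using assms by (auto simp: faces_eq)
  have "rel_interior f \<inter> f1 = {}" unfolding rel_interior_facet_eq[OF f(1)] using f by blast
  then have "F ` rel_interior f \<inter> F ` f1 = {}"
    using inj_on_image_Int[OF inj facet_subset_U(2)[OF f(1)] facet_subset_U(1)[OF f(3)]] by simp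
  then show ?thesis using open_face_image[OF f(1)] f by simp
qed

lemma compact_face:
  assumes "e \<in> faces E"
  shows "compact e"
proof -
  obtain f where f: "f facet_of P" "e = F ` f" using assms by (auto simp: faces_eq)
  show ?thesis
    unfolding f(2) by (rule compact_continuous_image[OF continuous_on_subset[OF continuous_F facet_subset_U(1)[OF f(1)]] compact_facet[OF f(1)]])
qed

end

text \<open>The transition map between the two reference facets is continuous and injective, and the
  facets have equal dimension; invariance of domain then sends relative interior into relative
  interior.\<close>

lemma open_faces_subset:
  assumes "curved_element E U" "curved_element E' U'" and e: "e \<in> faces E" "e \<in> faces E'"
  shows "open_face E e \<subseteq> open_face E' e"
proof -
  interpret A: curved_element E U by fact
  interpret B: curved_element E' U' by fact
  obtain f where f: "f facet_of ref E" "e = emap E ` f" using e(1) by (auto simp: A.faces_eq)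
  obtain f' where f': "f' facet_of ref E'" "e = emap E' ` f'" using e(2) by (auto simp: B.faces_eq)
  let ?h = "\<lambda>y. B.G (emap E y)"
  have sub: "emap E ` f \<subseteq> emap E' ` U'" using f f' B.facet_subset_U(1)[OF f'(1)] by blast
  have img: "?h ` f = f'"
  proof -
    have "?h ` f = B.G ` emap E' ` f'" using f f' by (metis image_image)
    also have "\<dots> = f'" using B.facet_subset_U(1)[OF f'(1)] by (force simp: image_image)
    finally show ?thesis .
  qed
  have FG: "emap E' (?h y) = emap E y" if "y \<in> f" for y
    using sub that by (auto simp: image_subset_iff)
  have "continuous_on f ?h"
    by (rule continuous_on_compose2[OF B.continuous_G continuous_on_subset[OF A.continuous_F A.facet_subset_U(1)[OF f(1)]] sub])
  moreover have "inj_on ?h f"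
  proof (rule inj_onI)
    fix x y assume "x \<in> f" "y \<in> f" "?h x = ?h y"
    then have "emap E x = emap E y" using FG by metis
    then show "x = y" using A.inj A.facet_subset_U(1)[OF f(1)] \<open>x \<in> f\<close> \<open>y \<in> f\<close> by (auto dest: inj_onD)
  qed
  moreover have "aff_dim f' \<le> aff_dim f"
    using f(1) f'(1) aff_dim_nonempty_interior[OF A.solid] aff_dim_nonempty_interior[OF B.solid]
    by (simp add: facet_of_def)
  ultimately have h: "?h \<in> rel_interior f \<rightarrow> rel_interior (?h ` f)"
    using img by (intro continuous_image_subset_rel_interior[where T = f']) auto
  have "emap E y \<in> emap E' ` rel_interior f'" if y: "y \<in> rel_interior f" for y
  proof -
    have "?h y \<in> rel_interior f'" using h y img by auto
    moreover have "emap E y = emap E' (?h y)" using FG y rel_interior_subset by (metis subsetD)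
    ultimately show ?thesis by blast
  qed
  then show ?thesis
    using A.open_face_image[OF f(1)] B.open_face_image[OF f'(1)] f(2) f'(2) by auto
qed

text \<open>In the coordinates of \<open>E'\<close> a level function \<open>h\<close> describes near
  \<open>p\<close> both the face (\<open>h = 0\<close>) and the interior of \<open>E'\<close>
  (\<open>h < 0\<close>). The far side \<open>H\<close> of the face, as seen from \<open>E\<close>,
  is connected and avoids the face, so \<open>h\<close> has one sign on it. This sign is negative,
  for otherwise the interior of \<open>E'\<close> would stay away from its boundary point
  \<open>p\<close>.\<close>

lemma open_face_covered:
  assumes "curved_element E U" "curved_element E' U'" and e: "e \<in> faces E" "e \<in> faces E'"
    and disj: "interior (body E) \<inter> interior (body E') = {}" and p: "p \<in> open_face E e"
  shows "p \<in> interior (body E \<union> body E')"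
proof -
  interpret A: curved_element E U by fact
  interpret B: curved_element E' U' by fact
  obtain f where f: "f facet_of ref E" "e = emap E ` f" using e(1) by (auto simp: A.faces_eq)
  obtain f' where f': "f' facet_of ref E'" "e = emap E' ` f'" using e(2) by (auto simp: B.faces_eq)
  obtain y where y: "y \<in> rel_interior f" "p = emap E y" using p A.open_face_image[OF f(1)] f(2) by auto
  have "p \<in> open_face E' e" using open_faces_subset[OF assms(1-4)] p by blast
  then obtain y' where y': "y' \<in> rel_interior f'" "p = emap E' y'" using B.open_face_image[OF f'(1)] f'(2) by auto
  obtain r' where r': "r' > 0" "ball y' r' \<subseteq> U'"
    and "emap E' ` ball y' r' \<subseteq> UNIV" "\<And>z. z \<in> ball y' r' \<Longrightarrow> emap E' z \<in> body E' \<longleftrightarrow> B.nrm f' \<bullet> z \<le> B.off f'"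
    and r'e: "\<And>z. z \<in> ball y' r' \<Longrightarrow> emap E' z \<in> interior (body E') \<longleftrightarrow> B.nrm f' \<bullet> z < B.off f'"
    "\<And>z. z \<in> ball y' r' \<Longrightarrow> emap E' z \<in> emap E' ` f' \<longleftrightarrow> B.nrm f' \<bullet> z = B.off f'"
    by (rule B.local_side[OF f'(1) y'(1) open_UNIV UNIV_I]) (rule that)
  define W where "W = emap E' ` ball y' r'"
  have oW: "open W" unfolding W_def by (rule B.open_F[OF open_ball r'(2)])
  have pW: "p \<in> W" unfolding W_def y'(2) using r'(1) by simp
  define h where "h = (\<lambda>x. B.nrm f' \<bullet> B.G x - B.off f')"
  have ch: "continuous_on W h"
    unfolding h_def W_def using r'(2)
    by (intro continuous_intros continuous_on_subset[OF B.continuous_G]) auto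
  have hW: "x \<in> interior (body E') \<longleftrightarrow> h x < 0" "x \<in> e \<longleftrightarrow> h x = 0" if xW: "x \<in> W" for x
  proof -
    obtain z where z: "z \<in> ball y' r'" "x = emap E' z" using xW by (auto simp: W_def)
    then have "B.G x = z" using r'(2) by auto
    then show "x \<in> interior (body E') \<longleftrightarrow> h x < 0" "x \<in> e \<longleftrightarrow> h x = 0"
      using r'e[OF z(1)] z(2) f'(2) by (auto simp: h_def)
  qed
  obtain r where r: "r > 0" "ball y r \<subseteq> U" "emap E ` ball y r \<subseteq> W"
    "\<And>z. z \<in> ball y r \<Longrightarrow> emap E z \<in> body E \<longleftrightarrow> A.nrm f \<bullet> z \<le> A.off f"
    "\<And>z. z \<in> ball y r \<Longrightarrow> emap E z \<in> interior (body E) \<longleftrightarrow> A.nrm f \<bullet> z < A.off f"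
    "\<And>z. z \<in> ball y r \<Longrightarrow> emap E z \<in> emap E ` f \<longleftrightarrow> A.nrm f \<bullet> z = A.off f"
    by (rule A.local_side[OF f(1) y(1) oW pW[unfolded y(2)]]) (rule that)
  define N where "N = emap E ` ball y r"
  have oN: "open N" unfolding N_def by (rule A.open_F[OF open_ball r(2)])
  have pN: "p \<in> N" unfolding N_def y(2) using r(1) by simp
  define H where "H = emap E ` (ball y r \<inter> {z. A.nrm f \<bullet> z > A.off f})"
  have HW: "H \<subseteq> W" using r(3) by (auto simp: H_def)
  have "connected (ball y r \<inter> {z. A.nrm f \<bullet> z > A.off f})"
    by (intro convex_connected convex_Int convex_ball convex_halfspace_gt)
  then have cH: "connected (h ` H)"
    unfolding H_def using r(2,3)
    by (intro connected_continuous_image continuous_on_subset[OF ch] continuous_on_subset[OF A.continuous_F]) auto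
  have "h x \<noteq> 0" if xH: "x \<in> H" for x
  proof -
    obtain z where z: "z \<in> ball y r" "A.nrm f \<bullet> z > A.off f" "x = emap E z" using xH by (auto simp: H_def)
    then have "x \<notin> e" using r(6)[OF z(1)] f(2) by auto
    then show ?thesis using hW(2) HW xH by blast
  qed
  then have H0: "0 \<notin> h ` H" by force
  \<comment> \<open>Disjointness of the interiors excludes \<open>h < 0\<close> on the near side,
    and the face excludes \<open>h = 0\<close>.\<close>
  have below: "h x > 0" if x: "x \<in> N" "x \<in> interior (body E)" for x
  proof -
    obtain z where z: "z \<in> ball y r" "x = emap E z" using x(1) by (auto simp: N_def)
    have xW: "x \<in> W" using z r(3) by auto
    have "A.nrm f \<bullet> z < A.off f" using r(5)[OF z(1)] x(2) z(2) by simp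
    then have "x \<notin> e" using r(6)[OF z(1)] z(2) f(2) by simp
    then show ?thesis using hW[OF xW] x(2) disj by (metis disjoint_iff linorder_neqE_linordered_idom)
  qed
  have split: "x \<in> interior (body E) \<or> x \<in> e \<or> x \<in> H" if x: "x \<in> N" for x
  proof -
    obtain z where z: "z \<in> ball y r" "x = emap E z" using x(1) by (auto simp: N_def)
    show ?thesis using r(5,6)[OF z(1)] z f(2)
      by (cases "A.nrm f \<bullet> z" "A.off f" rule: linorder_cases) (auto simp: H_def)
  qed
  have "\<exists>x\<in>H. h x < 0"
  proof (rule ccontr)
    assume "\<not> (\<exists>x\<in>H. h x < 0)"
    then have nonneg: "h x \<ge> 0" if "x \<in> N" for x
    proof -
      have "x \<in> W" using that r(3) by (auto simp: N_def)
      then show ?thesis using split[OF that] below[OF that] hW(2)[of x] \<open>\<not> (\<exists>x\<in>H. h x < 0)\<close> by force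
    qed
    then have "N \<inter> interior (body E') = {}" using hW(1) r(3) by (fastforce simp: N_def)
    moreover have "p \<in> body E'"
      unfolding y'(2) body_def
      by (rule imageI) (rule subsetD[OF facet_of_imp_subset[OF f'(1)] subsetD[OF rel_interior_subset y'(1)]])
    then have "p \<in> closure (interior (body E'))" by (simp add: B.closure_interior_K)
    ultimately show False using open_Int_closure_eq_empty[OF oN, of "interior (body E')"] pN by blast
  qed
  then obtain x0 where x0: "x0 \<in> H" "h x0 < 0" by blast
  have neg: "h x < 0" if "x \<in> H" for x
  proof (rule ccontr)
    assume "\<not> h x < 0"
    then have "0 \<in> h ` H" using cH x0 that unfolding connected_iff_interval by (meson imageI less_imp_le not_le)
    then show False using H0 by simp
  qed
  have "N \<subseteq> body E \<union> body E'"
  proof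
    fix x assume x: "x \<in> N"
    consider "x \<in> interior (body E)" | "x \<in> e" | "x \<in> H" using split[OF x] by blast
    then show "x \<in> body E \<union> body E'"
    proof cases
      case 1 then show ?thesis using interior_subset by blast
    next
      case 2 then show ?thesis using f facet_of_imp_subset unfolding body_def by blast
    next
      case 3
      then have "x \<in> interior (body E')" using neg hW(1) HW by blast
      then show ?thesis using interior_subset by blast
    qed
  qed
  then show ?thesis using oN pN by (rule interiorI[rotated 2])
qed

text \<open>Both fluxes through the common face are computed from volume integrals of functions that are
  supported in the two elements and vanish on all other faces; these volume integrals add up to 0.\<close>

lemma face_flux_match:
  fixes E E' :: "(real^'n::{finite,wellorder}) element"
  assumes cE: "curved_element E U" "curved_element E' U'" and e: "e \<in> faces E" "e \<in> faces E'"
    and disj: "interior (body E) \<inter> interior (body E') = {}"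
    and n: "\<And>e. e \<in> faces E \<Longrightarrow> has_normals E e" "\<And>e. e \<in> faces E' \<Longrightarrow> has_normals E' e"
    and q: "continuous_on e q" and \<omega>: "norm \<omega> \<le> 1"
  shows "(LINT x:open_face E e|face_measure E e. q x * (\<omega> \<bullet> outward_normal (body E) x)) =
    - (LINT x:open_face E' e|face_measure E' e. q x * (\<omega> \<bullet> outward_normal (body E') x))"
proof -
  interpret A: curved_element E U by fact
  interpret B: curved_element E' U' by fact
  let ?K = "body E" and ?K' = "body E'"
  let ?A = "\<lambda>w. LINT x:open_face E e|face_measure E e. w x * (\<omega> \<bullet> outward_normal ?K x)"
  let ?B = "\<lambda>w. LINT x:open_face E' e|face_measure E' e. w x * (\<omega> \<bullet> outward_normal ?K' x)"
  have oeq: "open_face E e = open_face E' e"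
    by (intro equalityI open_faces_subset[OF cE e] open_faces_subset[OF cE(2,1) e(2,1)])
  \<comment> \<open>With all other faces removed, Green's formula for functions supported in
    \<open>N\<close> retains the flux through \<open>e\<close> alone on each of the two
    elements.\<close>
  define N where "N = interior (?K \<union> ?K') - (\<Union>(faces E - {e}) \<union> \<Union>(faces E' - {e}))"
  have oN: "open N"
    unfolding N_def
    by (intro open_Diff open_interior closed_Un closed_Union finite_Diff A.finite_faces B.finite_faces)
      (auto intro: compact_imp_closed A.compact_face B.compact_face)
  have NK: "N \<subseteq> ?K \<union> ?K'" unfolding N_def using interior_subset by blast
  have bN: "bounded N"
    by (rule bounded_subset[OF _ NK]) (simp add: A.compact_K B.compact_K compact_imp_bounded)
  have eN: "open_face E e \<subseteq> N"
  proof
    fix p assume p: "p \<in> open_face E e"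
    have "p \<in> interior (?K \<union> ?K')" by (rule open_face_covered[OF cE e disj p])
    moreover have "p \<notin> e1" if "e1 \<in> faces E - {e}" for e1 using A.open_face_disjoint[OF e(1), of e1] that p by blast
    moreover have "p \<notin> e1" if "e1 \<in> faces E' - {e}" for e1 using B.open_face_disjoint[OF e(2), of e1] that p oeq by blast
    ultimately show "p \<in> N" unfolding N_def by blast
  qed
  have smooth: "?A w = - ?B w"
    if w: "dir_C1 \<omega> w dw" and C: "compact C" "C \<subseteq> N" "\<And>x. x \<notin> C \<Longrightarrow> w x = 0" for w dw C
  proof -
    have dw0: "dw x = 0" if "x \<notin> C" for x by (rule dir_C1_zero_outside[OF w C(1,3) that])
    have cdw: "continuous_on UNIV dw" using w by (simp add: dir_C1_def)
    have zero: "(LINT x:open_face D e1|face_measure D e1. w x * (\<omega> \<bullet> \<nu> x)) = 0"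
      if "open_face D e1 \<subseteq> e1" "e1 \<inter> N = {}" for D e1 \<nu>
    proof -
      have "(\<lambda>x. indicator (open_face D e1) x *\<^sub>R (w x * (\<omega> \<bullet> \<nu> x))) = (\<lambda>x. 0)"
        using that C(2,3) by (fastforce simp: indicator_def fun_eq_iff)
      then show ?thesis by (simp add: set_lebesgue_integral_def)
    qed
    have sA: "(LINT x:interior ?K|lebesgue. dw x) = ?A w"
    proof -
      have "(\<Sum>e\<in>faces E. LINT x:open_face E e|face_measure E e. w x * (\<omega> \<bullet> outward_normal ?K x)) =
        ?A w + (\<Sum>e\<in>faces E - {e}. LINT x:open_face E e|face_measure E e. w x * (\<omega> \<bullet> outward_normal ?K x))"
        by (rule sum.remove[OF A.finite_faces e(1)])
      also have "(\<Sum>e\<in>faces E - {e}. LINT x:open_face E e|face_measure E e. w x * (\<omega> \<bullet> outward_normal ?K x)) = 0"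
      proof (rule sum.neutral, rule ballI)
        fix e1 assume e1: "e1 \<in> faces E - {e}"
        show "(LINT x:open_face E e1|face_measure E e1. w x * (\<omega> \<bullet> outward_normal ?K x)) = 0"
          by (rule zero) (use e1 A.bounded_on_open_face(3)[OF continuous_on_const] in \<open>auto simp: N_def\<close>)
      qed
      finally show ?thesis using A.green_dir_C1(1)[OF n(1) w] by simp
    qed
    have sB: "(LINT x:interior ?K'|lebesgue. dw x) = ?B w"
    proof -
      have "(\<Sum>e\<in>faces E'. LINT x:open_face E' e|face_measure E' e. w x * (\<omega> \<bullet> outward_normal ?K' x)) =
        ?B w + (\<Sum>e\<in>faces E' - {e}. LINT x:open_face E' e|face_measure E' e. w x * (\<omega> \<bullet> outward_normal ?K' x))"
        by (rule sum.remove[OF B.finite_faces e(2)])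
      also have "(\<Sum>e\<in>faces E' - {e}. LINT x:open_face E' e|face_measure E' e. w x * (\<omega> \<bullet> outward_normal ?K' x)) = 0"
      proof (rule sum.neutral, rule ballI)
        fix e1 assume e1: "e1 \<in> faces E' - {e}"
        show "(LINT x:open_face E' e1|face_measure E' e1. w x * (\<omega> \<bullet> outward_normal ?K' x)) = 0"
          by (rule zero) (use e1 B.bounded_on_open_face(3)[OF continuous_on_const] in \<open>auto simp: N_def\<close>)
      qed
      finally show ?thesis using B.green_dir_C1(1)[OF n(2) w] by simp
    qed
    have dwm: "dw \<in> borel_measurable borel" by (rule borel_measurable_continuous_onI[OF cdw])
    let ?V = "interior ?K \<union> interior ?K'"
    have "(LINT x:?V|lebesgue. dw x) = (LINT x:interior ?K|lebesgue. dw x) + (LINT x:interior ?K'|lebesgue. dw x)"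
      by (rule set_integral_Un[OF disj A.green_dir_C1(2)[OF n(1) w] B.green_dir_C1(2)[OF n(2) w]])
    moreover have "(LINT x:?V|lebesgue. dw x) = (LINT x|lebesgue. dw x)"
      unfolding set_lebesgue_integral_def
    proof (rule integral_cong_AE)
      show "dw \<in> borel_measurable lebesgue" using dwm by (simp add: measurable_completion)
      show "(\<lambda>x. indicator ?V x *\<^sub>R dw x) \<in> borel_measurable lebesgue"
        using dwm by (intro measurable_completion borel_measurable_scaleR borel_measurable_indicator) auto
      \<comment> \<open>The element boundaries are null sets, so the two interiors carry the whole
        integral of \<open>dw\<close>.\<close>
      have "negligible ((?K - interior ?K) \<union> (?K' - interior ?K'))"
        by (rule negligible_Un[OF A.negligible_boundary_K B.negligible_boundary_K])
      then have "AE x in lebesgue. x \<notin> (?K - interior ?K) \<union> (?K' - interior ?K')"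
        by (intro AE_not_in) (simp add: negligible_iff_null_sets)
      then show "AE x in lebesgue. indicator ?V x *\<^sub>R dw x = dw x"
      proof eventually_elim
        case (elim x)
        then show ?case using dw0[of x] C(2) NK by (cases "x \<in> C") (auto simp: indicator_def)
      qed
    qed
    moreover have "(LINT x|lebesgue. dw x) = 0"
      using dir_C1_integral_zero[OF w C(1,3) dw0] dwm by (simp add: integral_completion)
    ultimately show ?thesis using sA sB by simp
  qed
  have bq: "bounded (q ` e)" by (intro compact_imp_bounded compact_continuous_image q A.compact_face e)
  then obtain M where M: "M > 0" "\<And>x. x \<in> e \<Longrightarrow> \<bar>q x\<bar> \<le> M" by (auto simp: bounded_pos)
  \<comment> \<open>\<open>q\<close> is given on the face only; it is approximated there by
    functions whose derivative can be integrated over the volume.\<close>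
  obtain w dw where w: "\<And>k::nat. dir_C1 \<omega> (w k) (dw k)"
    "\<And>k. \<exists>C. compact C \<and> C \<subseteq> N \<and> (\<forall>x. x \<notin> C \<longrightarrow> w k x = 0)" "\<And>k x. \<bar>w k x\<bar> \<le> M"
    "\<And>x. x \<in> e \<inter> N \<Longrightarrow> (\<lambda>k. w k x) \<longlonglongrightarrow> q x"
    using smooth_approximation[OF oN bN q A.compact_face[OF e(1)] M(2), of \<omega>] M(1) by (metis less_imp_le)
  have eq: "?A (w k) = - ?B (w k)" for k using smooth[OF w(1)] w(2)[of k] by blast
  have oe: "open_face E e \<subseteq> e" by (rule A.bounded_on_open_face(3)[OF continuous_on_const e(1)])
  have cw: "continuous_on S (w k)" for S k
    using w(1)[of k] by (auto simp: dir_C1_def intro: continuous_on_subset)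
  have cq: "continuous_on (open_face E e) q" by (rule continuous_on_subset[OF q oe])
  have lim: "(\<lambda>k. w k x) \<longlonglongrightarrow> q x" if "x \<in> open_face E e" for x using w(4) that oe eN by blast
  have lA: "(\<lambda>k. ?A (w k)) \<longlonglongrightarrow> ?A q"
    by (rule A.face_flux_tendsto[OF e(1) n(1)[OF e(1)] \<omega> cw w(3) cq lim])
  have lB: "(\<lambda>k. ?B (w k)) \<longlonglongrightarrow> ?B q"
    by (rule B.face_flux_tendsto[OF e(2) n(2)[OF e(2)] \<omega> cw w(3)]) (use cq lim oeq in auto)
  have "(\<lambda>k. ?A (w k)) \<longlonglongrightarrow> - ?B q" unfolding eq by (rule tendsto_minus[OF lB])
  then show ?thesis using lA LIMSEQ_unique by blast
qed

section \<open>The surface terms of the scheme\<close>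

lemma set_integral_cong_on:
  fixes f g :: "'a \<Rightarrow> real"
  assumes "\<And>x. x \<in> A \<Longrightarrow> f x = g x"
  shows "(LINT x:A|M. f x) = (LINT x:A|M. g x)"
  unfolding set_lebesgue_integral_def
  by (intro Bochner_Integration.integral_cong) (auto simp: indicator_def assms)

lemma set_integral_nonneg_on:
  fixes f :: "'a \<Rightarrow> real"
  assumes "\<And>x. x \<in> A \<Longrightarrow> 0 \<le> f x"
  shows "0 \<le> (LINT x:A|M. f x)"
  unfolding set_lebesgue_integral_def
  by (intro Bochner_Integration.integral_nonneg) (auto simp: indicator_def assms)

lemma restr_props:
  assumes "v \<in> broken_space X T" "E \<in> T"
  shows "continuous_on (body E) (restr E v)" "AE x in lebesgue_on (body E). v x = restr E v x"
    "H1_on (interior (body E)) v"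
proof -
  have "\<exists>c. continuous_on (body E) c \<and> (AE x in lebesgue_on (body E). v x = c x)"
    and h: "H1_on (interior (body E)) v" using assms by (auto simp: broken_space_def)
  from someI_ex[OF this(1)]
  show "continuous_on (body E) (restr E v)" "AE x in lebesgue_on (body E). v x = restr E v x"
    unfolding restr_def by blast+
  show "H1_on (interior (body E)) v" by (rule h)
qed

lemma face_orientation_normals:
  "incoming_face \<omega> E e \<Longrightarrow> has_normals E e" "outgoing_face \<omega> E e \<Longrightarrow> has_normals E e"
  unfolding incoming_face_def outgoing_face_def has_normals_def inflow_boundary_def outflow_boundary_def
  by blast+

context curved_element
begin

lemma outward_normal_eqI:
  assumes "e \<in> faces E" "x \<in> open_face E e" "is_outward_normal K x \<nu>"
  shows "outward_normal K x = \<nu>"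
proof -
  obtain f where f: "f facet_of P" "e = F ` f" using assms(1) by (auto simp: faces_eq)
  then obtain y where y: "y \<in> rel_interior f" "x = F y" using assms(2) open_face_image[OF f(1)] by auto
  show ?thesis using outward_normal_eq[OF f(1) y(1)] normal_unique[OF f(1) y(1)] assms(3) y(2) by simp
qed

lemma incoming_normal:
  assumes "e \<in> faces E" "incoming_face \<omega> E e" "x \<in> open_face E e"
  shows "is_outward_normal K x (outward_normal K x)" "\<omega> \<bullet> outward_normal K x < 0"
proof -
  obtain \<nu> where \<nu>: "is_outward_normal K x \<nu>" "\<omega> \<bullet> \<nu> < 0"
    using assms(2,3) by (auto simp: incoming_face_def inflow_boundary_def)
  then show "is_outward_normal K x (outward_normal K x)" "\<omega> \<bullet> outward_normal K x < 0"
    using outward_normal_eqI[OF assms(1,3) \<nu>(1)] by simp_all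
qed

lemma outgoing_normal:
  assumes "e \<in> faces E" "outgoing_face \<omega> E e" "x \<in> open_face E e"
  shows "is_outward_normal K x (outward_normal K x)" "\<omega> \<bullet> outward_normal K x \<ge> 0"
proof -
  obtain \<nu> where \<nu>: "is_outward_normal K x \<nu>" "\<omega> \<bullet> \<nu> \<ge> 0"
    using assms(2,3) by (auto simp: outgoing_face_def outflow_boundary_def)
  then show "is_outward_normal K x (outward_normal K x)" "\<omega> \<bullet> outward_normal K x \<ge> 0"
    using outward_normal_eqI[OF assms(1,3) \<nu>(1)] by simp_all
qed

lemma open_face_ne:
  assumes "e \<in> faces E"
  shows "open_face E e \<noteq> {}"
proof -
  obtain f where f: "f facet_of P" "e = F ` f" using assms by (auto simp: faces_eq)
  have "convex f" using f poly by (auto intro: face_of_imp_convex facet_of_imp_face_of)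
  then have "rel_interior f \<noteq> {}" using facet_ne[OF f(1)] by (simp add: rel_interior_eq_empty)
  then show ?thesis using open_face_image[OF f(1)] f(2) by simp
qed

text \<open>Carries information from the open face, where normals are known, to the closed one: an
  outflow face of \<open>X\<close> turns out to lie in the frontier of \<open>X\<close>.\<close>

lemma face_subset_closure:
  assumes "e \<in> faces E"
  shows "e \<subseteq> closure (open_face E e)"
proof -
  obtain f where f: "f facet_of P" "e = F ` f" using assms by (auto simp: faces_eq)
  have "convex f" "closed f"
    using f poly compact_facet[OF f(1)] by (auto intro: face_of_imp_convex facet_of_imp_face_of compact_imp_closed)
  then have cl: "closure (rel_interior f) = f" by (simp add: convex_closure_rel_interior closure_closed)
  have "F ` closure (rel_interior f) \<subseteq> closure (F ` rel_interior f)"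
    by (rule image_closure_subset)
      (auto simp: cl intro: continuous_on_subset[OF continuous_F facet_subset_U(1)[OF f(1)]] subsetD[OF closure_subset])
  then show ?thesis using open_face_image[OF f(1)] f(2) cl by simp
qed

lemma not_incoming_and_outgoing:
  assumes "e \<in> faces E" "incoming_face \<omega> E e" "outgoing_face \<omega> E e"
  shows False
  using open_face_ne[OF assms(1)] incoming_normal(2)[OF assms(1,2)] outgoing_normal(2)[OF assms(1,3)] by force

text \<open>With \<open>c'\<close> the upwind trace: \<open>(c - c') c = (c - c')^2 / 2 + c^2 / 2 - c'^2 / 2\<close>.\<close>

lemma jump_identity:
  assumes e: "e \<in> faces E" "incoming_face \<omega> E e" and \<omega>: "norm \<omega> \<le> 1"
    and c: "continuous_on K c" and c': "continuous_on e c'"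
  shows "face_inner E e (\<lambda>x. c x - c' x) (\<lambda>x. c x * \<bar>\<omega> \<bullet> outward_normal K x\<bar>) =
    1/2 * face_inner E e (\<lambda>x. c x - c' x) (\<lambda>x. (c x - c' x) * \<bar>\<omega> \<bullet> outward_normal K x\<bar>)
    - 1/2 * (LINT x:open_face E e|face_measure E e. (c x)\<^sup>2 * (\<omega> \<bullet> outward_normal K x))
    + 1/2 * (LINT x:open_face E e|face_measure E e. (c' x)\<^sup>2 * (\<omega> \<bullet> outward_normal K x))"
proof -
  let ?S = "open_face E e" and ?M = "face_measure E e"
  have n: "has_normals E e" using e(2) by (rule face_orientation_normals)
  have Se: "?S \<subseteq> e" and eK: "e \<subseteq> K" by (rule bounded_on_open_face(3,4)[OF c e(1)])+
  have ce: "continuous_on e c" by (rule continuous_on_subset[OF c eK])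
  have int: "set_integrable ?M ?S (\<lambda>x. q x * (\<omega> \<bullet> outward_normal K x))" if q: "continuous_on e q" for q
  proof -
    have "bounded (q ` e)" by (intro compact_imp_bounded compact_continuous_image q compact_face e)
    then have "bounded (q ` ?S)" by (rule bounded_subset) (use Se in blast)
    from face_normal_integrable[OF e(1) n continuous_on_subset[OF q Se] this continuous_on_id \<omega>]
    show ?thesis .
  qed
  let ?I = "\<lambda>q. LINT x:?S|?M. q x * (\<omega> \<bullet> outward_normal K x)"
  have abs: "\<bar>\<omega> \<bullet> outward_normal K x\<bar> = - (\<omega> \<bullet> outward_normal K x)" if "x \<in> ?S" for x
    using incoming_normal(2)[OF e that] by simp
  have i: "set_integrable ?M ?S (\<lambda>x. (c x)\<^sup>2 * (\<omega> \<bullet> outward_normal K x))"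
    "set_integrable ?M ?S (\<lambda>x. (c' x)\<^sup>2 * (\<omega> \<bullet> outward_normal K x))"
    "set_integrable ?M ?S (\<lambda>x. (c x * c' x) * (\<omega> \<bullet> outward_normal K x))"
    by (intro int continuous_intros ce c')+
  have "face_inner E e (\<lambda>x. c x - c' x) (\<lambda>x. c x * \<bar>\<omega> \<bullet> outward_normal K x\<bar>) =
      (LINT x:?S|?M. (c x * c' x) * (\<omega> \<bullet> outward_normal K x) - (c x)\<^sup>2 * (\<omega> \<bullet> outward_normal K x))"
    unfolding face_inner_def
    by (rule set_integral_cong_on) (simp add: abs power2_eq_square algebra_simps)
  also have "\<dots> = ?I (\<lambda>x. c x * c' x) - ?I (\<lambda>x. (c x)\<^sup>2)" by (rule set_integral_diff(2)[OF i(3,1)])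
  finally have 1: "face_inner E e (\<lambda>x. c x - c' x) (\<lambda>x. c x * \<bar>\<omega> \<bullet> outward_normal K x\<bar>) =
    ?I (\<lambda>x. c x * c' x) - ?I (\<lambda>x. (c x)\<^sup>2)" .
  have "face_inner E e (\<lambda>x. c x - c' x) (\<lambda>x. (c x - c' x) * \<bar>\<omega> \<bullet> outward_normal K x\<bar>) =
      (LINT x:?S|?M. ((c x * c' x) * (\<omega> \<bullet> outward_normal K x) - (c x)\<^sup>2 * (\<omega> \<bullet> outward_normal K x))
         + ((c x * c' x) * (\<omega> \<bullet> outward_normal K x) - (c' x)\<^sup>2 * (\<omega> \<bullet> outward_normal K x)))"
    unfolding face_inner_def
    by (rule set_integral_cong_on) (simp add: abs power2_eq_square algebra_simps)
  also have "\<dots> = (?I (\<lambda>x. c x * c' x) - ?I (\<lambda>x. (c x)\<^sup>2)) + (?I (\<lambda>x. c x * c' x) - ?I (\<lambda>x. (c' x)\<^sup>2))"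
    by (simp only: set_integral_add(2) set_integral_diff i)
  finally show ?thesis unfolding 1 by linarith
qed

end

lemma fe_partition_element:
  assumes "fe_partition X T" "E \<in> T"
  obtains U where "curved_element E U"
proof -
  have "is_element E" using assms by (simp add: fe_partition_def)
  then show ?thesis using is_element_curved that by blast
qed

text \<open>Unique existence applies from either side of the face, so passing to the neighbour is an
  involution. This will make the pairing of fluxes injective.\<close>

lemma neighbour_props:
  assumes T: "fe_partition X T" and E: "E \<in> T" "e \<in> faces E" "\<not> e \<subseteq> frontier X"
  shows "neighbour T E e \<in> T" "neighbour T E e \<noteq> E" "e \<in> faces (neighbour T E e)"
    "neighbour T (neighbour T E e) e = E"
proof -
  have ex: "\<exists>!E'. E' \<in> T \<and> E' \<noteq> D \<and> e \<in> faces E'" if "D \<in> T" "e \<in> faces D" for D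
  proof -
    have "\<forall>E\<in>T. \<forall>e\<in>faces E. e \<subseteq> frontier X \<or> (\<exists>!E'. E' \<in> T \<and> E' \<noteq> E \<and> e \<in> faces E')"
      using T unfolding fe_partition_def by (elim conjE)
    from bspec[OF bspec[OF this that(1)] that(2)] show ?thesis
      by (rule disjE) (simp add: E(3))
  qed
  have nb: "neighbour T D e \<in> T \<and> neighbour T D e \<noteq> D \<and> e \<in> faces (neighbour T D e)" if "D \<in> T" "e \<in> faces D" for D
    unfolding neighbour_def by (rule theI'[OF ex[OF that]])
  show *: "neighbour T E e \<in> T" "neighbour T E e \<noteq> E" "e \<in> faces (neighbour T E e)" using nb[OF E(1,2)] by auto
  show "neighbour T (neighbour T E e) e = E"
    using ex[OF *(1,3)] nb[OF *(1,3)] *(2) E(1,2) by metis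
qed

text \<open>Twice the volume term is the sum of inflow and outflow fluxes of \<open>v^2\<close> over
  all pairs of an element and a face. The jump identity cancels the inflow part and introduces
  fluxes of upwind traces, which are outflow fluxes of neighbours. These are distinct terms of the
  nonnegative outflow sum, whose remainder still contains the outflow through the boundary of
  \<open>X\<close>.\<close>

lemma surface_estimate:
  fixes X :: "(real^'n::{finite,wellorder}) set" and \<omega> :: "real^'n::_"
  assumes T: "fe_partition X T" and v: "v \<in> broken_space X T" and \<omega>: "norm \<omega> \<le> 1"
    and ori: "\<And>E e. E \<in> T \<Longrightarrow> e \<in> faces E \<Longrightarrow> incoming_face \<omega> E e \<or> outgoing_face \<omega> E e"
  defines "B \<equiv> \<Sum>E\<in>T. \<Sum>e | e \<in> faces E \<and> outgoing_face \<omega> E e \<and> open_face E e \<subseteq> outflow_boundary \<omega> X.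
      face_inner E e (restr E v) (\<lambda>x. restr E v x * (\<omega> \<bullet> outward_normal (body E) x))"
    and "Jmp \<equiv> \<Sum>E\<in>T. \<Sum>e | e \<in> faces E \<and> incoming_face \<omega> E e.
      face_inner E e (jump X T E e v) (\<lambda>x. jump X T E e v x * \<bar>\<omega> \<bullet> outward_normal (body E) x\<bar>)"
  shows "1/2 * (B + Jmp) \<le> (\<Sum>E\<in>T. LINT x:interior (body E)|lebesgue. v x * dir_deriv \<omega> E v x)
      + (\<Sum>E\<in>T. \<Sum>e | e \<in> faces E \<and> incoming_face \<omega> E e.
          face_inner E e (jump X T E e v) (\<lambda>x. restr E v x * \<bar>\<omega> \<bullet> outward_normal (body E) x\<bar>))"
    and "0 \<le> B" "0 \<le> Jmp"
proof -
  have finT: "finite T" using T by (simp add: fe_partition_def)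
  have normals: "has_normals E e" if "E \<in> T" "e \<in> faces E" for E e
    using ori[OF that] face_orientation_normals by blast
  have finF: "finite (faces E)" if E: "E \<in> T" for E
  proof -
    obtain U where "curved_element E U" by (rule fe_partition_element[OF T E])
    then interpret curved_element E U .
    show ?thesis by (rule finite_faces)
  qed
  \<comment> \<open>Flux of \<open>v^2\<close> through one side of a face, with the trace from that
    side: nonpositive on incoming and nonnegative on outgoing faces.\<close>
  define \<phi> where "\<phi> = (\<lambda>(E, e). LINT x:open_face E e|face_measure E e. (restr E v x)\<^sup>2 * (\<omega> \<bullet> outward_normal (body E) x))"
  define Inc where "Inc = (SIGMA E:T. {e. e \<in> faces E \<and> incoming_face \<omega> E e})"
  define Out where "Out = (SIGMA E:T. {e. e \<in> faces E \<and> outgoing_face \<omega> E e})"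
  define OutX where "OutX = (SIGMA E:T. {e. e \<in> faces E \<and> outgoing_face \<omega> E e \<and> open_face E e \<subseteq> outflow_boundary \<omega> X})"
  define int where "int = (\<lambda>(E :: (real^'n::_) element, e). \<not> e \<subseteq> frontier X)"
  define nb where "nb = (\<lambda>(E, e). (neighbour T E e, e))"
  have fin: "finite Inc" "finite Out" "finite OutX"
    unfolding Inc_def Out_def OutX_def using finT finF by (auto intro!: finite_SigmaI)
  have green: "2 * (LINT x:interior (body E)|lebesgue. v x * dir_deriv \<omega> E v x) = (\<Sum>e\<in>faces E. \<phi> (E, e))" if E: "E \<in> T" for E
  proof -
    obtain U where "curved_element E U" by (rule fe_partition_element[OF T E])
    then interpret curved_element E U .
    note r = restr_props[OF v E]
    have g: "(LINT x:interior K|lebesgue. 2 * restr E v x * dir_deriv \<omega> E v x) = (\<Sum>e\<in>faces E. \<phi> (E, e))"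
      "L2_on (interior K) (dir_deriv \<omega> E v)" "L2_on (interior K) (restr E v)"
      unfolding \<phi>_def prod.case
      by (rule green_square(1)[OF normals[OF E] r(1,2,3)], assumption,
          rule green_square(2)[OF normals[OF E] r(1,2,3)], assumption,
          rule green_square(3)[OF normals[OF E] r(1,2,3)], assumption)
    have ae: "AE x in lebesgue. x \<in> interior K \<longrightarrow> v x = restr E v x"
    proof -
      have "AE x in lebesgue. x \<in> K \<longrightarrow> v x = restr E v x"
        using r(2) compact_K by (subst (asm) AE_restrict_space_iff) (auto simp: compact_imp_closed)
      then show ?thesis by eventually_elim (use interior_subset in blast)
    qed
    have vL: "L2_on (interior K) v" using r(3) by (simp add: H1_on_def)
    have "2 * (LINT x:interior K|lebesgue. v x * dir_deriv \<omega> E v x) = (LINT x:interior K|lebesgue. 2 * (v x * dir_deriv \<omega> E v x))"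
      by simp
    also have "\<dots> = (LINT x:interior K|lebesgue. 2 * (restr E v x * dir_deriv \<omega> E v x))"
      unfolding set_lebesgue_integral_def
    proof (rule integral_cong_AE)
      have i: "integrable (lebesgue_on (interior K)) (\<lambda>x. 2 * (u x * dir_deriv \<omega> E v x))" if "L2_on (interior K) u" for u
        using L2_on_integrable[OF that g(2)] by simp
      show "(\<lambda>x. indicator (interior K) x *\<^sub>R (2 * (v x * dir_deriv \<omega> E v x))) \<in> borel_measurable lebesgue"
        using i[OF vL] by (subst (asm) integrable_restrict_space) (auto dest: borel_measurable_integrable)
      show "(\<lambda>x. indicator (interior K) x *\<^sub>R (2 * (restr E v x * dir_deriv \<omega> E v x))) \<in> borel_measurable lebesgue"
        using i[OF g(3)] by (subst (asm) integrable_restrict_space) (auto dest: borel_measurable_integrable)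
      show "AE x in lebesgue. indicator (interior K) x *\<^sub>R (2 * (v x * dir_deriv \<omega> E v x)) =
          indicator (interior K) x *\<^sub>R (2 * (restr E v x * dir_deriv \<omega> E v x))"
        using ae by eventually_elim (simp add: indicator_def)
    qed
    also have "\<dots> = (\<Sum>e\<in>faces E. \<phi> (E, e))" using g(1) by (simp add: mult.assoc)
    finally show ?thesis .
  qed
  have split: "(\<Sum>e\<in>faces E. \<phi> (E, e)) = (\<Sum>e | e \<in> faces E \<and> incoming_face \<omega> E e. \<phi> (E, e))
      + (\<Sum>e | e \<in> faces E \<and> outgoing_face \<omega> E e. \<phi> (E, e))" if E: "E \<in> T" for E
  proof -
    obtain U where "curved_element E U" by (rule fe_partition_element[OF T E])
    then interpret curved_element E U .
    have "faces E = {e. e \<in> faces E \<and> incoming_face \<omega> E e} \<union> {e. e \<in> faces E \<and> outgoing_face \<omega> E e}"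
      using ori[OF E] by blast
    moreover have "{e. e \<in> faces E \<and> incoming_face \<omega> E e} \<inter> {e. e \<in> faces E \<and> outgoing_face \<omega> E e} = {}"
      using not_incoming_and_outgoing by blast
    ultimately show ?thesis
      using finF[OF E] sum.union_disjoint[of "{e. e \<in> faces E \<and> incoming_face \<omega> E e}"
          "{e. e \<in> faces E \<and> outgoing_face \<omega> E e}" "\<lambda>e. \<phi> (E, e)"] by simp
  qed
  have vol: "2 * (\<Sum>E\<in>T. LINT x:interior (body E)|lebesgue. v x * dir_deriv \<omega> E v x) = sum \<phi> Inc + sum \<phi> Out"
  proof -
    have "2 * (\<Sum>E\<in>T. LINT x:interior (body E)|lebesgue. v x * dir_deriv \<omega> E v x) =
      (\<Sum>E\<in>T. (\<Sum>e | e \<in> faces E \<and> incoming_face \<omega> E e. \<phi> (E, e)) + (\<Sum>e | e \<in> faces E \<and> outgoing_face \<omega> E e. \<phi> (E, e)))"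
      unfolding sum_distrib_left by (rule sum.cong[OF refl]) (simp only: green split)
    also have "\<dots> = sum \<phi> Inc + sum \<phi> Out"
      unfolding Inc_def Out_def sum.distrib using finT finF by (subst (1 2) sum.Sigma) auto
    finally show ?thesis .
  qed
  have out_nonneg: "\<phi> p \<ge> 0" if p: "p \<in> Out" for p
  proof -
    obtain E e where Ee: "p = (E, e)" "E \<in> T" "e \<in> faces E" "outgoing_face \<omega> E e" using p by (auto simp: Out_def)
    obtain U where "curved_element E U" by (rule fe_partition_element[OF T Ee(2)])
    then interpret curved_element E U .
    show ?thesis unfolding Ee(1) \<phi>_def prod.case
      by (intro set_integral_nonneg_on mult_nonneg_nonneg outgoing_normal(2)[OF Ee(3,4)]) auto
  qed
  have B_eq: "B = sum \<phi> OutX"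
  proof -
    have "B = (\<Sum>E\<in>T. \<Sum>e | e \<in> faces E \<and> outgoing_face \<omega> E e \<and> open_face E e \<subseteq> outflow_boundary \<omega> X. \<phi> (E, e))"
      unfolding B_def by (intro sum.cong refl) (simp add: \<phi>_def face_inner_def power2_eq_square mult.assoc)
    then show ?thesis unfolding OutX_def using finT finF by (subst (asm) sum.Sigma) auto
  qed
  \<comment> \<open>The frontier of \<open>X\<close> is closed, so with the open face it contains
    the whole face, which therefore counts as a boundary face.\<close>
  have OutX: "OutX \<subseteq> {p \<in> Out. \<not> int p}"
  proof
    fix p assume "p \<in> OutX"
    then obtain E e where Ee: "p = (E, e)" "E \<in> T" "e \<in> faces E" "outgoing_face \<omega> E e" "open_face E e \<subseteq> outflow_boundary \<omega> X"
      by (auto simp: OutX_def)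
    obtain U where "curved_element E U" by (rule fe_partition_element[OF T Ee(2)])
    then interpret curved_element E U .
    have "open_face E e \<subseteq> frontier X" using Ee(5) by (auto simp: outflow_boundary_def)
    then have "closure (open_face E e) \<subseteq> frontier X" by (rule closure_minimal) simp
    then have "e \<subseteq> frontier X" using face_subset_closure[OF Ee(3)] by blast
    then show "p \<in> {p \<in> Out. \<not> int p}" using Ee by (simp add: Out_def int_def)
  qed
  show "0 \<le> B" unfolding B_eq using OutX out_nonneg by (intro sum_nonneg) blast
  show "0 \<le> Jmp"
    unfolding Jmp_def face_inner_def
    by (intro sum_nonneg set_integral_nonneg_on) (simp add: mult.assoc[symmetric])
  have nbr: "nb p \<in> Out \<and> int (nb p) \<and>
      \<phi> (nb p) = - (LINT x:open_face E e|face_measure E e. (restr (neighbour T E e) v x)\<^sup>2 * (\<omega> \<bullet> outward_normal (body E) x))"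
    if p: "p = (E, e)" "p \<in> Inc" "int p" for p E e
  proof -
    have Ee: "E \<in> T" "e \<in> faces E" "incoming_face \<omega> E e" "\<not> e \<subseteq> frontier X" using p by (auto simp: Inc_def int_def)
    let ?E' = "neighbour T E e"
    note nbp = neighbour_props[OF T Ee(1,2,4)]
    obtain U where cE: "curved_element E U" by (rule fe_partition_element[OF T Ee(1)])
    obtain U' where cE': "curved_element ?E' U'" by (rule fe_partition_element[OF T nbp(1)])
    interpret A: curved_element E U by (rule cE)
    interpret B: curved_element ?E' U' by (rule cE')
    have disj: "interior (body E) \<inter> interior (body ?E') = {}"
      using T Ee(1) nbp(1,2) unfolding fe_partition_def by metis
    \<comment> \<open>If both sides were incoming, two opposite normals would both have a negative
      product with \<omega>.\<close>
    have out: "outgoing_face \<omega> ?E' e"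
    proof (rule ccontr)
      assume "\<not> outgoing_face \<omega> ?E' e"
      then have inc: "incoming_face \<omega> ?E' e" using ori[OF nbp(1,3)] by blast
      obtain x where x: "x \<in> open_face E e" using A.open_face_ne[OF Ee(2)] by blast
      then have x': "x \<in> open_face ?E' e" using open_faces_subset[OF cE cE' Ee(2) nbp(3)] by blast
      have "outward_normal (body ?E') x = - outward_normal (body E) x"
        by (rule outward_normals_opposite[OF A.incoming_normal(1)[OF Ee(2,3) x] B.incoming_normal(1)[OF nbp(3) inc x'] disj])
      then show False using A.incoming_normal(2)[OF Ee(2,3) x] B.incoming_normal(2)[OF nbp(3) inc x'] by simp
    qed
    have "continuous_on e (\<lambda>x. (restr ?E' v x)\<^sup>2)"
      using restr_props(1)[OF v nbp(1)] B.bounded_on_open_face(4)[OF continuous_on_const nbp(3)]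
      by (auto intro!: continuous_intros intro: continuous_on_subset)
    from face_flux_match[OF cE cE' Ee(2) nbp(3) disj normals[OF Ee(1)] normals[OF nbp(1)] this \<omega>] out
    show ?thesis using nbp Ee by (simp add: nb_def p(1) Out_def int_def \<phi>_def)
  qed
  have inj: "inj_on nb {p \<in> Inc. int p}"
  proof (rule inj_onI)
    fix p q assume pq: "p \<in> {p \<in> Inc. int p}" "q \<in> {p \<in> Inc. int p}" "nb p = nb q"
    obtain E e E1 e1 where E: "p = (E, e)" "q = (E1, e1)" by (meson surj_pair)
    have "e1 = e" "neighbour T E e = neighbour T E1 e" using pq(3) by (auto simp: nb_def E)
    moreover have "neighbour T (neighbour T E e) e = E" "neighbour T (neighbour T E1 e1) e1 = E1"
      using pq(1,2) by (auto simp: E Inc_def int_def intro!: neighbour_props(4)[OF T])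
    ultimately show "p = q" using E by metis
  qed
  have "sum \<phi> Out = sum \<phi> {p \<in> Out. int p} + sum \<phi> {p \<in> Out. \<not> int p}"
    using fin(2) by (subst sum.union_disjoint[symmetric]) (auto intro!: sum.cong)
  moreover have "sum \<phi> {p \<in> Out. \<not> int p} \<ge> B"
    unfolding B_eq using fin(2) out_nonneg by (intro sum_mono2 OutX) auto
  \<comment> \<open>An inequality is enough: outgoing interior faces that are not paired with an
    incoming one, such as faces parallel to \<omega>, have nonnegative flux.\<close>
  moreover have "sum \<phi> {p \<in> Out. int p} \<ge> (\<Sum>p\<in>{p \<in> Inc. int p}. \<phi> (nb p))"
  proof -
    have "(\<Sum>p\<in>{p \<in> Inc. int p}. \<phi> (nb p)) = sum \<phi> (nb ` {p \<in> Inc. int p})"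
      by (simp add: sum.reindex[OF inj])
    also have "\<dots> \<le> sum \<phi> {p \<in> Out. int p}"
      using fin(2) out_nonneg nbr by (intro sum_mono2) (auto simp: split_paired_all)
    finally show ?thesis .
  qed
  ultimately have outB: "sum \<phi> Out \<ge> B + (\<Sum>p\<in>{p \<in> Inc. int p}. \<phi> (nb p))" by linarith
  define jj where "jj = (\<lambda>(E, e). face_inner E e (jump X T E e v) (\<lambda>x. jump X T E e v x * \<bar>\<omega> \<bullet> outward_normal (body E) x\<bar>))"
  define jr where "jr = (\<lambda>(E, e). face_inner E e (jump X T E e v) (\<lambda>x. restr E v x * \<bar>\<omega> \<bullet> outward_normal (body E) x\<bar>))"
  have face: "jr p = 1/2 * jj p - 1/2 * \<phi> p - 1/2 * (if int p then \<phi> (nb p) else 0)" if p: "p \<in> Inc" for p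
  proof -
    obtain E e where Ee: "p = (E, e)" "E \<in> T" "e \<in> faces E" "incoming_face \<omega> E e" using p by (auto simp: Inc_def)
    obtain U where cE: "curved_element E U" by (rule fe_partition_element[OF T Ee(2)])
    interpret A: curved_element E U by (rule cE)
    let ?c' = "\<lambda>x. if e \<subseteq> frontier X then 0 else restr (neighbour T E e) v x"
    have c': "continuous_on e ?c'"
    proof (cases "e \<subseteq> frontier X")
      case False
      note nbp = neighbour_props[OF T Ee(2,3) False]
      obtain U' where "curved_element (neighbour T E e) U'" by (rule fe_partition_element[OF T nbp(1)])
      then interpret B: curved_element "neighbour T E e" U' .
      have "continuous_on e (restr (neighbour T E e) v)"
        by (rule continuous_on_subset[OF restr_props(1)[OF v nbp(1)] B.bounded_on_open_face(4)[OF continuous_on_const nbp(3)]])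
      then show ?thesis using False by simp
    qed simp
    have j: "jump X T E e v = (\<lambda>x. restr E v x - ?c' x)" by (simp add: jump_def fun_eq_iff)
    \<comment> \<open>The upwind value 0 on boundary faces agrees with the 0 in the second
      branch.\<close>
    have "(LINT x:open_face E e|face_measure E e. (?c' x)\<^sup>2 * (\<omega> \<bullet> outward_normal (body E) x)) =
        - (if int p then \<phi> (nb p) else 0)"
      using nbr[OF Ee(1) p] by (auto simp: int_def Ee(1) set_lebesgue_integral_def)
    then show ?thesis
      using A.jump_identity[OF Ee(3,4) \<omega> restr_props(1)[OF v Ee(2)] c']
      by (simp add: jj_def jr_def \<phi>_def Ee(1) j)
  qed
  have JI: "(\<Sum>E\<in>T. \<Sum>e | e \<in> faces E \<and> incoming_face \<omega> E e. h (E, e)) = sum h Inc" for h :: "(real^'n::_) element \<times> (real^'n::_) set \<Rightarrow> real"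
    unfolding Inc_def using finT finF by (subst sum.Sigma) auto
  have J1: "Jmp = sum jj Inc" using JI[of jj] by (simp add: Jmp_def jj_def)
  have J2: "(\<Sum>E\<in>T. \<Sum>e | e \<in> faces E \<and> incoming_face \<omega> E e.
      face_inner E e (jump X T E e v) (\<lambda>x. restr E v x * \<bar>\<omega> \<bullet> outward_normal (body E) x\<bar>)) = sum jr Inc"
    using JI[of jr] by (simp add: jr_def)
  have arith: "1/2 * (b + j) \<le> V + s"
    if "s = 1/2 * j - 1/2 * i - 1/2 * n" "2 * V = i + out" "b + n \<le> out" for b j V s i n out :: real
  proof -
    have "2 * s = j - i - n" using that(1) by simp
    then have "b + j \<le> 2 * (V + s)" using that(2,3) by (simp add: algebra_simps)
    then show ?thesis by simp
  qed
  have "sum jr Inc = 1/2 * Jmp - 1/2 * sum \<phi> Inc - 1/2 * (\<Sum>p\<in>Inc. if int p then \<phi> (nb p) else 0)"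
    using face by (simp add: J1 sum_subtractf sum_distrib_left)
  also have "(\<Sum>p\<in>Inc. if int p then \<phi> (nb p) else 0) = (\<Sum>p\<in>{p \<in> Inc. int p}. \<phi> (nb p))"
    using fin(1) by (simp add: sum.If_cases Int_def)
  finally show "1/2 * (B + Jmp) \<le> (\<Sum>E\<in>T. LINT x:interior (body E)|lebesgue. v x * dir_deriv \<omega> E v x)
      + (\<Sum>E\<in>T. \<Sum>e | e \<in> faces E \<and> incoming_face \<omega> E e.
          face_inner E e (jump X T E e v) (\<lambda>x. restr E v x * \<bar>\<omega> \<bullet> outward_normal (body E) x\<bar>))"
    unfolding J2 by (rule arith[OF _ vol outB])
qed

section \<open>The volume terms of the scheme\<close>

text \<open>Cauchy-Schwarz with each weight split into two square roots.\<close>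

lemma weighted_square_sum_le:
  fixes a v :: "'i \<Rightarrow> real"
  assumes "\<And>i. i \<in> I \<Longrightarrow> a i \<ge> 0"
  shows "(\<Sum>i\<in>I. a i * v i)\<^sup>2 \<le> (\<Sum>i\<in>I. a i) * (\<Sum>i\<in>I. a i * (v i)\<^sup>2)"
proof -
  have "(\<Sum>i\<in>I. a i * v i) = (\<Sum>i\<in>I. sqrt (a i) * (sqrt (a i) * v i))"
    by (rule sum.cong) (use assms in \<open>auto simp: mult.assoc[symmetric]\<close>)
  moreover have "(\<Sum>i\<in>I. (sqrt (a i))\<^sup>2) = (\<Sum>i\<in>I. a i)"
    by (rule sum.cong) (use assms in auto)
  moreover have "(\<Sum>i\<in>I. (sqrt (a i) * v i)\<^sup>2) = (\<Sum>i\<in>I. a i * (v i)\<^sup>2)"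
    by (rule sum.cong) (use assms in \<open>auto simp: power_mult_distrib\<close>)
  ultimately show ?thesis
    using Cauchy_Schwarz_ineq_sum[of "\<lambda>i. sqrt (a i)" "\<lambda>i. sqrt (a i) * v i" I] by simp
qed

text \<open>The integrand at one point, with \<open>t\<close>, \<open>s\<close> and
  \<open>\<gamma> l i\<close> the values of the coefficients and the phase function. With
  \<open>r = t * v - S\<close> the form is \<open>(D + r) * (v + \<delta> * D)\<close>; its mixed
  term \<open>\<delta> * r * D\<close> is absorbed by Young's inequality into half of
  \<open>\<delta> * D^2\<close>.\<close>

lemma discrete_coercivity:
  fixes w v D :: "nat \<Rightarrow> real" and \<gamma> :: "nat \<Rightarrow> nat \<Rightarrow> real"
  assumes w: "\<And>l. l \<le> L \<Longrightarrow> w l > 0" and \<gamma>: "\<And>l i. l \<le> L \<Longrightarrow> i \<le> L \<Longrightarrow> \<gamma> l i \<ge> 0"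
    and sym: "\<And>l i. \<gamma> l i = \<gamma> i l" and s: "s \<ge> 0" and t: "\<bar>t\<bar> \<le> C" and c: "c > 0"
    and m: "\<And>l. l \<le> L \<Longrightarrow> s * (\<Sum>i\<le>L. w i * \<gamma> l i) \<le> t - c" and \<delta>: "\<delta> > 0"
  shows "(\<Sum>l\<le>L. w l * (D l * v l + (c - 2 * \<delta> * C\<^sup>2) * (v l)\<^sup>2 + \<delta> / 2 * (D l)\<^sup>2)) \<le>
    (\<Sum>l\<le>L. w l * ((D l + t * v l) * (v l + \<delta> * D l) - (s * (\<Sum>i\<le>L. w i * \<gamma> l i * v i)) * (v l + \<delta> * D l)))"
proof -
  define S where "S = (\<lambda>l. s * (\<Sum>i\<le>L. w i * \<gamma> l i * v i))"
  define r where "r = (\<lambda>l. t * v l - S l)"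
  define V where "V = (\<Sum>l\<le>L. w l * (v l)\<^sup>2)"
  have tc: "t - c \<le> C" "C \<ge> 0" using t c by auto
  have V0: "V \<ge> 0" unfolding V_def by (rule sum_nonneg) (use w in \<open>simp add: less_imp_le\<close>)
  \<comment> \<open>Symmetry of \<gamma> turns column sums into row sums, to which the assumption on
    \<open>t - c\<close> applies.\<close>
  have swap: "(\<Sum>l\<le>L. w l * (s * (\<Sum>i\<le>L. w i * \<gamma> l i * (v i)\<^sup>2))) = (\<Sum>i\<le>L. w i * (v i)\<^sup>2 * (s * (\<Sum>l\<le>L. w l * \<gamma> i l)))"
  proof -
    have "(\<Sum>l\<le>L. w l * (s * (\<Sum>i\<le>L. w i * \<gamma> l i * (v i)\<^sup>2))) = (\<Sum>l\<le>L. \<Sum>i\<le>L. w l * (s * (w i * \<gamma> l i * (v i)\<^sup>2)))"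
      by (simp add: sum_distrib_left)
    also have "\<dots> = (\<Sum>i\<le>L. \<Sum>l\<le>L. w l * (s * (w i * \<gamma> l i * (v i)\<^sup>2)))" by (rule sum.swap)
    also have "\<dots> = (\<Sum>i\<le>L. w i * (v i)\<^sup>2 * (s * (\<Sum>l\<le>L. w l * \<gamma> i l)))"
      by (intro sum.cong refl) (simp add: sum_distrib_left mult_ac sym)
    finally show ?thesis .
  qed
  have swapb: "(\<Sum>l\<le>L. w l * (s * (\<Sum>i\<le>L. w i * \<gamma> l i * (v i)\<^sup>2))) \<le> (t - c) * V"
  proof -
    have "w i * (v i)\<^sup>2 * (s * (\<Sum>l\<le>L. w l * \<gamma> i l)) \<le> w i * (v i)\<^sup>2 * (t - c)" if "i \<le> L" for i
      using m[OF that] w[OF that] by (intro mult_left_mono) auto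
    then have "(\<Sum>i\<le>L. w i * (v i)\<^sup>2 * (s * (\<Sum>l\<le>L. w l * \<gamma> i l))) \<le> (\<Sum>i\<le>L. w i * (v i)\<^sup>2 * (t - c))"
      by (intro sum_mono) auto
    then show ?thesis unfolding swap V_def by (simp add: sum_distrib_left mult_ac)
  qed
  \<comment> \<open>Young's inequality for \<open>v l * v i\<close> yields two halves, one with row
    sums and one with column sums; each is at most half of \<open>(t - c) * V\<close>.\<close>
  have Sv: "(\<Sum>l\<le>L. w l * (S l * v l)) \<le> (t - c) * V"
  proof -
    have "w l * (S l * v l) \<le> 1/2 * (w l * (v l)\<^sup>2 * (s * (\<Sum>i\<le>L. w i * \<gamma> l i))) + 1/2 * (w l * (s * (\<Sum>i\<le>L. w i * \<gamma> l i * (v i)\<^sup>2)))"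
      if l: "l \<le> L" for l
    proof -
      have "w l * (S l * v l) = (\<Sum>i\<le>L. (w l * s * w i * \<gamma> l i) * (v l * v i))"
        by (simp add: S_def sum_distrib_left sum_distrib_right mult_ac)
      also have "\<dots> \<le> (\<Sum>i\<le>L. (w l * s * w i * \<gamma> l i) * (1/2 * (v l)\<^sup>2 + 1/2 * (v i)\<^sup>2))"
      proof (intro sum_mono mult_left_mono)
        fix i assume "i \<in> {..L}"
        then show "0 \<le> w l * s * w i * \<gamma> l i" using w[OF l] w[of i] \<gamma>[OF l, of i] s by simp
        show "v l * v i \<le> 1/2 * (v l)\<^sup>2 + 1/2 * (v i)\<^sup>2" using sum_squares_bound[of "v l" "v i"] by simp
      qed
      also have "\<dots> = 1/2 * (w l * (v l)\<^sup>2 * (s * (\<Sum>i\<le>L. w i * \<gamma> l i))) + 1/2 * (w l * (s * (\<Sum>i\<le>L. w i * \<gamma> l i * (v i)\<^sup>2)))"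
        by (simp add: sum_distrib_left sum.distrib[symmetric] algebra_simps)
      finally show ?thesis .
    qed
    then have "(\<Sum>l\<le>L. w l * (S l * v l)) \<le> (\<Sum>l\<le>L. 1/2 * (w l * (v l)\<^sup>2 * (s * (\<Sum>i\<le>L. w i * \<gamma> l i))) + 1/2 * (w l * (s * (\<Sum>i\<le>L. w i * \<gamma> l i * (v i)\<^sup>2))))"
      by (intro sum_mono) auto
    also have "\<dots> = 1/2 * (\<Sum>l\<le>L. w l * (v l)\<^sup>2 * (s * (\<Sum>i\<le>L. w i * \<gamma> l i))) + 1/2 * (\<Sum>l\<le>L. w l * (s * (\<Sum>i\<le>L. w i * \<gamma> l i * (v i)\<^sup>2)))"
      unfolding sum.distrib by (simp only: sum_distrib_left)
    finally show ?thesis using swapb unfolding swap by linarith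
  qed
  \<comment> \<open>Cauchy-Schwarz splits off \<open>s\<close> times a row sum, at most
    \<open>t - c \<le> C\<close>; the remaining double sum is at most \<open>(t - c) * V\<close> and
    contributes the second \<open>C\<close>.\<close>
  have S2: "(\<Sum>l\<le>L. w l * (S l)\<^sup>2) \<le> C\<^sup>2 * V"
  proof -
    have "w l * (S l)\<^sup>2 \<le> C * (w l * (s * (\<Sum>i\<le>L. w i * \<gamma> l i * (v i)\<^sup>2)))" if l: "l \<le> L" for l
    proof -
      have a: "w i * \<gamma> l i \<ge> 0" if "i \<in> {..L}" for i using w[of i] \<gamma>[OF l, of i] that by simp
      have q: "(\<Sum>i\<le>L. w i * \<gamma> l i * (v i)\<^sup>2) \<ge> 0" by (rule sum_nonneg) (rule mult_nonneg_nonneg[OF a zero_le_power2])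
      have "(S l)\<^sup>2 = s\<^sup>2 * (\<Sum>i\<le>L. w i * \<gamma> l i * v i)\<^sup>2" by (simp add: S_def power_mult_distrib)
      also have "\<dots> \<le> s\<^sup>2 * ((\<Sum>i\<le>L. w i * \<gamma> l i) * (\<Sum>i\<le>L. w i * \<gamma> l i * (v i)\<^sup>2))"
        by (intro mult_left_mono weighted_square_sum_le a) auto
      also have "\<dots> = (s * (\<Sum>i\<le>L. w i * \<gamma> l i)) * (s * (\<Sum>i\<le>L. w i * \<gamma> l i * (v i)\<^sup>2))"
        by (simp add: power2_eq_square mult_ac)
      also have "\<dots> \<le> C * (s * (\<Sum>i\<le>L. w i * \<gamma> l i * (v i)\<^sup>2))"
        using m[OF l] tc s q by (intro mult_right_mono) auto
      finally have "w l * (S l)\<^sup>2 \<le> w l * (C * (s * (\<Sum>i\<le>L. w i * \<gamma> l i * (v i)\<^sup>2)))"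
        using w[OF l] by (intro mult_left_mono) auto
      then show ?thesis by (simp only: mult.left_commute[of "w l" C])
    qed
    then have "(\<Sum>l\<le>L. w l * (S l)\<^sup>2) \<le> (\<Sum>l\<le>L. C * (w l * (s * (\<Sum>i\<le>L. w i * \<gamma> l i * (v i)\<^sup>2))))"
      by (intro sum_mono) auto
    also have "\<dots> = C * (\<Sum>l\<le>L. w l * (s * (\<Sum>i\<le>L. w i * \<gamma> l i * (v i)\<^sup>2)))" by (simp only: sum_distrib_left)
    also have "\<dots> \<le> C * ((t - c) * V)" by (rule mult_left_mono[OF swapb tc(2)])
    also have "\<dots> \<le> C * (C * V)" by (rule mult_left_mono[OF mult_right_mono[OF tc(1) V0] tc(2)])
    finally show ?thesis by (simp add: power2_eq_square mult_ac)
  qed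
  \<comment> \<open>Half of \<open>r^2 \<le> 2 * t^2 * v^2 + 2 * S^2\<close> costs
    \<open>C^2 * v^2 + S^2\<close>. After summation \<open>S^2\<close> costs another
    \<open>C^2 * v^2\<close>, whence the 2 in \<open>2 * \<delta> * C\<^sup>2\<close>.\<close>
  have pt: "w l * (D l * v l + \<delta> / 2 * (D l)\<^sup>2) + t * (w l * (v l)\<^sup>2) - w l * (S l * v l)
      - \<delta> * C\<^sup>2 * (w l * (v l)\<^sup>2) - \<delta> * (w l * (S l)\<^sup>2)
      \<le> w l * ((D l + t * v l) * (v l + \<delta> * D l) - S l * (v l + \<delta> * D l))" if l: "l \<le> L" for l
  proof -
    have "(D l + r l)\<^sup>2 = (D l)\<^sup>2 + (r l)\<^sup>2 + 2 * (r l * D l)" by (simp add: power2_sum)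
    then have 1: "r l * D l \<ge> - 1/2 * (D l)\<^sup>2 - 1/2 * (r l)\<^sup>2" using zero_le_power2[of "D l + r l"] by linarith
    have "(r l)\<^sup>2 = 2 * (t\<^sup>2 * (v l)\<^sup>2) + 2 * (S l)\<^sup>2 - (t * v l + S l)\<^sup>2"
      by (simp add: r_def power2_eq_square algebra_simps)
    then have "(r l)\<^sup>2 \<le> 2 * (t\<^sup>2 * (v l)\<^sup>2) + 2 * (S l)\<^sup>2" using zero_le_power2[of "t * v l + S l"] by linarith
    moreover have "t\<^sup>2 * (v l)\<^sup>2 \<le> C\<^sup>2 * (v l)\<^sup>2"
      using power_mono[OF t abs_ge_zero, of 2] by (intro mult_right_mono) auto
    ultimately have "r l * D l \<ge> - 1/2 * (D l)\<^sup>2 - C\<^sup>2 * (v l)\<^sup>2 - (S l)\<^sup>2" using 1 by linarith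
    from mult_left_mono[OF this, of \<delta>] \<delta>
    have 2: "\<delta> * (- 1/2 * (D l)\<^sup>2 - C\<^sup>2 * (v l)\<^sup>2 - (S l)\<^sup>2) \<le> \<delta> * (r l * D l)" by simp
    have "(D l * v l + \<delta> / 2 * (D l)\<^sup>2) + t * (v l)\<^sup>2 - S l * v l - \<delta> * C\<^sup>2 * (v l)\<^sup>2 - \<delta> * (S l)\<^sup>2
      \<le> (D l + t * v l) * (v l + \<delta> * D l) - S l * (v l + \<delta> * D l)"
      using 2 by (simp add: r_def algebra_simps power2_eq_square)
    from mult_left_mono[OF this, of "w l"] w[OF l] show ?thesis by (simp add: algebra_simps)
  qed
  have "(\<Sum>l\<le>L. w l * (D l * v l + (c - 2 * \<delta> * C\<^sup>2) * (v l)\<^sup>2 + \<delta> / 2 * (D l)\<^sup>2)) =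
      (\<Sum>l\<le>L. w l * (D l * v l + \<delta> / 2 * (D l)\<^sup>2)) + (c - 2 * \<delta> * C\<^sup>2) * V"
    by (simp add: V_def sum_distrib_left sum.distrib[symmetric] algebra_simps)
  also have "\<dots> \<le> (\<Sum>l\<le>L. w l * (D l * v l + \<delta> / 2 * (D l)\<^sup>2)) + t * V - (\<Sum>l\<le>L. w l * (S l * v l))
      - \<delta> * C\<^sup>2 * V - \<delta> * (\<Sum>l\<le>L. w l * (S l)\<^sup>2)"
  proof -
    have "\<delta> * (\<Sum>l\<le>L. w l * (S l)\<^sup>2) \<le> \<delta> * C\<^sup>2 * V" using mult_left_mono[OF S2, of \<delta>] \<delta> by (simp add: mult.assoc)
    then show ?thesis using Sv unfolding left_diff_distrib mult.assoc by linarith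
  qed
  also have "\<dots> = (\<Sum>l\<le>L. w l * (D l * v l + \<delta> / 2 * (D l)\<^sup>2) + t * (w l * (v l)\<^sup>2) - w l * (S l * v l)
      - \<delta> * C\<^sup>2 * (w l * (v l)\<^sup>2) - \<delta> * (w l * (S l)\<^sup>2))"
    by (simp only: V_def sum_distrib_left sum.distrib sum_subtractf)
  also have "\<dots> \<le> (\<Sum>l\<le>L. w l * ((D l + t * v l) * (v l + \<delta> * D l) - S l * (v l + \<delta> * D l)))"
    by (intro sum_mono pt) simp
  finally show ?thesis unfolding S_def .
qed

text \<open>Integrability over the two sets is equivalent, and without it both integrals are 0. This
  moves the integrals of the scheme from closed elements to their interiors, where the weak gradient
  is defined.\<close>

lemma set_integral_spike:
  fixes f :: "'a::euclidean_space \<Rightarrow> real"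
  assumes "V \<subseteq> K" "negligible (K - V)"
  shows "(LINT x:K|lebesgue. f x) = (LINT x:V|lebesgue. f x)"
proof -
  have n: "negligible {x \<in> K - V. f x \<noteq> 0}" "negligible {x \<in> V - K. f x \<noteq> 0}"
    using assms by (auto intro: negligible_subset)
  have iff: "f absolutely_integrable_on K \<longleftrightarrow> f absolutely_integrable_on V"
    by (rule absolutely_integrable_spike_set_eq[OF n])
  show ?thesis
  proof (cases "f absolutely_integrable_on K")
    case True
    then show ?thesis using iff integral_spike_set[OF n] by (simp add: set_lebesgue_integral_eq_integral)
  next
    case False
    then show ?thesis using iff
      by (simp add: set_integrable_def set_lebesgue_integral_def not_integrable_integral_eq)
  qed
qed

lemma L2_on_bounded_mult:
  fixes f k :: "'a::euclidean_space \<Rightarrow> real"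
  assumes "L2_on V f" "k \<in> borel_measurable (lebesgue_on V)" "AE x in lebesgue_on V. \<bar>k x\<bar> \<le> C"
  shows "L2_on V (\<lambda>x. k x * f x)"
  unfolding L2_on_def
proof
  show m: "(\<lambda>x. k x * f x) \<in> borel_measurable (lebesgue_on V)" using assms by (auto simp: L2_on_def)
  show "integrable (lebesgue_on V) (\<lambda>x. (k x * f x)\<^sup>2)"
  proof (rule Bochner_Integration.integrable_bound[where f = "\<lambda>x. C\<^sup>2 * (f x)\<^sup>2"])
    show "integrable (lebesgue_on V) (\<lambda>x. C\<^sup>2 * (f x)\<^sup>2)" using assms(1) by (simp add: L2_on_def)
    show "(\<lambda>x. (k x * f x)\<^sup>2) \<in> borel_measurable (lebesgue_on V)" using m by simp
    show "AE x in lebesgue_on V. norm ((k x * f x)\<^sup>2) \<le> norm (C\<^sup>2 * (f x)\<^sup>2)"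
      using assms(3)
    proof eventually_elim
      case (elim x)
      then show ?case using power_mono[OF elim abs_ge_zero, of 2]
        by (simp add: power_mult_distrib mult_right_mono)
    qed
  qed
qed

text \<open>The elements cover the closure of \<open>X\<close>, while the coefficients are
  controlled on \<open>X\<close>; this keeps the interiors of elements inside \<open>X\<close>. At a
  frontier point in the interior of the closure, a direction of increase of the defining function
  would lead to points of the closure where it is positive, although it is at most 0 there.\<close>

lemma interior_closure_smooth_domain:
  fixes X :: "'a::euclidean_space set"
  assumes "open X" "smooth_boundary X"
  shows "interior (closure X) \<subseteq> X"
proof (rule ccontr)
  assume "\<not> interior (closure X) \<subseteq> X"
  then obtain p where p: "p \<in> interior (closure X)" "p \<notin> X" by blast
  have "p \<in> closure X" using p(1) interior_subset by blast
  then have "p \<in> frontier X" using p(2) assms(1) by (simp add: frontier_def interior_open)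
  then obtain U and \<rho> :: "'a \<Rightarrow> real" and D where U: "open U" "p \<in> U" "\<And>k. C_k_on k U \<rho>"
      "(\<rho> has_derivative D) (at p)" "D \<noteq> (\<lambda>_. 0)" "X \<inter> U = {x\<in>U. \<rho> x < 0}"
  proof -
    have "\<exists>U (\<rho> :: 'a \<Rightarrow> real) D. open U \<and> p \<in> U \<and> (\<forall>k. C_k_on k U \<rho>) \<and>
        (\<rho> has_derivative D) (at p) \<and> D \<noteq> (\<lambda>_. 0) \<and> X \<inter> U = {x\<in>U. \<rho> x < 0}"
      using assms(2) \<open>p \<in> frontier X\<close> unfolding smooth_boundary_def by (rule bspec)
    then show thesis by (elim exE conjE) (rule that; simp)
  qed
  have c: "continuous_on U \<rho>" using U(3)[of 0] by simp
  have le0: "\<rho> z \<le> 0" if z: "z \<in> U" "z \<in> closure X" for z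
  proof (rule ccontr)
    assume "\<not> \<rho> z \<le> 0"
    then have "z \<in> U \<inter> \<rho> -` {0<..}" using z(1) by simp
    moreover have "open (U \<inter> \<rho> -` {0<..})"
      using c U(1) by (simp add: continuous_on_open_vimage Int_commute)
    ultimately have "X \<inter> (U \<inter> \<rho> -` {0<..}) \<noteq> {}"
      using z(2) open_Int_closure_eq_empty[of "U \<inter> \<rho> -` {0<..}" X] by blast
    then obtain y where y: "y \<in> X" "y \<in> U" "\<rho> y > 0" by auto
    then have "y \<in> {x\<in>U. \<rho> x < 0}" unfolding U(6)[symmetric] by simp
    then show False using y(3) by simp
  qed
  have "\<rho> p \<ge> 0" using p(2) U(2,6) by (auto simp: not_less[symmetric])
  then have p0: "\<rho> p = 0" using le0[OF U(2) \<open>p \<in> closure X\<close>] by simp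
  have linD: "linear D" using U(4) by (rule has_derivative_linear)
  obtain u where "D u \<noteq> 0" using U(5) by auto
  then obtain u where u: "D u > 0" using linear_neg[OF linD, of u] by (metis neg_0_less_iff_less linorder_neqE_linordered_idom)
  have line: "((\<lambda>t::real. p + t *\<^sub>R u) has_derivative (\<lambda>t. t *\<^sub>R u)) (at 0)"
    by (auto intro!: derivative_eq_intros)
  have "((\<lambda>t. \<rho> (p + t *\<^sub>R u)) has_derivative (\<lambda>t. D (t *\<^sub>R u))) (at 0)"
    using has_derivative_compose[OF line, of \<rho> D] U(4) by simp
  moreover have "(\<lambda>t. D (t *\<^sub>R u)) = (*) (D u)" using linear_scale[OF linD] by (auto simp: fun_eq_iff)
  ultimately have "((\<lambda>t. \<rho> (p + t *\<^sub>R u)) has_real_derivative D u) (at 0)"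
    by (simp only: has_field_derivative_def)
  from DERIV_pos_inc_right[OF this u] obtain d where "d > 0" "\<And>h. h > 0 \<Longrightarrow> h < d \<Longrightarrow> \<rho> (p + h *\<^sub>R u) > 0"
    using p0 by auto
  then have "eventually (\<lambda>t. \<rho> (p + t *\<^sub>R u) > 0) (at_right 0)" unfolding eventually_at_right_field by auto
  moreover have "((\<lambda>t::real. p + t *\<^sub>R u) \<longlongrightarrow> p + 0 *\<^sub>R u) (at_right 0)" by (intro tendsto_intros)
  then have "eventually (\<lambda>t. p + t *\<^sub>R u \<in> U \<inter> interior (closure X)) (at_right 0)"
    using topological_tendstoD[of _ _ _ "U \<inter> interior (closure X)"] U(1,2) p(1) by fastforce
  ultimately have "eventually (\<lambda>t::real. False) (at_right 0)"
  proof eventually_elim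
    case (elim t)
    then show ?case using le0[of "p + t *\<^sub>R u"] interior_subset[of "closure X"] by fastforce
  qed
  then show False by simp
qed

lemma phase_function_measurable:
  fixes X :: "(real^'n) set"
  assumes "phase_function X g" "t \<in> {-1..1}"
  shows "(\<lambda>x. g x t) \<in> borel_measurable (lebesgue_on X)"
proof -
  have 1: "(\<lambda>x. (x, t)) \<in> measurable (lebesgue_on X) (lebesgue_on X \<Otimes>\<^sub>M restrict_space borel {-1..1})"
    by (rule measurable_Pair2') (use assms(2) in \<open>simp add: space_restrict_space\<close>)
  have 2: "(\<lambda>(x, t). g x t) \<in> borel_measurable (lebesgue_on X \<Otimes>\<^sub>M restrict_space borel {-1..1})"
    using assms(1) by (simp add: phase_function_def)
  from measurable_compose[OF 1 2] show ?thesis by simp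
qed

lemma AE_lebesgue_on_subset:
  fixes V X :: "'a::euclidean_space set"
  assumes "AE x in lebesgue_on X. Q x" "V \<subseteq> X" "open V" "open X"
  shows "AE x in lebesgue_on V. Q x"
proof -
  have "AE x in lebesgue. x \<in> X \<longrightarrow> Q x" using assms(1,4) by (subst (asm) AE_restrict_space_iff) auto
  then have "AE x in lebesgue. x \<in> V \<longrightarrow> Q x" by eventually_elim (use assms(2) in blast)
  then show ?thesis using assms(3) by (subst AE_restrict_space_iff) auto
qed

text \<open>\<open>discrete_coercivity\<close> is integrated with the sum over \<open>l\<close>
  inside the integral, since scattering couples the directions and the pointwise bound holds for the
  weighted sum only.\<close>

lemma volume_estimate:
  fixes X :: "(real^'n) set" and \<omega> :: "nat \<Rightarrow> real^'n"
  assumes X: "open X" and \<omega>: "\<And>l. l \<le> L \<Longrightarrow> \<omega> l \<in> sphere 0 1" and w: "\<And>l. l \<le> L \<Longrightarrow> w l > 0"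
    and g: "phase_function X g"
    and \<sigma>t: "\<sigma>t \<in> borel_measurable (lebesgue_on X)" "AE x in lebesgue_on X. \<bar>\<sigma>t x\<bar> \<le> C"
    and \<sigma>s: "\<sigma>s \<in> borel_measurable (lebesgue_on X)" "AE x in lebesgue_on X. \<sigma>s x \<ge> 0"
    and c: "c > 0" "AE x in lebesgue_on X. \<sigma>t x - max_scattering L \<omega> w g x * \<sigma>s x \<ge> c"
    and V: "open V" "V \<subseteq> X" "V \<subseteq> K" "negligible (K - V)"
    and v: "\<And>l. l \<le> L \<Longrightarrow> L2_on V (v l)" and D: "\<And>l. l \<le> L \<Longrightarrow> L2_on V (D l)" and \<delta>: "\<delta> > 0"
  shows "(\<Sum>l\<le>L. w l * ((LINT x:V|lebesgue. v l x * D l x)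
        + (c - 2 * \<delta> * C\<^sup>2) * (l2_norm K (v l))\<^sup>2 + \<delta> / 2 * (l2_norm K (D l))\<^sup>2)) \<le>
    (\<Sum>l\<le>L. w l * l2_inner K (\<lambda>x. D l x + \<sigma>t x * v l x) (\<lambda>x. v l x + \<delta> * D l x))
    - (\<Sum>l\<le>L. w l * l2_inner K (\<lambda>x. \<sigma>s x * (\<Sum>i\<le>L. w i * g x (\<omega> l \<bullet> \<omega> i) * v i x)) (\<lambda>x. v l x + \<delta> * D l x))"
proof -
  let ?M = "lebesgue_on V"
  let ?S = "\<lambda>l x. \<Sum>i\<le>L. w i * g x (\<omega> l \<bullet> \<omega> i) * v i x"
  have Vs: "V \<inter> space lebesgue \<in> sets lebesgue" using V(1) by simp
  have inner: "l2_inner K p q = (LINT x|?M. p x * q x)" for p q :: "real^'n \<Rightarrow> real"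
    unfolding l2_inner_def set_integral_spike[OF V(3,4)]
    using Vs by (simp add: set_lebesgue_integral_def integral_restrict_space)
  have norm2: "(l2_norm K p)\<^sup>2 = (LINT x|?M. (p x)\<^sup>2)" for p :: "real^'n \<Rightarrow> real"
    by (simp add: l2_norm_def inner power2_eq_square)
  have LV: "(LINT x:V|lebesgue. v l x * D l x) = (LINT x|?M. v l x * D l x)" for l
    using Vs by (simp add: set_lebesgue_integral_def integral_restrict_space)
  have ts: "\<omega> l \<bullet> \<omega> i \<in> {-1..1}" if "l \<le> L" "i \<le> L" for l i
    using Cauchy_Schwarz_ineq2[of "\<omega> l" "\<omega> i"] \<omega>[OF that(1)] \<omega>[OF that(2)] by (simp add: abs_le_iff)
  have meas: "k \<in> borel_measurable ?M" if "k \<in> borel_measurable (lebesgue_on X)" for k :: "real^'n \<Rightarrow> real"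
    by (rule measurable_restrict_mono[OF that V(2)])
  have inX: "AE x in ?M. x \<in> X" using V(2) by (intro AE_I2) auto
  note ae = AE_lebesgue_on_subset[OF _ V(2,1) X]
  have tC: "AE x in ?M. \<bar>\<sigma>t x\<bar> \<le> C" by (rule ae[OF \<sigma>t(2)])
  have key: "AE x in ?M. \<sigma>s x \<ge> 0 \<and> \<bar>\<sigma>t x\<bar> \<le> C \<and> (\<forall>l\<le>L. \<forall>i\<le>L. g x (\<omega> l \<bullet> \<omega> i) \<ge> 0) \<and>
      (\<forall>l\<le>L. \<sigma>s x * (\<Sum>i\<le>L. w i * g x (\<omega> l \<bullet> \<omega> i)) \<le> \<sigma>t x - c)"
    using ae[OF \<sigma>s(2)] tC ae[OF c(2)] inX
  proof eventually_elim
    case (elim x)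
    have "\<sigma>s x * (\<Sum>i\<le>L. w i * g x (\<omega> l \<bullet> \<omega> i)) \<le> \<sigma>t x - c" if l: "l \<le> L" for l
    proof -
      have "(\<Sum>i\<le>L. w i * g x (\<omega> l \<bullet> \<omega> i)) \<le> max_scattering L \<omega> w g x"
        unfolding max_scattering_def by (rule Max_ge) (use l in auto)
      from mult_left_mono[OF this elim(1)] show ?thesis using elim(3) by (simp add: mult.commute)
    qed
    then show ?case using elim ts g by (auto simp: phase_function_def)
  qed
  have A: "L2_on V (\<lambda>x. \<sigma>t x * v l x)" if "l \<le> L" for l
    by (rule L2_on_bounded_mult[OF v[OF that] meas[OF \<sigma>t(1)] tC])
  \<comment> \<open>The phase function may be unbounded, but each factor
    \<open>\<sigma>s x * (w i * g x (\<omega> l \<bullet> \<omega> i))\<close> is one nonnegative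
    term of a sum bounded by \<open>\<sigma>t x - c\<close>, hence by \<open>C\<close>.\<close>
  have R: "L2_on V (\<lambda>x. \<sigma>s x * ?S l x)" if l: "l \<le> L" for l
  proof -
    have "L2_on V (\<lambda>x. (\<sigma>s x * (w i * g x (\<omega> l \<bullet> \<omega> i))) * v i x)" if i: "i \<le> L" for i
    proof (rule L2_on_bounded_mult[OF v[OF i]])
      show "(\<lambda>x. \<sigma>s x * (w i * g x (\<omega> l \<bullet> \<omega> i))) \<in> borel_measurable ?M"
        using meas[OF \<sigma>s(1)] meas[OF phase_function_measurable[OF g ts[OF l i]]] by simp
      show "AE x in ?M. \<bar>\<sigma>s x * (w i * g x (\<omega> l \<bullet> \<omega> i))\<bar> \<le> C"
        using key
      proof eventually_elim
        case (elim x)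
        have nn: "w j * g x (\<omega> l \<bullet> \<omega> j) \<ge> 0" if "j \<le> L" for j using elim l that w[OF that] by simp
        have "w i * g x (\<omega> l \<bullet> \<omega> i) \<le> (\<Sum>i\<le>L. w i * g x (\<omega> l \<bullet> \<omega> i))"
          using i nn by (intro member_le_sum) auto
        then have "\<sigma>s x * (w i * g x (\<omega> l \<bullet> \<omega> i)) \<le> \<sigma>s x * (\<Sum>i\<le>L. w i * g x (\<omega> l \<bullet> \<omega> i))"
          using elim by (intro mult_left_mono) auto
        moreover have "\<dots> \<le> C" using elim l c(1) by fastforce
        moreover have "0 \<le> \<sigma>s x * (w i * g x (\<omega> l \<bullet> \<omega> i))" using elim nn[OF i] by simp
        ultimately show ?case by simp
      qed
    qed
    then have "L2_on V (\<lambda>x. \<Sum>i\<le>L. (\<sigma>s x * (w i * g x (\<omega> l \<bullet> \<omega> i))) * v i x)"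
      by (intro L2_on_sum) auto
    then show ?thesis by (simp add: sum_distrib_left mult.assoc)
  qed
  have T: "L2_on V (\<lambda>x. v l x + \<delta> * D l x)" "L2_on V (\<lambda>x. D l x + \<sigma>t x * v l x)" if "l \<le> L" for l
    by (rule L2_on_add[OF v[OF that] L2_on_cmult[OF D[OF that]]], rule L2_on_add[OF D[OF that] A[OF that]])
  have i1: "integrable ?M (\<lambda>x. (D l x + \<sigma>t x * v l x) * (v l x + \<delta> * D l x))"
    and i2: "integrable ?M (\<lambda>x. (\<sigma>s x * ?S l x) * (v l x + \<delta> * D l x))"
    and i3: "integrable ?M (\<lambda>x. v l x * D l x)" "integrable ?M (\<lambda>x. (v l x)\<^sup>2)" "integrable ?M (\<lambda>x. (D l x)\<^sup>2)" if "l \<le> L" for l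
  proof -
    show "integrable ?M (\<lambda>x. (D l x + \<sigma>t x * v l x) * (v l x + \<delta> * D l x))" by (rule L2_on_integrable[OF T(2)[OF that] T(1)[OF that]])
    show "integrable ?M (\<lambda>x. (\<sigma>s x * ?S l x) * (v l x + \<delta> * D l x))" by (rule L2_on_integrable[OF R[OF that] T(1)[OF that]])
    show "integrable ?M (\<lambda>x. v l x * D l x)" by (rule L2_on_integrable[OF v[OF that] D[OF that]])
    show "integrable ?M (\<lambda>x. (v l x)\<^sup>2)" "integrable ?M (\<lambda>x. (D l x)\<^sup>2)"
      using v[OF that] D[OF that] by (simp_all add: L2_on_def)
  qed
  have "(\<Sum>l\<le>L. w l * ((LINT x:V|lebesgue. v l x * D l x) + (c - 2 * \<delta> * C\<^sup>2) * (l2_norm K (v l))\<^sup>2 + \<delta> / 2 * (l2_norm K (D l))\<^sup>2))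
      = (LINT x|?M. (\<Sum>l\<le>L. w l * (D l x * v l x + (c - 2 * \<delta> * C\<^sup>2) * (v l x)\<^sup>2 + \<delta> / 2 * (D l x)\<^sup>2)))"
  proof -
    have "(LINT x|?M. (\<Sum>l\<le>L. w l * (D l x * v l x + (c - 2 * \<delta> * C\<^sup>2) * (v l x)\<^sup>2 + \<delta> / 2 * (D l x)\<^sup>2))) =
        (\<Sum>l\<le>L. LINT x|?M. w l * (v l x * D l x + (c - 2 * \<delta> * C\<^sup>2) * (v l x)\<^sup>2 + \<delta> / 2 * (D l x)\<^sup>2))"
      using i3 by (subst Bochner_Integration.integral_sum) (auto simp: mult.commute)
    also have "\<dots> = (\<Sum>l\<le>L. w l * ((LINT x|?M. v l x * D l x) + (c - 2 * \<delta> * C\<^sup>2) * (LINT x|?M. (v l x)\<^sup>2) + \<delta> / 2 * (LINT x|?M. (D l x)\<^sup>2)))"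
      using i3 by (intro sum.cong refl) simp
    finally show ?thesis by (simp add: LV norm2)
  qed
  also have "\<dots> \<le> (LINT x|?M. (\<Sum>l\<le>L. w l * ((D l x + \<sigma>t x * v l x) * (v l x + \<delta> * D l x) - (\<sigma>s x * ?S l x) * (v l x + \<delta> * D l x))))"
  proof (rule integral_mono_AE)
    show "integrable ?M (\<lambda>x. \<Sum>l\<le>L. w l * (D l x * v l x + (c - 2 * \<delta> * C\<^sup>2) * (v l x)\<^sup>2 + \<delta> / 2 * (D l x)\<^sup>2))"
      using i3 by (intro Bochner_Integration.integrable_sum) (auto simp: mult.commute)
    show "integrable ?M (\<lambda>x. \<Sum>l\<le>L. w l * ((D l x + \<sigma>t x * v l x) * (v l x + \<delta> * D l x) - (\<sigma>s x * ?S l x) * (v l x + \<delta> * D l x)))"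
      using i1 i2 by (intro Bochner_Integration.integrable_sum integrable_mult_right Bochner_Integration.integrable_diff) auto
    show "AE x in ?M. (\<Sum>l\<le>L. w l * (D l x * v l x + (c - 2 * \<delta> * C\<^sup>2) * (v l x)\<^sup>2 + \<delta> / 2 * (D l x)\<^sup>2)) \<le>
        (\<Sum>l\<le>L. w l * ((D l x + \<sigma>t x * v l x) * (v l x + \<delta> * D l x) - (\<sigma>s x * ?S l x) * (v l x + \<delta> * D l x)))"
      using key
    proof eventually_elim
      case (elim x)
      show ?case
        by (rule discrete_coercivity) (use elim w c \<delta> in \<open>auto simp: inner_commute\<close>)
    qed
  qed
  also have "\<dots> = (\<Sum>l\<le>L. LINT x|?M. w l * ((D l x + \<sigma>t x * v l x) * (v l x + \<delta> * D l x) - (\<sigma>s x * ?S l x) * (v l x + \<delta> * D l x)))"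
    using i1 i2 by (intro Bochner_Integration.integral_sum integrable_mult_right Bochner_Integration.integrable_diff) auto
  also have "\<dots> = (\<Sum>l\<le>L. w l * (LINT x|?M. (D l x + \<sigma>t x * v l x) * (v l x + \<delta> * D l x)) - w l * (LINT x|?M. (\<sigma>s x * ?S l x) * (v l x + \<delta> * D l x)))"
  proof (rule sum.cong[OF refl])
    fix l assume "l \<in> {..L}"
    then have l: "l \<le> L" by simp
    have "(LINT x|?M. (D l x + \<sigma>t x * v l x) * (v l x + \<delta> * D l x) - (\<sigma>s x * ?S l x) * (v l x + \<delta> * D l x)) =
      (LINT x|?M. (D l x + \<sigma>t x * v l x) * (v l x + \<delta> * D l x)) - (LINT x|?M. (\<sigma>s x * ?S l x) * (v l x + \<delta> * D l x))"
      by (rule Bochner_Integration.integral_diff[OF i1[OF l] i2[OF l]])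
    then show "(LINT x|?M. w l * ((D l x + \<sigma>t x * v l x) * (v l x + \<delta> * D l x) - (\<sigma>s x * ?S l x) * (v l x + \<delta> * D l x))) =
      w l * (LINT x|?M. (D l x + \<sigma>t x * v l x) * (v l x + \<delta> * D l x)) - w l * (LINT x|?M. (\<sigma>s x * ?S l x) * (v l x + \<delta> * D l x))"
      unfolding integral_mult_right_zero by (simp only: right_diff_distrib)
  qed
  finally show ?thesis unfolding inner sum_subtractf .
qed

section \<open>Coercivity of the scheme\<close>

text \<open>One mesh at a time: smallness of the mesh enters only as
  \<open>3 * \<delta> * C\<^sup>2 \<le> c\<close>. Volume estimates come per element, summed over
  directions, and surface estimates per direction, summed over elements.\<close>

lemma mesh_coercivity:
  fixes X :: "(real^'n::{finite,wellorder}) set" and \<omega> :: "nat \<Rightarrow> real^'n::_"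
    and g :: "real^'n::_ \<Rightarrow> real \<Rightarrow> real" and T :: "(real^'n::_) element set"
  assumes X: "bounded_smooth_domain X" and \<omega>: "\<And>l. l \<le> L \<Longrightarrow> \<omega> l \<in> sphere 0 1" and w: "\<And>l. l \<le> L \<Longrightarrow> w l > 0"
    and g: "phase_function X g"
    and \<sigma>t: "\<sigma>t \<in> borel_measurable (lebesgue_on X)" "AE x in lebesgue_on X. \<bar>\<sigma>t x\<bar> \<le> C"
    and \<sigma>s: "\<sigma>s \<in> borel_measurable (lebesgue_on X)" "AE x in lebesgue_on X. \<sigma>s x \<ge> 0"
    and c: "c > 0" "AE x in lebesgue_on X. \<sigma>t x - max_scattering L \<omega> w g x * \<sigma>s x \<ge> c"
    and T: "fe_partition X T"
    and ori: "\<And>l E e. l \<le> L \<Longrightarrow> E \<in> T \<Longrightarrow> e \<in> faces E \<Longrightarrow> incoming_face (\<omega> l) E e \<or> outgoing_face (\<omega> l) E e"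
    and v: "\<And>l. l \<le> L \<Longrightarrow> v l \<in> broken_space X T" and \<delta>: "\<delta> > 0" "3 * \<delta> * C\<^sup>2 \<le> c"
  shows "scheme_norm_sq X L \<omega> w c T \<delta> v \<le> 3 * scheme_form X L \<omega> w g \<sigma>t \<sigma>s T \<delta> v v"
proof -
  have oX: "open X" and sX: "interior (closure X) \<subseteq> X"
    using X interior_closure_smooth_domain by (auto simp: bounded_smooth_domain_def)
  define vol where "vol = (\<lambda>l E. LINT x:interior (body E)|lebesgue. v l x * dir_deriv (\<omega> l) E (v l) x)"
  define nv where "nv = (\<lambda>l E. (l2_norm (body E) (v l))\<^sup>2)"
  define nd where "nd = (\<lambda>l E. (l2_norm (body E) (dir_deriv (\<omega> l) E (v l)))\<^sup>2)"
  define a1 where "a1 = (\<lambda>l E. l2_inner (body E) (\<lambda>x. dir_deriv (\<omega> l) E (v l) x + \<sigma>t x * v l x)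
        (\<lambda>x. v l x + \<delta> * dir_deriv (\<omega> l) E (v l) x))"
  define a3 where "a3 = (\<lambda>l E. l2_inner (body E) (\<lambda>x. \<sigma>s x * (\<Sum>i\<le>L. w i * g x (\<omega> l \<bullet> \<omega> i) * v i x))
        (\<lambda>x. v l x + \<delta> * dir_deriv (\<omega> l) E (v l) x))"
  define a2 where "a2 = (\<lambda>l. \<Sum>E\<in>T. \<Sum>e | e \<in> faces E \<and> incoming_face (\<omega> l) E e. face_inner E e
        (jump X T E e (v l)) (\<lambda>x. restr E (v l) x * \<bar>\<omega> l \<bullet> outward_normal (body E) x\<bar>))"
  define B where "B = (\<lambda>l. \<Sum>E\<in>T. \<Sum>e | e \<in> faces E \<and> outgoing_face (\<omega> l) E e \<and> open_face E e \<subseteq> outflow_boundary (\<omega> l) X.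
      face_inner E e (restr E (v l)) (\<lambda>x. restr E (v l) x * (\<omega> l \<bullet> outward_normal (body E) x)))"
  define Jm where "Jm = (\<lambda>l. \<Sum>E\<in>T. \<Sum>e | e \<in> faces E \<and> incoming_face (\<omega> l) E e.
      face_inner E e (jump X T E e (v l)) (\<lambda>x. jump X T E e (v l) x * \<bar>\<omega> l \<bullet> outward_normal (body E) x\<bar>))"
  \<comment> \<open>Direction 0 is always in range, and its orientation of the faces already
    supplies normals.\<close>
  have normals: "has_normals E e" if "E \<in> T" "e \<in> faces E" for E e
    using ori[OF le0 that] face_orientation_normals by blast
  have volE: "(\<Sum>l\<le>L. w l * (vol l E + (c - 2 * \<delta> * C\<^sup>2) * nv l E + \<delta> / 2 * nd l E)) \<le>
      (\<Sum>l\<le>L. w l * a1 l E) - (\<Sum>l\<le>L. w l * a3 l E)" if E: "E \<in> T" for E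
  proof -
    obtain U where "curved_element E U" by (rule fe_partition_element[OF T E])
    then interpret curved_element E U .
    have "(\<Union>E\<in>T. body E) = closure X" using T by (simp add: fe_partition_def)
    then have "body E \<subseteq> closure X" using E by blast
    then have sub: "interior (body E) \<subseteq> X" using interior_mono sX by blast
    have vL: "L2_on (interior (body E)) (v l)" if "l \<le> L" for l
      using restr_props(3)[OF v[OF that] E] by (simp add: H1_on_def)
    have dL: "L2_on (interior (body E)) (dir_deriv (\<omega> l) E (v l))" if "l \<le> L" for l
      by (rule green_square(2)[OF normals[OF E] restr_props[OF v[OF that] E]])
    show ?thesis
      unfolding vol_def nv_def nd_def a1_def a3_def
      by (rule volume_estimate[OF oX \<omega> w g \<sigma>t \<sigma>s c open_interior sub interior_subset negligible_boundary_K vL dL \<delta>(1)])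
  qed
  have surf: "1/2 * (B l + Jm l) \<le> (\<Sum>E\<in>T. vol l E) + a2 l" "0 \<le> B l" "0 \<le> Jm l" if l: "l \<le> L" for l
  proof -
    have n: "norm (\<omega> l) \<le> 1" using \<omega>[OF l] by simp
    show "1/2 * (B l + Jm l) \<le> (\<Sum>E\<in>T. vol l E) + a2 l"
      unfolding B_def Jm_def vol_def a2_def by (rule surface_estimate(1)[OF T v[OF l] n ori[OF l]])
    show "0 \<le> B l" unfolding B_def by (rule surface_estimate(2)[OF T v[OF l] n ori[OF l]])
    show "0 \<le> Jm l" unfolding Jm_def by (rule surface_estimate(3)[OF T v[OF l] n ori[OF l]])
  qed
  have n0: "nv l E \<ge> 0" "nd l E \<ge> 0" for l E by (simp_all add: nv_def nd_def)
  have form: "scheme_form X L \<omega> w g \<sigma>t \<sigma>s T \<delta> v v =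
      (\<Sum>E\<in>T. (\<Sum>l\<le>L. w l * a1 l E) - (\<Sum>l\<le>L. w l * a3 l E)) + (\<Sum>l\<le>L. w l * a2 l)"
  proof -
    have "(\<Sum>E\<in>T. (\<Sum>l\<le>L. w l * h l E)) = (\<Sum>l\<le>L. w l * (\<Sum>E\<in>T. h l E))" for h :: "nat \<Rightarrow> (real^'n::_) element \<Rightarrow> real"
      by (subst sum.swap) (simp add: sum_distrib_left)
    then show ?thesis
      unfolding sum_subtractf by (simp add: scheme_form_def a1_def a2_def a3_def)
  qed
  have norm: "scheme_norm_sq X L \<omega> w c T \<delta> v = (\<Sum>l\<le>L. w l * ((\<Sum>E\<in>T. c * nv l E) + B l + \<delta> * (\<Sum>E\<in>T. nd l E) + Jm l))"
    unfolding scheme_norm_sq_def nv_def nd_def B_def Jm_def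
    by (simp only: distrib_left sum.distrib sum_distrib_left[of \<delta>] mult.left_commute[of \<delta>])
  also have "\<dots> \<le> (\<Sum>l\<le>L. 3 * (w l * ((\<Sum>E\<in>T. vol l E) + a2 l + (\<Sum>E\<in>T. (c - 2 * \<delta> * C\<^sup>2) * nv l E + \<delta> / 2 * nd l E))))"
  proof (rule sum_mono)
    fix l assume "l \<in> {..L}"
    then have l: "l \<le> L" by simp
    have "c * nv l E + \<delta> * nd l E \<le> 3 * ((c - 2 * \<delta> * C\<^sup>2) * nv l E + \<delta> / 2 * nd l E)" for E
    proof -
      \<comment> \<open>\<open>c \<le> 3 * (c - 2 * \<delta> * C\<^sup>2)\<close> is the smallness
        assumption rearranged; the factor 3 of the theorem originates here.\<close>
      have "c * nv l E \<le> (3 * (c - 2 * \<delta> * C\<^sup>2)) * nv l E"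
        using \<delta>(2) n0(1) by (intro mult_right_mono) auto
      moreover have "\<delta> * nd l E \<le> (3 * (\<delta> / 2)) * nd l E"
        using \<delta>(1) n0(2) by (intro mult_right_mono) auto
      ultimately have "c * nv l E + \<delta> * nd l E \<le> 3 * (c - 2 * \<delta> * C\<^sup>2) * nv l E + 3 * (\<delta> / 2) * nd l E"
        by (rule add_mono)
      then show ?thesis by (simp only: distrib_left mult.assoc)
    qed
    then have "(\<Sum>E\<in>T. c * nv l E + \<delta> * nd l E) \<le> (\<Sum>E\<in>T. 3 * ((c - 2 * \<delta> * C\<^sup>2) * nv l E + \<delta> / 2 * nd l E))"
      by (rule sum_mono)
    then have "(\<Sum>E\<in>T. c * nv l E) + \<delta> * (\<Sum>E\<in>T. nd l E) \<le> 3 * (\<Sum>E\<in>T. (c - 2 * \<delta> * C\<^sup>2) * nv l E + \<delta> / 2 * nd l E)"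
      by (simp only: sum.distrib sum_distrib_left[of \<delta>] sum_distrib_left[of 3, symmetric])
    \<comment> \<open>Three times the surface estimate gives 3/2 of \<open>B l + Jm l\<close>, and
      both terms are nonnegative.\<close>
    then have "(\<Sum>E\<in>T. c * nv l E) + B l + \<delta> * (\<Sum>E\<in>T. nd l E) + Jm l \<le>
        3 * ((\<Sum>E\<in>T. vol l E) + a2 l + (\<Sum>E\<in>T. (c - 2 * \<delta> * C\<^sup>2) * nv l E + \<delta> / 2 * nd l E))"
      using surf[OF l] by argo
    from mult_left_mono[OF this, of "w l"] w[OF l]
    show "w l * ((\<Sum>E\<in>T. c * nv l E) + B l + \<delta> * (\<Sum>E\<in>T. nd l E) + Jm l) \<le>
      3 * (w l * ((\<Sum>E\<in>T. vol l E) + a2 l + (\<Sum>E\<in>T. (c - 2 * \<delta> * C\<^sup>2) * nv l E + \<delta> / 2 * nd l E)))"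
      by (simp only: mult.left_commute less_imp_le)
  qed
  also have "\<dots> = 3 * ((\<Sum>E\<in>T. \<Sum>l\<le>L. w l * (vol l E + (c - 2 * \<delta> * C\<^sup>2) * nv l E + \<delta> / 2 * nd l E)) + (\<Sum>l\<le>L. w l * a2 l))"
  proof -
    have "(\<Sum>E\<in>T. \<Sum>l\<le>L. w l * (vol l E + (c - 2 * \<delta> * C\<^sup>2) * nv l E + \<delta> / 2 * nd l E)) =
      (\<Sum>l\<le>L. w l * ((\<Sum>E\<in>T. vol l E) + (\<Sum>E\<in>T. (c - 2 * \<delta> * C\<^sup>2) * nv l E + \<delta> / 2 * nd l E)))"
      by (subst sum.swap) (simp only: sum_distrib_left[symmetric] sum.distrib[symmetric] add.assoc)
    then show ?thesis by (simp only: sum_distrib_left[of 3, symmetric] sum.distrib[symmetric] distrib_left[symmetric] add_ac)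
  qed
  also have "\<dots> \<le> 3 * scheme_form X L \<omega> w g \<sigma>t \<sigma>s T \<delta> v v"
    unfolding form by (intro mult_left_mono add_right_mono sum_mono volE) auto
  finally show ?thesis .
qed

theorem lemma4p2:
  fixes X :: "(real^'n::{finite,wellorder}) set"
    and L :: nat
    and \<omega> :: "nat \<Rightarrow> real^'n::_"
    and w :: "nat \<Rightarrow> real"
    and g :: "real^'n::_ \<Rightarrow> real \<Rightarrow> real"
    and \<sigma>t \<sigma>s :: "real^'n::_ \<Rightarrow> real"
    and c0 c0' cbar :: real
    and H :: "real set"
    and T :: "real \<Rightarrow> (real^'n::_) element set"
  assumes "CARD('n) = 2 \<or> CARD('n) = 3"
    and "bounded_smooth_domain X"
    and "\<And>l. l \<le> L \<Longrightarrow> \<omega> l \<in> sphere 0 1"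
    and "\<And>l. l \<le> L \<Longrightarrow> w l > 0"
    and "phase_function X g"
    and "Linf_on X \<sigma>t" and "Linf_on X \<sigma>s"
    and "AE x in lebesgue_on X. \<sigma>s x \<ge> 0"
    and "c0 > 0" and "AE x in lebesgue_on X. \<sigma>t x - \<sigma>s x \<ge> c0"
    and "c0' > 0" and "AE x in lebesgue_on X. \<sigma>t x - max_scattering L \<omega> w g x * \<sigma>s x \<ge> c0'"
    and "regular_family X H T"
    and "\<And>h l E e. h \<in> H \<Longrightarrow> l \<le> L \<Longrightarrow> E \<in> T h \<Longrightarrow> e \<in> faces E \<Longrightarrow>
           incoming_face (\<omega> l) E e \<or> outgoing_face (\<omega> l) E e"
    and "cbar > 0"
  shows "\<exists>h0>0. \<forall>h\<in>H. h < h0 \<longrightarrow>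
           (\<forall>v. (\<forall>l\<le>L. v l \<in> broken_space X (T h)) \<longrightarrow>
              scheme_norm_sq X L \<omega> w c0' (T h) (cbar * h) v
                \<le> 3 * scheme_form X L \<omega> w g \<sigma>t \<sigma>s (T h) (cbar * h) v v)"
proof -
  obtain C0 where C0: "AE x in lebesgue_on X. \<bar>\<sigma>t x\<bar> \<le> C0" using assms(6) by (auto simp: Linf_on_def)
  \<comment> \<open>An essential bound of \<sigma>_t, enlarged to be positive because it appears in
    the denominator of \<open>h0\<close>.\<close>
  define C where "C = max C0 1"
  have C: "C > 0" "AE x in lebesgue_on X. \<bar>\<sigma>t x\<bar> \<le> C"
    using C0 by (auto simp: C_def elim: eventually_mono)
  have m: "\<sigma>t \<in> borel_measurable (lebesgue_on X)" "\<sigma>s \<in> borel_measurable (lebesgue_on X)"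
    using assms(6,7) by (auto simp: Linf_on_def)
  \<comment> \<open>The mesh size at which \<open>3 * (cbar * h) * C\<^sup>2\<close> reaches
    \<open>c0'\<close>.\<close>
  define h0 where "h0 = c0' / (3 * cbar * C\<^sup>2)"
  show ?thesis
  proof (intro exI[of _ h0] conjI ballI impI allI)
    show "h0 > 0" using assms(11,15) C(1) by (simp add: h0_def)
    fix h v assume h: "h \<in> H" "h < h0" and v: "\<forall>l\<le>L. v l \<in> broken_space X (T h)"
    have hp: "h > 0" "fe_partition X (T h)" using assms(13) h(1) by (auto simp: regular_family_def)
    have small: "3 * (cbar * h) * C\<^sup>2 \<le> c0'" using h(2) assms(15) C(1) by (simp add: h0_def field_simps)
    show "scheme_norm_sq X L \<omega> w c0' (T h) (cbar * h) v \<le> 3 * scheme_form X L \<omega> w g \<sigma>t \<sigma>s (T h) (cbar * h) v v"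
      by (rule mesh_coercivity[OF assms(2-5) m(1) C(2) m(2) assms(8,11,12) hp(2) assms(14)[OF h(1)] v[rule_format]
            mult_pos_pos[OF assms(15) hp(1)] small])
  qed
qed

end
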